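(* Let $TM\simeq S^k(E)$ be a $GL(2)$-structure on an even-dimensional smooth manifold $M$ (of dimension $k+1$) and assume that the almost-complex structure $\mathfrak{J}_\phi$ on $B(E)/CO(2)$ defined by a $GL(2)$-connection $\phi$ is integrable. Then any holomorphic section $\sigma:M\to B(E)/CO(2)$ is a complex structure on $M$; that is, the almost-complex structure $\mathfrak{J}^\sigma_\phi$ on $M$ determined by $\sigma$ is integrable.
   Context: $\mathcal{H}_k$ is the real vector space of homogeneous polynomials of degree $k$ in $x,y$, with basis of monomials $(x^k,x^{k-1}y,\ldots,y^k)$ and right action of $GL(2)=GL(2,\mathbb{R})$ given by $(V\cdot g)(x,y)=V((x,y)g)$; $\rho_k(g)$ denotes the matrix of $V\mapsto V\cdot g$ in the monomial basis. A $GL(2)$-structure on a manifold $M$ of dimension $k+1$ is an isomorphism of vector bundles $TM\simeq S^k(E)$, where $E\to M$ is a real rank-2 vector bundle. $\pi:B(E)\to M$ is the bundle of frames of $TM$ of the form $\chi=(x^k,x^{k-1}y,\ldots,y^k)$, where $(x,y)$ is a basis of $E_p$; $GL(2)$ acts on it on the right via $(x,y)\mapsto(x,y)g$, i.e. $\chi\mapsto\chi\rho_k(g)$. $CO(2)\subset GL(2)$ is the subgroup of matrices $\begin{pmatrix}u&-v\\ v&u\end{pmatrix}$ with $u^2+v^2\neq0$. $\omega=(\omega^0,\ldots,\omega^k)^t$ is the $\mathcal{H}_k$-valued soldering form on $B(E)$: $\pi_*v=\sum_i x^{k-i}y^i\,\omega^i(v)$ at $\chi$. A $GL(2)$-connection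 is given by a $\mathfrak{gl}(2)$-valued $1$-form $\phi=\begin{pmatrix}\phi^1_1&\phi^2_1\\\phi^1_2&\phi^2_2\end{pmatrix}$ on $B(E)$ whose image $\Phi$ under $d\rho_k$ is a principal connection form. For $j=0,\ldots,\lfloor k/2\rfloor$ ($k$ odd) let $V^{even}_{k,j}$, $V^{odd}_{k,j}$ be the real and imaginary parts of $(x^2+y^2)^j(x+\mathrm{i}y)^{k-2j}$; these form a basis of $\mathcal{H}_k$. Let $(\xi^{k,j}_{even},\xi^{k,j}_{odd})$ be the dual basis and $\xi^{k,j}=\xi^{k,j}_{even}+\mathrm{i}\xi^{k,j}_{odd}$, regarded also as complex-valued horizontal $1$-forms on $B(E)$ by composing with $\omega$. Let $\zeta=(\phi^1_2+\phi^2_1)+\mathrm{i}(\phi^2_2-\phi^1_1)$. $\mathfrak{J}_\phi$ is the almost-complex structure on $B(E)/CO(2)$ whose $(1,0)$-forms are those whose pullbacks to $B(E)$ are linear combinations of $\xi^{k,0},\ldots,\xi^{k,\lfloor k/2\rfloor},\zeta$. $\mathfrak{J}^k$ is the complex structure on $\mathcal{H}_k$ with $\mathfrak{J}^k(V^{even}_{k,j})=V^{odd}_{k,j}$, $\mathfrak{J}^k(V^{odd}_{k,j})=-V^{even}_{k,j}$; it commutes with the action of $CO(2)$. A section $\sigma:M\to B(E)/CO(2)$ determines an almost-complex structure $\mathfrak{J}^\sigma_\phi$ on $M$: on $T_pM$ it is $\mathfrak{J}^k$ transported via the identification $T_pM\simeq\mathcal{H}_k$ given by any frame $\chi\in B(E)_p$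 representing $\sigma(p)$ (the result does not depend on the representative). A smooth section $\sigma$ is called holomorphic if its image $\sigma(M)$ is a $\mathfrak{J}_\phi$-complex submanifold of $B(E)/CO(2)$, i.e. its tangent spaces are $\mathfrak{J}_\phi$-invariant; equivalently, $\sigma$ is a holomorphic map from $(M,\mathfrak{J}^\sigma_\phi)$ to $(B(E)/CO(2),\mathfrak{J}_\phi)$. *)

theory Defs
  imports "HOL-Analysis.Analysis" "HOL-Library.Function_Algebras"
begin

text \<open>Pointwise vector space structure on functions; it is used for tangent vectors, for symmetric
  powers and for polynomial functions.\<close>

instantiation "fun" :: (type, scaleR) scaleR
begin
definition scaleR_fun_def: "r *\<^sub>R f = (\<lambda>x. r *\<^sub>R f x)"
instance ..
end

instance "fun" :: (type, real_vector) real_vector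
  by standard (simp_all add: scaleR_fun_def fun_eq_iff scaleR_add_right scaleR_add_left)

definition linear_on :: "'v::real_vector set \<Rightarrow> ('v \<Rightarrow> 'w::real_vector) \<Rightarrow> bool" where
  "linear_on S f \<longleftrightarrow>
     (\<forall>x\<in>S. \<forall>y\<in>S. f (x + y) = f x + f y) \<and> (\<forall>r. \<forall>x\<in>S. f (r *\<^sub>R x) = r *\<^sub>R f x)"


section \<open>Smooth manifolds\<close>

text \<open>\<open>Ck_on n S f\<close> (for open \<open>S\<close>): \<open>f\<close> is \<open>n\<close> times continuously differentiable on \<open>S\<close>.\<close>

fun Ck_on :: "nat \<Rightarrow> 'a::euclidean_space set \<Rightarrow> ('a \<Rightarrow> 'b::euclidean_space) \<Rightarrow> bool" where
  "Ck_on 0 S f \<longleftrightarrow> continuous_on S f"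
| "Ck_on (Suc n) S f \<longleftrightarrow>
     (\<forall>x\<in>S. f differentiable (at x)) \<and> (\<forall>v. Ck_on n S (\<lambda>x. frechet_derivative f (at x) v))"

definition smooth_on :: "'a::euclidean_space set \<Rightarrow> ('a \<Rightarrow> 'b::euclidean_space) \<Rightarrow> bool" where
  "smooth_on S f \<longleftrightarrow> (\<forall>n. Ck_on n S f)"

text \<open>A chart is a pair of a domain and a coordinate map, and a manifold is given by an atlas.\<close>

type_synonym ('p, 'e) chart = "'p set \<times> ('p \<Rightarrow> 'e)"

definition chart_inv :: "('p, 'e) chart \<Rightarrow> 'e \<Rightarrow> 'p" where
  "chart_inv c = inv_into (fst c) (snd c)"

definition transition :: "('p, 'e) chart \<Rightarrow> ('p, 'e) chart \<Rightarrow> 'e \<Rightarrow> 'e" where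
  "transition c d = snd d \<circ> chart_inv c"

definition points :: "('p, 'e) chart set \<Rightarrow> 'p set" where
  "points A = \<Union> (fst ` A)"

definition smooth_atlas :: "('p, 'e::euclidean_space) chart set \<Rightarrow> bool" where
  "smooth_atlas A \<longleftrightarrow>
     (\<forall>c\<in>A. inj_on (snd c) (fst c) \<and> open (snd c ` fst c)) \<and>
     (\<forall>c\<in>A. \<forall>d\<in>A. open (snd c ` (fst c \<inter> fst d)) \<and>
        smooth_on (snd c ` (fst c \<inter> fst d)) (transition c d))"

definition atlas_topology :: "('p, 'e::euclidean_space) chart set \<Rightarrow> 'p topology" where
  "atlas_topology A =
     topology (\<lambda>W. W \<subseteq> points A \<and> (\<forall>c\<in>A. open (snd c ` (fst c \<inter> W))))"

definition smooth_manifold :: "('p, 'e::euclidean_space) chart set \<Rightarrow> bool" where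
  "smooth_manifold A \<longleftrightarrow> smooth_atlas A \<and>
     Hausdorff_space (atlas_topology A) \<and> second_countable (atlas_topology A)"

text \<open>Membership of a chart in the maximal atlas.\<close>

definition compatible_chart :: "('p, 'e::euclidean_space) chart set \<Rightarrow> ('p, 'e) chart \<Rightarrow> bool" where
  "compatible_chart A c \<longleftrightarrow> fst c \<subseteq> points A \<and> smooth_atlas (insert c A)"

definition chart_at :: "('p, 'e) chart set \<Rightarrow> 'p \<Rightarrow> ('p, 'e) chart" where
  "chart_at A p = (SOME c. c \<in> A \<and> p \<in> fst c)"

definition smooth_map ::
  "('p, 'e::euclidean_space) chart set \<Rightarrow> ('q, 'f::euclidean_space) chart set \<Rightarrow> ('p \<Rightarrow> 'q) \<Rightarrow> bool" where
  "smooth_map A B f \<longleftrightarrow> f ` points A \<subseteq> points B \<and>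
     (\<forall>c\<in>A. \<forall>d\<in>B. open (snd c ` (fst c \<inter> f -` fst d)) \<and>
        smooth_on (snd c ` (fst c \<inter> f -` fst d)) (snd d \<circ> f \<circ> chart_inv c))"

definition smooth_fun_on ::
  "('p, 'e::euclidean_space) chart set \<Rightarrow> 'p set \<Rightarrow> ('p \<Rightarrow> 'f::euclidean_space) \<Rightarrow> bool" where
  "smooth_fun_on A W f \<longleftrightarrow> (\<forall>c\<in>A. smooth_on (snd c ` (fst c \<inter> W)) (f \<circ> chart_inv c))"


section \<open>Tangent vectors\<close>

text \<open>A tangent vector at \<open>p\<close> is the family of its coordinate vectors in the charts around \<open>p\<close>,
  related by the derivatives of the transition maps (and \<open>0\<close> on everything else).\<close>

type_synonym ('p, 'e) tvec = "('p, 'e) chart \<Rightarrow> 'e"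

definition tangent_space ::
  "('p, 'e::euclidean_space) chart set \<Rightarrow> 'p \<Rightarrow> ('p, 'e) tvec set" where
  "tangent_space A p = {v.
     (\<forall>c. \<not> (c \<in> A \<and> p \<in> fst c) \<longrightarrow> v c = 0) \<and>
     (\<forall>c\<in>A. \<forall>d\<in>A. p \<in> fst c \<and> p \<in> fst d \<longrightarrow>
        v d = frechet_derivative (transition c d) (at (snd c p)) (v c))}"

text \<open>The tangent vector at \<open>p\<close> with coordinates \<open>e\<close> in the chart \<open>c\<close>.\<close>

definition coord_vec ::
  "('p, 'e::euclidean_space) chart set \<Rightarrow> ('p, 'e) chart \<Rightarrow> 'p \<Rightarrow> 'e \<Rightarrow> ('p, 'e) tvec" where
  "coord_vec A c p e = (\<lambda>d. if d \<in> A \<and> p \<in> fst d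
     then frechet_derivative (transition c d) (at (snd c p)) e else 0)"

text \<open>The coordinates of \<open>v\<close> at \<open>p\<close> in a chart \<open>c\<close> of the maximal atlas.\<close>

definition vec_coords ::
  "('p, 'e::euclidean_space) chart set \<Rightarrow> ('p, 'e) chart \<Rightarrow> 'p \<Rightarrow> ('p, 'e) tvec \<Rightarrow> 'e" where
  "vec_coords A c p v =
     frechet_derivative (transition (chart_at A p) c) (at (snd (chart_at A p) p)) (v (chart_at A p))"

definition tangent_map ::
  "('p, 'e::euclidean_space) chart set \<Rightarrow> ('q, 'f::euclidean_space) chart set \<Rightarrow> ('p \<Rightarrow> 'q) \<Rightarrow>
     'p \<Rightarrow> ('p, 'e) tvec \<Rightarrow> ('q, 'f) tvec" where
  "tangent_map A B f p v = (\<lambda>d. if d \<in> B \<and> f p \<in> fst d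
     then frechet_derivative (snd d \<circ> f \<circ> chart_inv (chart_at A p))
            (at (snd (chart_at A p) p)) (v (chart_at A p))
     else 0)"

text \<open>Smooth 1-forms with values in a Euclidean space.\<close>

definition smooth_one_form ::
  "('p, 'e::euclidean_space) chart set \<Rightarrow> ('p \<Rightarrow> ('p, 'e) tvec \<Rightarrow> 'w::euclidean_space) \<Rightarrow> bool" where
  "smooth_one_form A \<alpha> \<longleftrightarrow> (\<forall>p\<in>points A. linear_on (tangent_space A p) (\<alpha> p)) \<and>
     (\<forall>c\<in>A. \<forall>e. smooth_on (snd c ` fst c)
        (\<lambda>y. \<alpha> (chart_inv c y) (coord_vec A c (chart_inv c y) e)))"


section \<open>Almost complex structures\<close>

definition almost_complex_structure ::
  "('p, 'e::euclidean_space) chart set \<Rightarrow> ('p \<Rightarrow> ('p, 'e) tvec \<Rightarrow> ('p, 'e) tvec) \<Rightarrow> bool" where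
  "almost_complex_structure A J \<longleftrightarrow>
     (\<forall>p\<in>points A. linear_on (tangent_space A p) (J p) \<and>
        (\<forall>v\<in>tangent_space A p. J p v \<in> tangent_space A p \<and> J p (J p v) = - v)) \<and>
     (\<forall>c\<in>A. \<forall>e. smooth_on (snd c ` fst c)
        (\<lambda>y. J (chart_inv c y) (coord_vec A c (chart_inv c y) e) c))"

text \<open>Integrability means that \<open>J\<close> comes from a holomorphic atlas: around every point there is a
  chart in which \<open>J\<close> becomes a constant linear complex structure \<open>j\<close> of the model space
  (the model space with \<open>j\<close> is a copy of a standard complex coordinate space).\<close>

definition integrable_acs ::
  "('p, 'e::euclidean_space) chart set \<Rightarrow> ('p \<Rightarrow> ('p, 'e) tvec \<Rightarrow> ('p, 'e) tvec) \<Rightarrow> bool" where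
  "integrable_acs A J \<longleftrightarrow> (\<forall>p\<in>points A. \<exists>c j.
     compatible_chart A c \<and> p \<in> fst c \<and> linear j \<and> (\<forall>e. j (j e) = - e) \<and>
     (\<forall>x\<in>fst c. \<forall>v\<in>tangent_space A x.
        vec_coords A c x (J x v) = j (vec_coords A c x v)))"


section \<open>Vector bundles\<close>

text \<open>A smooth vector bundle with fibres \<open>E p\<close> is given by a family of local frames
  \<open>(U, s)\<close>, indexed by \<open>I\<close>, whose changes of frame are smooth. The fibres are subspaces of a real
  vector space \<open>'v\<close>; this is only a device to have them as sets in one type, no relation between
  different fibres is implied.\<close>

type_synonym ('m, 'i, 'v) local_frame = "'m set \<times> ('i \<Rightarrow> 'm \<Rightarrow> 'v)"

definition vector_bundle ::
  "('m, 'e::euclidean_space) chart set \<Rightarrow> 'i set \<Rightarrow> ('m \<Rightarrow> 'v::real_vector set) \<Rightarrow>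
     ('m, 'i, 'v) local_frame set \<Rightarrow> bool" where
  "vector_bundle A I E F \<longleftrightarrow> finite I \<and> \<Union> (fst ` F) = points A \<and>
     (\<forall>(U, s)\<in>F. openin (atlas_topology A) U \<and>
        (\<forall>p\<in>U. inj_on (\<lambda>i. s i p) I \<and> independent ((\<lambda>i. s i p) ` I) \<and>
           span ((\<lambda>i. s i p) ` I) = E p)) \<and>
     (\<forall>(U, s)\<in>F. \<forall>(U', s')\<in>F. \<exists>g.
        (\<forall>i\<in>I. \<forall>j\<in>I. smooth_fun_on A (U \<inter> U') (g i j :: 'm \<Rightarrow> real)) \<and>
        (\<forall>p\<in>U \<inter> U'. \<forall>j\<in>I. s' j p = (\<Sum>i\<in>I. g i j p *\<^sub>R s i p)))"

definition vector_bundle_iso ::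
  "('m, 'e::euclidean_space) chart set \<Rightarrow>
     'i set \<Rightarrow> ('m \<Rightarrow> 'v::real_vector set) \<Rightarrow> ('m, 'i, 'v) local_frame set \<Rightarrow>
     'j set \<Rightarrow> ('m \<Rightarrow> 'w::real_vector set) \<Rightarrow> ('m, 'j, 'w) local_frame set \<Rightarrow>
     ('m \<Rightarrow> 'v \<Rightarrow> 'w) \<Rightarrow> bool" where
  "vector_bundle_iso A I E F I' E' F' \<Theta> \<longleftrightarrow>
     (\<forall>p\<in>points A. linear_on (E p) (\<Theta> p) \<and> bij_betw (\<Theta> p) (E p) (E' p)) \<and>
     (\<forall>(U, s)\<in>F. \<forall>(U', s')\<in>F'. \<exists>h.
        (\<forall>j\<in>I'. \<forall>i\<in>I. smooth_fun_on A (U \<inter> U') (h j i :: 'm \<Rightarrow> real)) \<and>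
        (\<forall>p\<in>U \<inter> U'. \<forall>i\<in>I. \<Theta> p (s i p) = (\<Sum>j\<in>I'. h j i p *\<^sub>R s' j p)))"

definition tangent_frames ::
  "('m, 'e::euclidean_space) chart set \<Rightarrow> ('m, 'e, ('m, 'e) tvec) local_frame set" where
  "tangent_frames A = {(fst c, \<lambda>e p. coord_vec A c p e) | c. c \<in> A}"

text \<open>The \<open>k\<close>-th symmetric power of \<open>V\<close> is spanned by products of \<open>k\<close> vectors of \<open>V\<close>, where vectors
  are multiplied as linear functions on the dual space.\<close>

definition sym_prod :: "'v::real_vector list \<Rightarrow> ('v \<Rightarrow> real) \<Rightarrow> real" where
  "sym_prod vs = (\<lambda>\<alpha>. if linear \<alpha> then prod_list (map \<alpha> vs) else 0)"

definition sym_power :: "nat \<Rightarrow> 'v::real_vector set \<Rightarrow> (('v \<Rightarrow> real) \<Rightarrow> real) set" where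
  "sym_power k V = span {sym_prod vs | vs. length vs = k \<and> set vs \<subseteq> V}"

text \<open>The monomial \<open>x\<^sup>k\<^sup>-\<^sup>i y\<^sup>i\<close> of two vectors.\<close>

definition sym_monom :: "nat \<Rightarrow> nat \<Rightarrow> 'v::real_vector \<Rightarrow> 'v \<Rightarrow> ('v \<Rightarrow> real) \<Rightarrow> real" where
  "sym_monom k i x y = sym_prod (replicate (k - i) x @ replicate i y)"

definition sym_frames ::
  "nat \<Rightarrow> ('m, 2, 'v::real_vector) local_frame set \<Rightarrow>
     ('m, nat, ('v \<Rightarrow> real) \<Rightarrow> real) local_frame set" where
  "sym_frames k F = {(U, \<lambda>i p. sym_monom k i (s 1 p) (s 2 p)) | U s. (U, s) \<in> F}"

definition gl2_structure ::
  "nat \<Rightarrow> ('m, 'e::euclidean_space) chart set \<Rightarrow> ('m \<Rightarrow> 'v::real_vector set) \<Rightarrow>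
     ('m, 2, 'v) local_frame set \<Rightarrow> ('m \<Rightarrow> (('v \<Rightarrow> real) \<Rightarrow> real) \<Rightarrow> ('m, 'e) tvec) \<Rightarrow> bool" where
  "gl2_structure k A E F \<Theta> \<longleftrightarrow>
     smooth_manifold A \<and> DIM('e) = k + 1 \<and> vector_bundle A UNIV E F \<and>
     vector_bundle_iso A {..k} (\<lambda>p. sym_power k (E p)) (sym_frames k F)
       Basis (tangent_space A) (tangent_frames A) \<Theta>"


section \<open>Binary forms\<close>

text \<open>Homogeneous polynomials in \<open>(x, y) = (w $ 1, w $ 2)\<close> are taken as polynomial functions.\<close>

definition hmonom :: "nat \<Rightarrow> nat \<Rightarrow> real^2 \<Rightarrow> real" where
  "hmonom k i = (\<lambda>w. (w $ 1) ^ (k - i) * (w $ 2) ^ i)"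

definition hpoly :: "nat \<Rightarrow> (real^2 \<Rightarrow> real) set" where
  "hpoly k = span (hmonom k ` {..k})"

definition hcoeff :: "nat \<Rightarrow> (real^2 \<Rightarrow> real) \<Rightarrow> nat \<Rightarrow> real" where
  "hcoeff k V i = representation (hmonom k ` {..k}) V (hmonom k i)"

text \<open>\<open>V \<cdot> g\<close>, with \<open>(x, y) g\<close> a row vector times a matrix.\<close>

definition hact :: "(real^2 \<Rightarrow> real) \<Rightarrow> real^2^2 \<Rightarrow> real^2 \<Rightarrow> real" where
  "hact V g = (\<lambda>w. V (w v* g))"

text \<open>Entry \<open>(i, j)\<close>, \<open>0 \<le> i, j \<le> k\<close>, of the matrix of \<open>V \<mapsto> V \<cdot> g\<close> in the monomial basis, and
  the derivative of this representation at the identity.\<close>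

definition rho :: "nat \<Rightarrow> real^2^2 \<Rightarrow> nat \<Rightarrow> nat \<Rightarrow> real" where
  "rho k g i j = hcoeff k (hact (hmonom k j) g) i"

definition drho :: "nat \<Rightarrow> real^2^2 \<Rightarrow> nat \<Rightarrow> nat \<Rightarrow> real" where
  "drho k X i j = frechet_derivative (\<lambda>g. rho k g i j) (at (mat 1)) X"

definition CO2 :: "(real^2^2) set" where
  "CO2 = {vector [vector [u, - v], vector [v, u]] | u v. u\<^sup>2 + v\<^sup>2 \<noteq> 0}"

definition Vcpx :: "nat \<Rightarrow> nat \<Rightarrow> real^2 \<Rightarrow> complex" where
  "Vcpx k j w = of_real ((w $ 1)\<^sup>2 + (w $ 2)\<^sup>2) ^ j * Complex (w $ 1) (w $ 2) ^ (k - 2 * j)"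

definition Veven :: "nat \<Rightarrow> nat \<Rightarrow> real^2 \<Rightarrow> real" where
  "Veven k j = (\<lambda>w. Re (Vcpx k j w))"

definition Vodd :: "nat \<Rightarrow> nat \<Rightarrow> real^2 \<Rightarrow> real" where
  "Vodd k j = (\<lambda>w. Im (Vcpx k j w))"

definition Vbasis :: "nat \<Rightarrow> (real^2 \<Rightarrow> real) set" where
  "Vbasis k = Veven k ` {..k div 2} \<union> Vodd k ` {..k div 2}"

definition xi_even :: "nat \<Rightarrow> nat \<Rightarrow> (real^2 \<Rightarrow> real) \<Rightarrow> real" where
  "xi_even k j V = representation (Vbasis k) V (Veven k j)"

definition xi_odd :: "nat \<Rightarrow> nat \<Rightarrow> (real^2 \<Rightarrow> real) \<Rightarrow> real" where
  "xi_odd k j V = representation (Vbasis k) V (Vodd k j)"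

definition xi :: "nat \<Rightarrow> nat \<Rightarrow> (real^2 \<Rightarrow> real) \<Rightarrow> complex" where
  "xi k j V = Complex (xi_even k j V) (xi_odd k j V)"

text \<open>The linear map of \<open>hpoly k\<close> taking \<open>Veven k j\<close> to \<open>Vodd k j\<close> and \<open>Vodd k j\<close> to
  \<open>- Veven k j\<close>.\<close>

definition Jpoly :: "nat \<Rightarrow> (real^2 \<Rightarrow> real) \<Rightarrow> real^2 \<Rightarrow> real" where
  "Jpoly k V = (\<Sum>j\<le>k div 2. xi_even k j V *\<^sub>R Vodd k j - xi_odd k j V *\<^sub>R Veven k j)"


section \<open>The frame bundle \<open>B(E)\<close> and its quotient by \<open>CO(2)\<close>\<close>

text \<open>A frame of the tangent space is a function of \<open>i \<in> {0..k}\<close>, continued by \<open>0\<close>; a point of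
  \<open>B(E)\<close> is a pair of a base point and a frame.\<close>

type_synonym ('m, 'e) fpoint = "'m \<times> (nat \<Rightarrow> ('m, 'e) tvec)"

definition induced_frame ::
  "nat \<Rightarrow> ('m \<Rightarrow> (('v::real_vector \<Rightarrow> real) \<Rightarrow> real) \<Rightarrow> ('m, 'e::euclidean_space) tvec) \<Rightarrow>
     'm \<Rightarrow> 'v \<Rightarrow> 'v \<Rightarrow> nat \<Rightarrow> ('m, 'e) tvec" where
  "induced_frame k \<Theta> p x y = (\<lambda>i. if i \<le> k then \<Theta> p (sym_monom k i x y) else 0)"

definition frame_bundle ::
  "nat \<Rightarrow> ('m, 'e::euclidean_space) chart set \<Rightarrow> ('m \<Rightarrow> 'v::real_vector set) \<Rightarrow>
     ('m \<Rightarrow> (('v \<Rightarrow> real) \<Rightarrow> real) \<Rightarrow> ('m, 'e) tvec) \<Rightarrow> ('m, 'e) fpoint set" where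
  "frame_bundle k A E \<Theta> = {(p, induced_frame k \<Theta> p x y) | p x y.
     p \<in> points A \<and> x \<noteq> y \<and> independent {x, y} \<and> span {x, y} = E p}"

definition right_act ::
  "nat \<Rightarrow> ('m, 'e::euclidean_space) fpoint \<Rightarrow> real^2^2 \<Rightarrow> ('m, 'e) fpoint" where
  "right_act k b g =
     (fst b, \<lambda>j. if j \<le> k then (\<Sum>i\<le>k. rho k g i j *\<^sub>R snd b i) else 0)"

text \<open>A chart of \<open>M\<close> and a local frame \<open>(s\<^sub>1, s\<^sub>2)\<close> of \<open>E\<close> give a chart of \<open>B(E)\<close>: its fibre
  coordinate is the matrix \<open>a\<close> with \<open>(x, y) = (s\<^sub>1, s\<^sub>2) a\<close>. (For odd \<open>k\<close> the frame
  \<open>(x\<^sup>k, \<dots>, y\<^sup>k)\<close> determines \<open>(x, y)\<close>.)\<close>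

definition frame_matrix ::
  "nat \<Rightarrow> ('m \<Rightarrow> (('v::real_vector \<Rightarrow> real) \<Rightarrow> real) \<Rightarrow> ('m, 'e::euclidean_space) tvec) \<Rightarrow>
     (2 \<Rightarrow> 'm \<Rightarrow> 'v) \<Rightarrow> ('m, 'e) fpoint \<Rightarrow> real^2^2" where
  "frame_matrix k \<Theta> s b = (THE a. invertible a \<and>
     snd b = induced_frame k \<Theta> (fst b)
       (\<Sum>i\<in>UNIV. a $ i $ 1 *\<^sub>R s i (fst b)) (\<Sum>i\<in>UNIV. a $ i $ 2 *\<^sub>R s i (fst b)))"

definition frame_atlas ::
  "nat \<Rightarrow> ('m, 'e::euclidean_space) chart set \<Rightarrow> ('m \<Rightarrow> 'v::real_vector set) \<Rightarrow>
     ('m, 2, 'v) local_frame set \<Rightarrow> ('m \<Rightarrow> (('v \<Rightarrow> real) \<Rightarrow> real) \<Rightarrow> ('m, 'e) tvec) \<Rightarrow>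
     (('m, 'e) fpoint, 'e \<times> (real^2^2)) chart set" where
  "frame_atlas k A E F \<Theta> =
     {({b \<in> frame_bundle k A E \<Theta>. fst b \<in> fst c \<inter> U},
       \<lambda>b. (snd c (fst b), frame_matrix k \<Theta> s b)) | c U s. c \<in> A \<and> (U, s) \<in> F}"

definition CO2_orbit :: "nat \<Rightarrow> ('m, 'e::euclidean_space) fpoint \<Rightarrow> ('m, 'e) fpoint set" where
  "CO2_orbit k b = right_act k b ` CO2"

text \<open>The quotient smooth structure on the image of \<open>q\<close>, i.e. the one for which \<open>q\<close> is a smooth
  submersion. It is given by its maximal atlas: the charts are the injective maps whose composite
  with \<open>q\<close> is a smooth submersion.\<close>

definition quotient_atlas ::
  "('p, 'e::euclidean_space) chart set \<Rightarrow> ('p \<Rightarrow> 'q) \<Rightarrow> ('q, 'f::euclidean_space) chart set" where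
  "quotient_atlas B q = {(W, c). W \<subseteq> q ` points B \<and> inj_on c W \<and> open (c ` W) \<and>
     (\<forall>d\<in>B. open (snd d ` (fst d \<inter> q -` W)) \<and>
        smooth_on (snd d ` (fst d \<inter> q -` W)) (c \<circ> q \<circ> chart_inv d) \<and>
        (\<forall>y\<in>snd d ` (fst d \<inter> q -` W). surj (frechet_derivative (c \<circ> q \<circ> chart_inv d) (at y))))}"

definition CO2_quotient_atlas ::
  "nat \<Rightarrow> ('m, 'e::euclidean_space) chart set \<Rightarrow> ('m \<Rightarrow> 'v::real_vector set) \<Rightarrow>
     ('m, 2, 'v) local_frame set \<Rightarrow> ('m \<Rightarrow> (('v \<Rightarrow> real) \<Rightarrow> real) \<Rightarrow> ('m, 'e) tvec) \<Rightarrow>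
     (('m, 'e) fpoint set, 'e \<times> complex) chart set" where
  "CO2_quotient_atlas k A E F \<Theta> = quotient_atlas (frame_atlas k A E F \<Theta>) (CO2_orbit k)"


section \<open>Soldering form and \<open>GL(2)\<close>-connections\<close>

text \<open>A frame \<open>\<eta>\<close> identifies \<open>hpoly k\<close> with the tangent space.\<close>

definition frame_map ::
  "nat \<Rightarrow> (nat \<Rightarrow> ('m, 'e::euclidean_space) tvec) \<Rightarrow> (real^2 \<Rightarrow> real) \<Rightarrow> ('m, 'e) tvec" where
  "frame_map k \<eta> V = (\<Sum>i\<le>k. hcoeff k V i *\<^sub>R \<eta> i)"

definition frame_inv ::
  "nat \<Rightarrow> (nat \<Rightarrow> ('m, 'e::euclidean_space) tvec) \<Rightarrow> ('m, 'e) tvec \<Rightarrow> real^2 \<Rightarrow> real" where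
  "frame_inv k \<eta> v = (\<Sum>i\<le>k. representation (\<eta> ` {..k}) v (\<eta> i) *\<^sub>R hmonom k i)"

definition soldering_form ::
  "nat \<Rightarrow> ('m, 'e::euclidean_space) chart set \<Rightarrow> ('m \<Rightarrow> 'v::real_vector set) \<Rightarrow>
     ('m, 2, 'v) local_frame set \<Rightarrow> ('m \<Rightarrow> (('v \<Rightarrow> real) \<Rightarrow> real) \<Rightarrow> ('m, 'e) tvec) \<Rightarrow>
     ('m, 'e) fpoint \<Rightarrow> (('m, 'e) fpoint, 'e \<times> (real^2^2)) tvec \<Rightarrow> real^2 \<Rightarrow> real" where
  "soldering_form k A E F \<Theta> b v =
     frame_inv k (snd b) (tangent_map (frame_atlas k A E F \<Theta>) A fst b v)"

text \<open>The derivative of \<open>g \<mapsto> b \<cdot> g\<close> at the identity in direction \<open>X\<close>.\<close>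

definition fundamental_vec ::
  "nat \<Rightarrow> ('m, 'e::euclidean_space) chart set \<Rightarrow> ('m \<Rightarrow> 'v::real_vector set) \<Rightarrow>
     ('m, 2, 'v) local_frame set \<Rightarrow> ('m \<Rightarrow> (('v \<Rightarrow> real) \<Rightarrow> real) \<Rightarrow> ('m, 'e) tvec) \<Rightarrow>
     ('m, 'e) fpoint \<Rightarrow> real^2^2 \<Rightarrow> (('m, 'e) fpoint, 'e \<times> (real^2^2)) tvec" where
  "fundamental_vec k A E F \<Theta> b X = (\<lambda>d. if d \<in> frame_atlas k A E F \<Theta> \<and> b \<in> fst d
     then frechet_derivative (\<lambda>g. snd d (right_act k b g)) (at (mat 1)) X else 0)"

text \<open>\<open>\<phi>\<close> is a \<open>gl(2)\<close>-valued 1-form whose image \<open>\<Phi>\<close> under the derivative of the representation is a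
  principal connection form: \<open>\<Phi>\<close> reproduces the generators of the fundamental vector fields, and it
  is equivariant, i.e. the pullback of \<open>\<Phi>\<close> by the action of \<open>g\<close> is
  \<open>rho k (inverse g) \<cdot> \<Phi> \<cdot> rho k g\<close>.\<close>

definition gl2_connection ::
  "nat \<Rightarrow> ('m, 'e::euclidean_space) chart set \<Rightarrow> ('m \<Rightarrow> 'v::real_vector set) \<Rightarrow>
     ('m, 2, 'v) local_frame set \<Rightarrow> ('m \<Rightarrow> (('v \<Rightarrow> real) \<Rightarrow> real) \<Rightarrow> ('m, 'e) tvec) \<Rightarrow>
     (('m, 'e) fpoint \<Rightarrow> (('m, 'e) fpoint, 'e \<times> (real^2^2)) tvec \<Rightarrow> real^2^2) \<Rightarrow> bool" where
  "gl2_connection k A E F \<Theta> \<phi> \<longleftrightarrow>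
     (let B = frame_atlas k A E F \<Theta>; \<Phi> = (\<lambda>b v. drho k (\<phi> b v)) in
        smooth_one_form B \<phi> \<and>
        (\<forall>b\<in>frame_bundle k A E \<Theta>. \<forall>X. \<forall>i\<le>k. \<forall>j\<le>k.
           \<Phi> b (fundamental_vec k A E F \<Theta> b X) i j = drho k X i j) \<and>
        (\<forall>b\<in>frame_bundle k A E \<Theta>. \<forall>g. invertible g \<longrightarrow>
           (\<forall>v\<in>tangent_space B b. \<forall>i\<le>k. \<forall>j\<le>k.
              \<Phi> (right_act k b g) (tangent_map B B (\<lambda>b. right_act k b g) b v) i j =
              (\<Sum>l\<le>k. \<Sum>m\<le>k. rho k (matrix_inv g) i l * \<Phi> b v l m * rho k g m j))))"

text \<open>The entries of \<open>\<phi>\<close> are \<open>\<phi>\<^sup>i\<^sub>j = \<phi> $ j $ i\<close>: the lower index is the row.\<close>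

definition zeta ::
  "('b \<Rightarrow> 'w \<Rightarrow> real^2^2) \<Rightarrow> 'b \<Rightarrow> 'w \<Rightarrow> complex" where
  "zeta \<phi> b v = Complex (\<phi> b v $ 2 $ 1 + \<phi> b v $ 1 $ 2) (\<phi> b v $ 2 $ 2 - \<phi> b v $ 1 $ 1)"

text \<open>\<open>J\<close> is the almost complex structure on \<open>B(E)/CO(2)\<close> whose (1,0)-forms (the complex covectors
  \<open>\<alpha>\<close> with \<open>\<alpha> \<circ> J = \<i> \<alpha>\<close>) are those whose pullbacks to \<open>B(E)\<close> are complex linear combinations of
  the forms \<open>\<xi>\<^sup>k\<^sup>,\<^sup>j\<close> and \<open>\<zeta>\<close>. This determines \<open>J\<close> on all tangent spaces.\<close>

definition is_J_phi ::
  "nat \<Rightarrow> ('m, 'e::euclidean_space) chart set \<Rightarrow> ('m \<Rightarrow> 'v::real_vector set) \<Rightarrow>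
     ('m, 2, 'v) local_frame set \<Rightarrow> ('m \<Rightarrow> (('v \<Rightarrow> real) \<Rightarrow> real) \<Rightarrow> ('m, 'e) tvec) \<Rightarrow>
     (('m, 'e) fpoint \<Rightarrow> (('m, 'e) fpoint, 'e \<times> (real^2^2)) tvec \<Rightarrow> real^2^2) \<Rightarrow>
     (('m, 'e) fpoint set \<Rightarrow> (('m, 'e) fpoint set, 'e \<times> complex) tvec \<Rightarrow>
        (('m, 'e) fpoint set, 'e \<times> complex) tvec) \<Rightarrow> bool" where
  "is_J_phi k A E F \<Theta> \<phi> J \<longleftrightarrow>
     (let B = frame_atlas k A E F \<Theta>; Q = CO2_quotient_atlas k A E F \<Theta> in
        almost_complex_structure Q J \<and>
        (\<forall>b\<in>frame_bundle k A E \<Theta>. \<forall>\<alpha> :: _ \<Rightarrow> complex.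
           linear_on (tangent_space Q (CO2_orbit k b)) \<alpha> \<longrightarrow>
           ((\<forall>w\<in>tangent_space Q (CO2_orbit k b). \<alpha> (J (CO2_orbit k b) w) = \<i> * \<alpha> w) \<longleftrightarrow>
            (\<exists>a z. \<forall>v\<in>tangent_space B b.
               \<alpha> (tangent_map B Q (CO2_orbit k) b v) =
               (\<Sum>j\<le>k div 2. a j * xi k j (soldering_form k A E F \<Theta> b v)) + z * zeta \<phi> b v))))"


section \<open>Sections\<close>

definition smooth_section ::
  "nat \<Rightarrow> ('m, 'e::euclidean_space) chart set \<Rightarrow> ('m \<Rightarrow> 'v::real_vector set) \<Rightarrow>
     ('m, 2, 'v) local_frame set \<Rightarrow> ('m \<Rightarrow> (('v \<Rightarrow> real) \<Rightarrow> real) \<Rightarrow> ('m, 'e) tvec) \<Rightarrow>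
     ('m \<Rightarrow> ('m, 'e) fpoint set) \<Rightarrow> bool" where
  "smooth_section k A E F \<Theta> \<sigma> \<longleftrightarrow> smooth_map A (CO2_quotient_atlas k A E F \<Theta>) \<sigma> \<and>
     (\<forall>p\<in>points A. \<sigma> p \<in> CO2_orbit k ` frame_bundle k A E \<Theta> \<and> fst ` \<sigma> p = {p})"

text \<open>The tangent spaces of the submanifold \<open>\<sigma>(M)\<close>, i.e. the images of the tangent spaces of \<open>M\<close>
  under the derivative of \<open>\<sigma>\<close>, are \<open>J\<close>-invariant.\<close>

definition holomorphic_section ::
  "nat \<Rightarrow> ('m, 'e::euclidean_space) chart set \<Rightarrow> ('m \<Rightarrow> 'v::real_vector set) \<Rightarrow>
     ('m, 2, 'v) local_frame set \<Rightarrow> ('m \<Rightarrow> (('v \<Rightarrow> real) \<Rightarrow> real) \<Rightarrow> ('m, 'e) tvec) \<Rightarrow>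
     (('m, 'e) fpoint set \<Rightarrow> (('m, 'e) fpoint set, 'e \<times> complex) tvec \<Rightarrow>
        (('m, 'e) fpoint set, 'e \<times> complex) tvec) \<Rightarrow>
     ('m \<Rightarrow> ('m, 'e) fpoint set) \<Rightarrow> bool" where
  "holomorphic_section k A E F \<Theta> J \<sigma> \<longleftrightarrow> smooth_section k A E F \<Theta> \<sigma> \<and>
     (let Q = CO2_quotient_atlas k A E F \<Theta> in
        \<forall>p\<in>points A. J (\<sigma> p) ` tangent_map A Q \<sigma> p ` tangent_space A p
          \<subseteq> tangent_map A Q \<sigma> p ` tangent_space A p)"

text \<open>The value does not depend on the chosen frame, because \<open>Jpoly k\<close> commutes with \<open>CO2\<close>.\<close>

definition J_section ::
  "nat \<Rightarrow> ('m \<Rightarrow> ('m, 'e::euclidean_space) fpoint set) \<Rightarrow> 'm \<Rightarrow> ('m, 'e) tvec \<Rightarrow> ('m, 'e) tvec" where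
  "J_section k \<sigma> p v =
     (let \<eta> = snd (SOME b. b \<in> \<sigma> p) in frame_map k \<eta> (Jpoly k (frame_inv k \<eta> v)))"

end

theory Submission
  imports Defs
begin

text \<open>
  Let \<open>Q = B(E)/CO(2)\<close>. The proof has two parts.

  First, \<open>J\<^sup>\<sigma>\<close> is the restriction of \<open>J\<close> to the submanifold \<open>\<sigma>(M)\<close>, i.e. \<open>d\<sigma> (J\<^sup>\<sigma> v) = J (d\<sigma> v)\<close>
  (\<open>holomorphic_section_J\<close>). As the image of \<open>d\<sigma>\<close> is \<open>J\<close>-invariant, \<open>J (d\<sigma> v) = d\<sigma> v'\<close> for some \<open>v'\<close>. The
  forms \<open>\<xi>\<^sup>k\<^sup>,\<^sup>j\<close> descend to covectors of type (1,0) at the points of \<open>Q\<close> that depend only on the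
  projection to the tangent space of \<open>M\<close> (\<open>xi_form_J\<close>). Evaluating them on \<open>d\<sigma> v\<close> and \<open>d\<sigma> v'\<close> shows that
  in a frame representing \<open>\<sigma>(p)\<close> the coordinates \<open>\<xi>\<^sup>k\<^sup>,\<^sup>j\<close> of \<open>v'\<close> are \<open>\<i>\<close> times those of \<open>v\<close>, and because \<open>k\<close>
  is odd these are complex coordinates of \<open>hpoly k\<close> (\<open>span_Vbasis\<close>), so that \<open>v' = J\<^sup>\<sigma> v\<close>.

  Second, an immersed submanifold of a complex manifold with \<open>J\<close>-invariant tangent spaces is a complex
  manifold (\<open>integrable_acs_immersion\<close>). Integrability of \<open>J\<close> means that there are charts in which \<open>J\<close> is
  a constant \<open>j\<close>. Take such a chart around \<open>\<sigma>(p)\<close> and follow it by a \<open>j\<close>-linear projection onto the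
  tangent space of \<open>\<sigma>(M)\<close> at \<open>\<sigma>(p)\<close>. The composition with \<open>\<sigma>\<close> has invertible derivative at \<open>p\<close> and
  complex linear derivatives near \<open>p\<close>; by the inverse function theorem it is a chart of \<open>M\<close> in which
  \<open>J\<^sup>\<sigma>\<close> is constant. The same charts show that \<open>J\<^sup>\<sigma>\<close> is smooth.

  What connects the two parts is that \<open>d\<sigma>\<close> is injective. This requires the projection from \<open>Q\<close> to \<open>M\<close>
  to be differentiable. The charts of \<open>Q\<close> are only known through their composition with the quotient
  map, which is a submersion in them; local sections of this submersion provide the
  differentiability (\<open>orbit_base_chart_diff\<close>).
\<close>

section \<open>Calculus of continuously differentiable maps\<close>

lemma Ck_on_cong:
  assumes "open S" "\<And>x. x \<in> S \<Longrightarrow> f x = g x" "Ck_on n S f"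
  shows "Ck_on n S g"
  using assms(2,3)
proof (induction n arbitrary: f g)
  case 0
  then show ?case by (simp cong: continuous_on_cong)
next
  case (Suc n)
  have d: "f differentiable (at x)" if "x \<in> S" for x
    using Suc.prems(2) that by simp
  have *: "g differentiable (at x)" "frechet_derivative g (at x) = frechet_derivative f (at x)"
    if "x \<in> S" for x
  proof -
    have "(f has_derivative frechet_derivative f (at x)) (at x)"
      using d[OF that] frechet_derivative_works by blast
    then have "(g has_derivative frechet_derivative f (at x)) (at x)"
      using has_derivative_transform_within_open[OF _ \<open>open S\<close> that] Suc.prems(1) by metis
    then show "g differentiable (at x)" "frechet_derivative g (at x) = frechet_derivative f (at x)"
      using differentiable_def frechet_derivative_at by metis+
  qed
  have "Ck_on n S (\<lambda>x. frechet_derivative g (at x) v)" for v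
    by (rule Suc.IH[of "\<lambda>x. frechet_derivative f (at x) v"]) (use * Suc.prems(2) in auto)
  with * show ?case by simp
qed

lemma Ck_on_SucI:
  assumes "open S" "\<And>x. x \<in> S \<Longrightarrow> (f has_derivative f' x) (at x)" "\<And>v. Ck_on n S (\<lambda>x. f' x v)"
  shows "Ck_on (Suc n) S f"
proof -
  have "f differentiable (at x)" "frechet_derivative f (at x) = f' x" if "x \<in> S" for x
    using assms(2)[OF that] differentiable_def frechet_derivative_at by metis+
  moreover have "Ck_on n S (\<lambda>x. frechet_derivative f (at x) v)" for v
    by (rule Ck_on_cong[OF assms(1) _ assms(3)[of v]]) (simp add: calculation)
  ultimately show ?thesis by simp
qed

lemma Ck_on_has_derivative:
  "Ck_on (Suc n) S f \<Longrightarrow> x \<in> S \<Longrightarrow> (f has_derivative frechet_derivative f (at x)) (at x)"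
  using frechet_derivative_works by auto

lemma Ck_on_subset: "Ck_on n S f \<Longrightarrow> T \<subseteq> S \<Longrightarrow> Ck_on n T f"
  by (induction n arbitrary: f) (auto intro: continuous_on_subset)

lemma Ck_on_local:
  assumes "\<And>x. x \<in> S \<Longrightarrow> \<exists>T. open T \<and> x \<in> T \<and> Ck_on n T f"
  shows "Ck_on n S f"
  using assms
proof (induction n arbitrary: f)
  case 0
  have "continuous (at x within S) f" if "x \<in> S" for x
    using 0[OF that] that
    by (metis Ck_on.simps(1) continuous_at_imp_continuous_at_within continuous_on_eq_continuous_at)
  then show ?case by (simp add: continuous_on_eq_continuous_within)
next
  case (Suc n)
  have "Ck_on n S (\<lambda>x. frechet_derivative f (at x) v)" for v
    by (rule Suc.IH) (use Suc.prems in fastforce)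
  moreover have "f differentiable (at x)" if "x \<in> S" for x
    using Suc.prems[OF that] by auto
  ultimately show ?case by simp
qed

lemma Ck_on_continuous: "Ck_on n S f \<Longrightarrow> continuous_on S f"
  by (cases n) (auto intro!: continuous_at_imp_continuous_on differentiable_imp_continuous_within)

lemma Ck_on_Suc_imp: "Ck_on (Suc n) S f \<Longrightarrow> Ck_on n S f"
proof (induction n arbitrary: f)
  case 0
  then show ?case by (metis Ck_on.simps(1) Ck_on_continuous)
next
  case (Suc n)
  then show ?case by (metis Ck_on.simps(2))
qed

lemma Ck_on_const: "open S \<Longrightarrow> Ck_on n S (\<lambda>x. c)"
proof (induction n arbitrary: c)
  case (Suc n)
  show ?case
    by (rule Ck_on_SucI[where f' = "\<lambda>x v. 0"]) (use Suc in auto)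
qed simp

lemma Ck_on_id: "open S \<Longrightarrow> Ck_on n S (\<lambda>x. x)"
proof (cases n)
  case (Suc n')
  assume "open S"
  then show ?thesis unfolding Suc
    by (intro Ck_on_SucI[where f' = "\<lambda>x v. v"]) (auto intro: Ck_on_const)
qed simp

lemma Ck_on_linear:
  assumes "open S" "bounded_linear L" "Ck_on n S f"
  shows "Ck_on n S (\<lambda>x. L (f x))"
  using assms(3)
proof (induction n arbitrary: f)
  case 0
  then show ?case using bounded_linear.continuous_on[OF assms(2)] by simp
next
  case (Suc n)
  show ?case
    by (rule Ck_on_SucI[OF assms(1), where f' = "\<lambda>x v. L (frechet_derivative f (at x) v)"],
        erule bounded_linear.has_derivative[OF assms(2) Ck_on_has_derivative[OF Suc.prems]],
        rule Suc.IH, use Suc.prems in simp)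
qed

lemma Ck_on_add:
  assumes "open S" "Ck_on n S f" "Ck_on n S g"
  shows "Ck_on n S (\<lambda>x. f x + g x)"
  using assms(2,3)
proof (induction n arbitrary: f g)
  case 0
  then show ?case by (simp add: continuous_on_add)
next
  case (Suc n)
  show ?case
  proof (rule Ck_on_SucI[OF assms(1)])
    show "((\<lambda>x. f x + g x) has_derivative
        (\<lambda>v. frechet_derivative f (at x) v + frechet_derivative g (at x) v)) (at x)" if "x \<in> S" for x
      using has_derivative_add Ck_on_has_derivative[OF Suc.prems(1) that]
        Ck_on_has_derivative[OF Suc.prems(2) that] by blast
    show "Ck_on n S (\<lambda>x. frechet_derivative f (at x) v + frechet_derivative g (at x) v)" for v
      using Suc.prems by (intro Suc.IH) simp_all
  qed
qed

lemma Ck_on_sum: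
  assumes "open S" "\<And>i. i \<in> I \<Longrightarrow> Ck_on n S (f i)"
  shows "Ck_on n S (\<lambda>x. \<Sum>i\<in>I. f i x)"
  using assms(2)
  by (induction I rule: infinite_finite_induct) (auto intro: Ck_on_add Ck_on_const assms(1))

lemma Ck_on_scaleR:
  fixes f :: "'a::euclidean_space \<Rightarrow> 'b::euclidean_space"
  assumes "open S" "Ck_on n S r" "Ck_on n S f"
  shows "Ck_on n S (\<lambda>x. r x *\<^sub>R f x)"
  using assms(2,3)
proof (induction n arbitrary: r f)
  case 0
  then show ?case by (simp add: continuous_on_scaleR)
next
  case (Suc n)
  show ?case
  proof (rule Ck_on_SucI[OF assms(1), where
          f' = "\<lambda>x v. r x *\<^sub>R frechet_derivative f (at x) v + frechet_derivative r (at x) v *\<^sub>R f x"])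
    fix x assume "x \<in> S"
    then show "((\<lambda>x. r x *\<^sub>R f x) has_derivative
       (\<lambda>v. r x *\<^sub>R frechet_derivative f (at x) v + frechet_derivative r (at x) v *\<^sub>R f x)) (at x)"
      by (intro has_derivative_scaleR Ck_on_has_derivative[OF Suc.prems(1)]
          Ck_on_has_derivative[OF Suc.prems(2)])
  next
    fix v
    show "Ck_on n S (\<lambda>x. r x *\<^sub>R frechet_derivative f (at x) v + frechet_derivative r (at x) v *\<^sub>R f x)"
      using Suc.prems Ck_on_Suc_imp[OF Suc.prems(1)] Ck_on_Suc_imp[OF Suc.prems(2)]
      by (intro Ck_on_add assms(1) Suc.IH) simp_all
  qed
qed

lemma linear_Basis_expand:
  fixes v :: "'a::euclidean_space"
  assumes "linear L" shows "L v = (\<Sum>b\<in>Basis. (v \<bullet> b) *\<^sub>R L b)"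
proof -
  have "L v = L (\<Sum>b\<in>Basis. (v \<bullet> b) *\<^sub>R b)" by (simp add: euclidean_representation)
  also have "\<dots> = (\<Sum>b\<in>Basis. (v \<bullet> b) *\<^sub>R L b)"
    using assms by (simp add: linear_sum linear_scale)
  finally show ?thesis .
qed

text \<open>A family of linear maps whose values on the standard basis depend on the parameter in a
  \<open>C\<^sup>n\<close> way may be evaluated at an argument that varies with the parameter.\<close>

lemma Ck_on_linear_family:
  fixes v :: "'a::euclidean_space \<Rightarrow> 'b::euclidean_space"
  assumes "open S" "\<And>x. x \<in> S \<Longrightarrow> linear (L x)" "\<And>b. b \<in> Basis \<Longrightarrow> Ck_on n S (\<lambda>x. L x b)" "Ck_on n S v"
  shows "Ck_on n S (\<lambda>x. L x (v x))"
proof (rule Ck_on_cong[OF assms(1)])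
  show "Ck_on n S (\<lambda>x. \<Sum>b\<in>Basis. (v x \<bullet> b) *\<^sub>R L x b)"
    by (intro Ck_on_sum Ck_on_scaleR assms Ck_on_linear[OF _ bounded_linear_inner_left])
  show "(\<Sum>b\<in>Basis. (v x \<bullet> b) *\<^sub>R L x b) = L x (v x)" if "x \<in> S" for x
    using linear_Basis_expand[OF assms(2)[OF that]] by metis
qed

lemma Ck_on_compose:
  fixes f :: "'a::euclidean_space \<Rightarrow> 'b::euclidean_space" and g :: "'b \<Rightarrow> 'c::euclidean_space"
  assumes "open S" "open T" "f ` S \<subseteq> T" "Ck_on n S f" "Ck_on n T g"
  shows "Ck_on n S (\<lambda>x. g (f x))"
  using assms(4,5)
proof (induction n arbitrary: g)
  case 0
  then show ?case using continuous_on_compose2[of T g S f] assms(3) by auto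
next
  case (Suc n)
  have dg: "(g has_derivative frechet_derivative g (at (f x))) (at (f x))" if "x \<in> S" for x
    using Suc.prems(2) Ck_on_has_derivative assms(3) that by blast
  show ?case
  proof (rule Ck_on_SucI[OF assms(1), where
        f' = "\<lambda>x v. frechet_derivative g (at (f x)) (frechet_derivative f (at x) v)"])
    fix x assume "x \<in> S"
    then show "((\<lambda>x. g (f x)) has_derivative
        (\<lambda>v. frechet_derivative g (at (f x)) (frechet_derivative f (at x) v))) (at x)"
      using has_derivative_compose[OF Ck_on_has_derivative[OF Suc.prems(1)] dg] by blast
  next
    fix v
    have 1: "Ck_on n S (\<lambda>x. frechet_derivative g (at (f x)) b)" for b
      using Suc.prems(2) by (intro Suc.IH Ck_on_Suc_imp[OF Suc.prems(1)]) simp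
    have 2: "linear (frechet_derivative g (at (f x)))" if "x \<in> S" for x
      using dg[OF that] has_derivative_linear by blast
    have 3: "Ck_on n S (\<lambda>x. frechet_derivative f (at x) v)"
      using Suc.prems(1) by simp
    show "Ck_on n S (\<lambda>x. frechet_derivative g (at (f x)) (frechet_derivative f (at x) v))"
      using Ck_on_linear_family[where L = "\<lambda>x. frechet_derivative g (at (f x))", OF assms(1) 2 1 3] .
  qed
qed

lemma smooth_onD: "smooth_on S f \<Longrightarrow> Ck_on n S f"
  by (simp add: smooth_on_def)

lemma smooth_on_has_derivative:
  "smooth_on S f \<Longrightarrow> x \<in> S \<Longrightarrow> (f has_derivative frechet_derivative f (at x)) (at x)"
  by (rule Ck_on_has_derivative[OF smooth_onD])

lemma smooth_on_differentiable: "smooth_on S f \<Longrightarrow> x \<in> S \<Longrightarrow> f differentiable (at x)"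
  using smooth_on_has_derivative differentiableI by blast

lemma smooth_on_continuous: "smooth_on S f \<Longrightarrow> continuous_on S f"
  using Ck_on_continuous smooth_onD by blast

lemma smooth_on_subset: "smooth_on S f \<Longrightarrow> T \<subseteq> S \<Longrightarrow> smooth_on T f"
  by (auto simp: smooth_on_def intro: Ck_on_subset)

lemma smooth_on_cong:
  "open S \<Longrightarrow> smooth_on S f \<Longrightarrow> (\<And>x. x \<in> S \<Longrightarrow> f x = g x) \<Longrightarrow> smooth_on S g"
  unfolding smooth_on_def using Ck_on_cong by blast

lemma smooth_on_local:
  assumes "\<And>x. x \<in> S \<Longrightarrow> \<exists>T. open T \<and> x \<in> T \<and> smooth_on T f"
  shows "smooth_on S f"
  unfolding smooth_on_def using assms by (auto intro!: Ck_on_local dest: smooth_onD)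

lemma smooth_on_id: "open S \<Longrightarrow> smooth_on S (\<lambda>x. x)"
  by (simp add: smooth_on_def Ck_on_id)

lemma smooth_on_const: "open S \<Longrightarrow> smooth_on S (\<lambda>x. c)"
  by (simp add: smooth_on_def Ck_on_const)

lemma smooth_on_linear:
  "open S \<Longrightarrow> linear L \<Longrightarrow> smooth_on S f \<Longrightarrow> smooth_on S (\<lambda>x. L (f x))"
  for f :: "_ \<Rightarrow> 'b::euclidean_space"
  by (simp add: smooth_on_def Ck_on_linear linear_conv_bounded_linear)

lemma smooth_on_compose:
  "open S \<Longrightarrow> open T \<Longrightarrow> f ` S \<subseteq> T \<Longrightarrow> smooth_on S f \<Longrightarrow> smooth_on T g \<Longrightarrow> smooth_on S (\<lambda>x. g (f x))"
  unfolding smooth_on_def using Ck_on_compose by blast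

lemma smooth_on_frechet_derivative:
  assumes "open S" "open T" "f ` S \<subseteq> T" "smooth_on S f" "smooth_on S v" "smooth_on T g"
  shows "smooth_on S (\<lambda>x. frechet_derivative g (at (f x)) (v x))"
  unfolding smooth_on_def
proof
  fix n
  have "Ck_on n T (\<lambda>y. frechet_derivative g (at y) b)" for b
    using smooth_onD[OF assms(6), of "Suc n"] by simp
  from Ck_on_compose[OF assms(1-3) smooth_onD[OF assms(4)] this]
  have 1: "Ck_on n S (\<lambda>x. frechet_derivative g (at (f x)) b)" for b .
  have 2: "linear (frechet_derivative g (at (f x)))" if "x \<in> S" for x
    using assms(3) that by (intro linear_frechet_derivative smooth_on_differentiable[OF assms(6)]) auto
  show "Ck_on n S (\<lambda>x. frechet_derivative g (at (f x)) (v x))"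
    using Ck_on_linear_family[where L = "\<lambda>x. frechet_derivative g (at (f x))", OF assms(1) 2 1
        smooth_onD[OF assms(5)]] .
qed

section \<open>Smoothness of local inverses\<close>

text \<open>\<open>y \<mapsto> (B y) v\<close> solves \<open>u y = B\<^sub>0 (v - (A y - A\<^sub>0) (u y))\<close>, where \<open>A\<^sub>0 = A x\<close> and \<open>B\<^sub>0 = B x\<close>.
  Near \<open>x\<close> the operator \<open>A y - A\<^sub>0\<close> is small, hence \<open>u\<close> is bounded, then continuous, and finally
  differentiable at \<open>x\<close>: this is the usual formula \<open>d (A\<^sup>-\<^sup>1) = - A\<^sup>-\<^sup>1 (dA) A\<^sup>-\<^sup>1\<close>.\<close>

lemma has_derivative_inverse_family:
  fixes A B :: "'x::euclidean_space \<Rightarrow> 'a::euclidean_space \<Rightarrow> 'a"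
  assumes S: "open S" "x \<in> S"
    and lin: "\<And>y. y \<in> S \<Longrightarrow> linear (A y)" "\<And>y. y \<in> S \<Longrightarrow> linear (B y)"
    and inv: "\<And>y w. y \<in> S \<Longrightarrow> A y (B y w) = w" "\<And>y w. y \<in> S \<Longrightarrow> B y (A y w) = w"
    and der: "\<And>b. b \<in> Basis \<Longrightarrow> ((\<lambda>y. A y b) has_derivative D b) (at x)"
  shows "((\<lambda>y. B y v) has_derivative (\<lambda>h. - B x (\<Sum>b\<in>Basis. (B x v \<bullet> b) *\<^sub>R D b h))) (at x)"
proof -
  define u where "u = (\<lambda>y. B y v)"
  have blB: "bounded_linear (B x)" using lin S by (simp add: linear_conv_bounded_linear)
  then obtain K where K: "K > 0" "\<And>w. norm (B x w) \<le> norm w * K"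
    using bounded_linear.pos_bounded by blast
  define N where "N = (\<lambda>y. \<Sum>b\<in>Basis. norm (A y b - A x b))"
  have contA: "((\<lambda>y. A y b) \<longlongrightarrow> A x b) (at x)" if "b \<in> Basis" for b
    using der[OF that] has_derivative_continuous continuous_within by blast
  have N0: "(N \<longlongrightarrow> 0) (at x)"
    unfolding N_def by (rule tendsto_null_sum, rule tendsto_norm_zero, rule LIM_zero, rule contA)
  have diff: "A y w - A x w = (\<Sum>b\<in>Basis. (w \<bullet> b) *\<^sub>R (A y b - A x b))" if "y \<in> S" for y w
    using linear_Basis_expand[OF lin(1)[OF that], of w] linear_Basis_expand[OF lin(1)[OF S(2)], of w]
    by (simp add: scaleR_diff_right sum_subtractf)
  have Nb: "norm (A y w - A x w) \<le> norm w * N y" if "y \<in> S" for y w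
  proof -
    have "norm (A y w - A x w) \<le> (\<Sum>b\<in>Basis. norm ((w \<bullet> b) *\<^sub>R (A y b - A x b)))"
      by (subst diff[OF that], rule norm_sum)
    also have "\<dots> \<le> (\<Sum>b\<in>Basis. norm w * norm (A y b - A x b))"
      by (intro sum_mono) (simp add: Basis_le_norm mult_right_mono)
    finally show ?thesis by (simp add: N_def sum_distrib_left)
  qed
  have evS: "\<forall>\<^sub>F y in at x. y \<in> S"
    using S by (simp add: eventually_at_in_open')
  have eq: "u y = u x - B x (A y (u y) - A x (u y))" if "y \<in> S" for y
  proof -
    have "B x (A y (u y) - A x (u y)) = B x v - u y"
      using that lin(2)[OF S(2)] inv S(2) by (simp add: u_def linear_diff)
    then show ?thesis by (simp add: u_def)
  qed
  have evN: "\<forall>\<^sub>F y in at x. N y < 1 / (2 * K)"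
    using order_tendstoD(2)[OF N0, of "1 / (2*K)"] K(1) by simp
  have bdd: "\<forall>\<^sub>F y in at x. norm (u y) \<le> 2 * norm (u x)"
    using evS evN
  proof eventually_elim
    case (elim y)
    have "norm (u y) \<le> norm (u x) + norm (B x (A y (u y) - A x (u y)))"
      using eq[OF elim(1)] norm_triangle_ineq4 by metis
    also have "\<dots> \<le> norm (u x) + norm (u y) * N y * K"
      using K Nb[OF elim(1), of "u y"] by (smt (verit) mult_right_mono)
    also have "norm (u y) * N y * K \<le> norm (u y) * (1 / (2*K)) * K"
      using elim(2) K(1) by (intro mult_right_mono mult_left_mono) auto
    also have "\<dots> = norm (u y) / 2" using K(1) by simp
    finally show ?case by simp
  qed
  have cont: "(u \<longlongrightarrow> u x) (at x)"
  proof (rule Lim_transform_bound[THEN LIM_zero_cancel])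
    show "\<forall>\<^sub>F y in at x. norm (u y - u x) \<le> norm (2 * norm (u x) * N y * K)"
      using evS bdd
    proof eventually_elim
      case (elim y)
      have "norm (u y - u x) = norm (B x (A y (u y) - A x (u y)))"
        using eq[OF elim(1)] by (metis add_diff_cancel_left' norm_minus_cancel diff_conv_add_uminus)
      also have "\<dots> \<le> norm (u y) * N y * K"
        using K Nb[OF elim(1), of "u y"] by (smt (verit) mult_right_mono)
      also have "\<dots> \<le> 2 * norm (u x) * N y * K"
        using elim(2) K(1) by (intro mult_right_mono) (auto simp: N_def sum_nonneg)
      finally show ?case using abs_ge_self order_trans by (metis real_norm_def)
    qed
    show "((\<lambda>y. 2 * norm (u x) * N y * K) \<longlongrightarrow> 0) (at x)"
      using tendsto_mult[OF tendsto_mult[OF tendsto_const[of "2 * norm (u x)"] N0] tendsto_const[of K]]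
      by simp
  qed
  have prod: "((\<lambda>y. (u y \<bullet> b) *\<^sub>R (A y b - A x b)) has_derivative (\<lambda>h. (u x \<bullet> b) *\<^sub>R D b h)) (at x)"
    if b: "b \<in> Basis" for b
  proof -
    have 1: "((\<lambda>y. (u x \<bullet> b) *\<^sub>R (A y b - A x b)) has_derivative (\<lambda>h. (u x \<bullet> b) *\<^sub>R D b h)) (at x)"
      using der[OF b] by (auto intro!: derivative_eq_intros)
    have 2: "((\<lambda>y. ((u y - u x) \<bullet> b) *\<^sub>R (A y b - A x b)) has_derivative (\<lambda>h. 0)) (at x)"
    proof -
      let ?r = "\<lambda>y. norm (A y b - A x b - D b (y - x)) / norm (y - x)"
      have blD: "bounded_linear (D b)" using der[OF b] has_derivative_bounded_linear by blast
      then obtain C where C: "\<And>h. norm (D b h) \<le> norm h * C"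
        using bounded_linear.bounded by blast
      have r: "(?r \<longlongrightarrow> 0) (at x)"
        using der[OF b] by (simp add: has_derivative_iff_norm)
      have "((\<lambda>y. norm (((u y - u x) \<bullet> b) *\<^sub>R (A y b - A x b)) / norm (y - x)) \<longlongrightarrow> 0) (at x)"
      proof (rule Lim_transform_bound)
        show "\<forall>\<^sub>F y in at x. norm (norm (((u y - u x) \<bullet> b) *\<^sub>R (A y b - A x b)) / norm (y - x))
            \<le> norm (norm (u y - u x) * (?r y + C))"
        proof (rule eventually_at_filter[THEN iffD2], rule always_eventually, intro allI impI)
          fix y assume "y \<noteq> x"
          then have p: "norm (y - x) > 0" by simp
          have "norm (A y b - A x b) \<le> norm (A y b - A x b - D b (y - x)) + norm (D b (y - x))"
            using norm_triangle_ineq[of "A y b - A x b - D b (y - x)" "D b (y - x)"] by simp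
          then have "norm (A y b - A x b) / norm (y - x) \<le> ?r y + C"
            using C[of "y - x"] p by (simp add: field_simps)
          moreover have "\<bar>(u y - u x) \<bullet> b\<bar> \<le> norm (u y - u x)" using b Basis_le_norm by blast
          ultimately have "\<bar>(u y - u x) \<bullet> b\<bar> * (norm (A y b - A x b) / norm (y - x))
              \<le> norm (u y - u x) * (?r y + C)"
            by (intro mult_mono) auto
          then show "norm (norm (((u y - u x) \<bullet> b) *\<^sub>R (A y b - A x b)) / norm (y - x))
            \<le> norm (norm (u y - u x) * (?r y + C))"
            by (smt (verit) norm_scaleR real_norm_def times_divide_eq_right norm_ge_zero divide_nonneg_nonneg)
        qed
        show "((\<lambda>y. norm (u y - u x) * (?r y + C)) \<longlongrightarrow> 0) (at x)"
          using tendsto_mult[OF tendsto_norm_zero[OF LIM_zero[OF cont]] tendsto_add[OF r tendsto_const[of C]]]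
          by simp
      qed
      then show ?thesis by (simp add: has_derivative_iff_norm)
    qed
    show ?thesis using has_derivative_add[OF 1 2]
      by (rule has_derivative_eq_rhs[THEN has_derivative_transform[rotated 2, where s = UNIV]])
         (auto simp: inner_diff_left algebra_simps)
  qed
  have "((\<lambda>y. u x - B x (\<Sum>b\<in>Basis. (u y \<bullet> b) *\<^sub>R (A y b - A x b))) has_derivative
      (\<lambda>h. 0 - B x (\<Sum>b\<in>Basis. (u x \<bullet> b) *\<^sub>R D b h))) (at x)"
    by (intro has_derivative_diff has_derivative_const bounded_linear.has_derivative[OF blB]
          has_derivative_sum prod)
  then have "(u has_derivative (\<lambda>h. 0 - B x (\<Sum>b\<in>Basis. (u x \<bullet> b) *\<^sub>R D b h))) (at x)"
    by (rule has_derivative_transform_within_open[OF _ S]) (metis eq diff)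
  then show ?thesis by (simp add: u_def)
qed

text \<open>The derivative of \<open>y \<mapsto> B y v\<close> is again built from values of \<open>B\<close> and derivatives of \<open>A\<close>,
  so each order of differentiability of \<open>B\<close> yields the next one.\<close>

lemma Ck_on_inverse_family:
  fixes A B :: "'x::euclidean_space \<Rightarrow> 'a::euclidean_space \<Rightarrow> 'a"
  assumes S: "open S"
    and lin: "\<And>y. y \<in> S \<Longrightarrow> linear (A y)" "\<And>y. y \<in> S \<Longrightarrow> linear (B y)"
    and inv: "\<And>y w. y \<in> S \<Longrightarrow> A y (B y w) = w" "\<And>y w. y \<in> S \<Longrightarrow> B y (A y w) = w"
    and smooth: "\<And>b. smooth_on S (\<lambda>y. A y b)"
  shows "Ck_on n S (\<lambda>y. B y v)"
proof (induction n arbitrary: v)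
  case 0
  have "continuous (at x) (\<lambda>y. B y v)" if "x \<in> S" for x
    by (rule has_derivative_continuous[OF has_derivative_inverse_family[OF S that lin inv]])
       (use smooth_on_has_derivative[OF smooth that] in auto)
  then show ?case by (simp add: continuous_at_imp_continuous_on)
next
  case (Suc n)
  let ?D = "\<lambda>x b. frechet_derivative (\<lambda>y. A y b) (at x)"
  show ?case
  proof (rule Ck_on_SucI[OF S, where f' = "\<lambda>x h. - B x (\<Sum>b\<in>Basis. (B x v \<bullet> b) *\<^sub>R ?D x b h)"])
    fix x assume "x \<in> S"
    then show "((\<lambda>y. B y v) has_derivative (\<lambda>h. - B x (\<Sum>b\<in>Basis. (B x v \<bullet> b) *\<^sub>R ?D x b h))) (at x)"
      by (intro has_derivative_inverse_family[OF S _ lin inv] smooth_on_has_derivative[OF smooth])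
  next
    fix h
    have D: "Ck_on n S (\<lambda>x. ?D x b h)" for b
      using smooth_onD[OF smooth, of "Suc n" b] by simp
    have "Ck_on n S (\<lambda>x. \<Sum>b\<in>Basis. (B x v \<bullet> b) *\<^sub>R ?D x b h)"
      by (intro S Ck_on_sum Ck_on_scaleR D Ck_on_linear[OF _ bounded_linear_inner_left] Suc.IH)
    from Ck_on_linear_family[where L = B, OF S lin(2) Suc.IH this]
    have "Ck_on n S (\<lambda>x. B x (\<Sum>b\<in>Basis. (B x v \<bullet> b) *\<^sub>R ?D x b h))" .
    then show "Ck_on n S (\<lambda>x. - B x (\<Sum>b\<in>Basis. (B x v \<bullet> b) *\<^sub>R ?D x b h))"
      by (rule Ck_on_linear[OF S bounded_linear_minus[OF bounded_linear_ident]])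
  qed
qed

text \<open>The derivative of \<open>g\<close> is the pointwise inverse of the derivative of \<open>f\<close>, taken at \<open>g y\<close>. Its
  entries are smooth functions of \<open>g y\<close>, so \<open>g\<close> gains one order of differentiability at a time.\<close>

lemma smooth_on_inverse:
  fixes f g :: "'a::euclidean_space \<Rightarrow> 'a"
  assumes "open U" "open V" "f ` U \<subseteq> V" "g ` V \<subseteq> U" "smooth_on U f"
    and dg: "\<And>y. y \<in> V \<Longrightarrow> (g has_derivative inv (frechet_derivative f (at (g y)))) (at y)"
    and bij: "\<And>x. x \<in> U \<Longrightarrow> bij (frechet_derivative f (at x))"
  shows "smooth_on V g"
proof -
  let ?A = "\<lambda>x. frechet_derivative f (at x)"
  have linA: "linear (?A x)" if "x \<in> U" for x
    using assms(5) that smooth_on_differentiable linear_frechet_derivative by blast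
  have linB: "linear (inv (?A x))" if "x \<in> U" for x
    using linA[OF that] bij[OF that] bij_is_inj inj_linear_imp_inv_linear by blast
  have B: "Ck_on n U (\<lambda>x. inv (?A x) v)" for n v
  proof (rule Ck_on_inverse_family[where A = ?A])
    show "smooth_on U (\<lambda>y. frechet_derivative f (at y) b)" for b
      unfolding smooth_on_def using smooth_onD[OF assms(5), of "Suc _"] by simp
  qed (use assms linA linB bij in \<open>auto simp: bij_is_surj surj_f_inv_f bij_is_inj inv_f_f\<close>)
  have "Ck_on n V g" for n
  proof (induction n)
    case 0
    then show ?case using dg by (auto intro!: continuous_at_imp_continuous_on has_derivative_continuous)
  next
    case (Suc n)
    show ?case
      by (rule Ck_on_SucI[OF assms(2) dg]) (use Ck_on_compose[OF assms(2,1,4) Suc.IH B] in auto)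
  qed
  then show ?thesis by (simp add: smooth_on_def)
qed

theorem smooth_inverse_function_theorem:
  fixes f :: "'a::euclidean_space \<Rightarrow> 'a"
  assumes "open U" "smooth_on U f" "x0 \<in> U" "inj (frechet_derivative f (at x0))"
  obtains U' V g where "open U'" "U' \<subseteq> U" "x0 \<in> U'" "open V" "homeomorphism U' V f g"
    "smooth_on V g"
proof -
  define f' where "f' = (\<lambda>x. Blinfun (frechet_derivative f (at x)))"
  have f': "blinfun_apply (f' x) = frechet_derivative f (at x)" if "x \<in> U" for x
    unfolding f'_def using smooth_on_has_derivative[OF assms(2) that]
    by (simp add: bounded_linear_Blinfun_apply has_derivative_bounded_linear)
  have der: "(f has_derivative (blinfun_apply (f' x))) (at x)" if "x \<in> U" for x
    using f'[OF that] smooth_on_has_derivative[OF assms(2) that] by simp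
  have contf: "continuous_on U f'"
  proof (rule continuous_on_blinfun_componentwise)
    fix i :: 'a
    have "continuous_on U (\<lambda>x. frechet_derivative f (at x) i)"
      using smooth_onD[OF assms(2), of 1] by simp
    then show "continuous_on U (\<lambda>x. blinfun_apply (f' x) i)"
      by (subst continuous_on_cong[OF refl]) (use f' in auto)
  qed
  obtain h where h: "linear h" "\<And>v. h (frechet_derivative f (at x0) v) = v"
    using linear_injective_left_inverse[OF _ assms(4)] assms(2,3) smooth_on_differentiable
      linear_frechet_derivative by (metis comp_apply id_apply)
  have "Blinfun h o\<^sub>L f' x0 = id_blinfun"
    by (rule blinfun_eqI) (use h f' assms(3) in
        \<open>auto simp: bounded_linear_Blinfun_apply linear_conv_bounded_linear\<close>)
  from inverse_function_theorem[OF assms(1) der contf assms(3) this]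
  obtain U' V g g' where *: "open U'" "U' \<subseteq> U" "x0 \<in> U'" "open V" "f x0 \<in> V"
    "homeomorphism U' V f g" "\<And>y. y \<in> V \<Longrightarrow> (g has_derivative (g' y)) (at y)"
    "\<And>y. y \<in> V \<Longrightarrow> g' y = inv (blinfun_apply (f'(g y)))"
    "\<And>y. y \<in> V \<Longrightarrow> bij (blinfun_apply (f'(g y)))" by metis
  have gV: "g ` V = U'" and fU: "f ` U' = V" and gf: "\<And>x. x \<in> U' \<Longrightarrow> g (f x) = x"
    using *(6) by (auto simp: homeomorphism_def)
  have "smooth_on V g"
  proof (rule smooth_on_inverse[OF *(1,4)])
    show "smooth_on U' f" using assms(2) *(2) smooth_on_subset by blast
    show "bij (frechet_derivative f (at x))" if "x \<in> U'" for x
      using *(9)[of "f x"] f'[of x] gf[OF that] fU that *(2) by auto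
    show "(g has_derivative inv (frechet_derivative f (at (g y)))) (at y)" if "y \<in> V" for y
      using *(7,8)[OF that] f'[of "g y"] gV that *(2) by auto
  qed (use gV fU in auto)
  with * that show ?thesis by blast
qed

text \<open>Restricting \<open>G\<close> to an affine subspace that its derivative maps isomorphically onto the target
  reduces the claim to the inverse function theorem.\<close>

lemma submersion_local_section:
  fixes G :: "'a::euclidean_space \<Rightarrow> 'b::euclidean_space"
  assumes "open U" "smooth_on U G" "y0 \<in> U" "surj (frechet_derivative G (at y0))"
  obtains W s where "open W" "G y0 \<in> W" "smooth_on W s" "s ` W \<subseteq> U" "s (G y0) = y0"
    "\<And>w. w \<in> W \<Longrightarrow> G (s w) = w"
proof -
  let ?D = "frechet_derivative G (at y0)"
  have linD: "linear ?D"
    using assms(2,3) smooth_on_differentiable linear_frechet_derivative by blast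
  obtain L where L: "linear L" "\<And>v. ?D (L v) = v"
    using linear_surjective_right_inverse[OF linD assms(4)] by (metis comp_apply id_apply)
  define e where "e = (\<lambda>z. y0 + L z)"
  define U1 where "U1 = e -` U"
  have sm_e: "smooth_on T e" if "open T" for T
  proof -
    have "smooth_on T (\<lambda>z. L z)" using smooth_on_linear[OF that L(1) smooth_on_id[OF that]] .
    then show ?thesis unfolding e_def smooth_on_def using that by (auto intro!: Ck_on_add Ck_on_const)
  qed
  have U1: "open U1" unfolding U1_def
    using open_vimage[OF assms(1)] smooth_on_continuous[OF sm_e[OF open_UNIV]] by blast
  have e0: "e 0 = y0" using L(1) by (simp add: e_def linear_0)
  have smH: "smooth_on U1 (\<lambda>z. G (e z))"
    by (rule smooth_on_compose[OF U1 assms(1) _ sm_e[OF U1] assms(2)]) (auto simp: U1_def)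
  have "(e has_derivative L) (at 0)"
    unfolding e_def using L(1) by (auto intro!: derivative_eq_intros linear_imp_has_derivative)
  from has_derivative_compose[OF this, of G ?D]
  have "((\<lambda>z. G (e z)) has_derivative (\<lambda>v. v)) (at 0)"
    using smooth_on_has_derivative[OF assms(2,3)] L(2) e0 by simp
  then have "frechet_derivative (\<lambda>z. G (e z)) (at 0) = (\<lambda>v. v)"
    using frechet_derivative_at by metis
  then have "inj (frechet_derivative (\<lambda>z. G (e z)) (at 0))" by simp
  from smooth_inverse_function_theorem[OF U1 smH _ this]
  obtain U' V g where *: "open U'" "U' \<subseteq> U1" "0 \<in> U'" "open V" "homeomorphism U' V (\<lambda>z. G (e z)) g"
    "smooth_on V g" using assms(3) e0 U1_def by auto
  show ?thesis
  proof (rule that[OF *(4), of "\<lambda>w. e (g w)"])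
    show "G y0 \<in> V" using *(3,5) e0 by (auto simp: homeomorphism_def image_iff)
    show "smooth_on V (\<lambda>w. e (g w))"
      by (rule smooth_on_compose[OF *(4) open_UNIV _ *(6) sm_e]) auto
    show "(\<lambda>w. e (g w)) ` V \<subseteq> U"
      using *(2,5) by (auto simp: homeomorphism_def U1_def)
    show "e (g (G y0)) = y0"
      using *(3,5) e0 by (auto simp: homeomorphism_def)
    show "G (e (g w)) = w" if "w \<in> V" for w
      using *(5) that by (auto simp: homeomorphism_def)
  qed
qed

section \<open>Derivatives in charts\<close>

definition chart_deriv ::
  "('p, 'e::euclidean_space) chart \<Rightarrow> ('q, 'f::euclidean_space) chart \<Rightarrow> ('p \<Rightarrow> 'q) \<Rightarrow> 'p \<Rightarrow> 'e \<Rightarrow> 'f" where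
  "chart_deriv c d f p = frechet_derivative (snd d \<circ> f \<circ> chart_inv c) (at (snd c p))"

text \<open>Differentiability at a point, read in two given charts. That a neighbourhood of \<open>p\<close> is mapped
  into the second chart makes the chain rule a statement about three charts alone, with no reference
  to the atlases they belong to.\<close>

definition chart_diff ::
  "('p, 'e::euclidean_space) chart \<Rightarrow> ('q, 'f::euclidean_space) chart \<Rightarrow> ('p \<Rightarrow> 'q) \<Rightarrow> 'p \<Rightarrow> bool" where
  "chart_diff c d f p \<longleftrightarrow> p \<in> fst c \<and> f p \<in> fst d \<and>
     inj_on (snd c) (fst c) \<and> inj_on (snd d) (fst d) \<and>
     (\<forall>\<^sub>F y in nhds (snd c p). y \<in> snd c ` (fst c \<inter> f -` fst d)) \<and>
     (snd d \<circ> f \<circ> chart_inv c) differentiable (at (snd c p))"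

lemma chart_inv_left: "inj_on (snd c) (fst c) \<Longrightarrow> p \<in> fst c \<Longrightarrow> chart_inv c (snd c p) = p"
  by (simp add: chart_inv_def)

lemma chart_inv_right:
  "y \<in> snd c ` fst c \<Longrightarrow> snd c (chart_inv c y) = y"
  "y \<in> snd c ` fst c \<Longrightarrow> chart_inv c y \<in> fst c"
  by (simp_all add: chart_inv_def f_inv_into_f inv_into_into)

lemma chart_inv_eq: "inj_on (snd c) (fst c) \<Longrightarrow> p \<in> fst c \<Longrightarrow> snd c p = y \<Longrightarrow> chart_inv c y = p"
  by (auto simp: chart_inv_left)

lemma chart_diff_has_derivative:
  "chart_diff c d f p \<Longrightarrow> (snd d \<circ> f \<circ> chart_inv c has_derivative chart_deriv c d f p) (at (snd c p))"
  by (simp add: chart_diff_def chart_deriv_def frechet_derivative_works[symmetric])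

lemma chart_diff_linear: "chart_diff c d f p \<Longrightarrow> linear (chart_deriv c d f p)"
  by (rule has_derivative_linear[OF chart_diff_has_derivative])

lemma
  assumes f: "chart_diff c d f p" and g: "chart_diff d e g (f p)"
  shows chart_diff_comp: "chart_diff c e (\<lambda>x. g (f x)) p"
    and chart_deriv_comp:
      "chart_deriv c e (\<lambda>x. g (f x)) p v = chart_deriv d e g (f p) (chart_deriv c d f p v)"
proof -
  let ?F = "snd d \<circ> f \<circ> chart_inv c" and ?G = "snd e \<circ> g \<circ> chart_inv d"
    and ?H = "snd e \<circ> (\<lambda>x. g (f x)) \<circ> chart_inv c"
  have p: "p \<in> fst c" "inj_on (snd c) (fst c)" "f p \<in> fst d" "inj_on (snd d) (fst d)"
    "g (f p) \<in> fst e" "inj_on (snd e) (fst e)"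
    using f g by (auto simp: chart_diff_def)
  have Fp: "?F (snd c p) = snd d (f p)" using p by (simp add: chart_inv_left)
  have lim: "filterlim ?F (nhds (?F (snd c p))) (nhds (snd c p))"
    using has_derivative_continuous[OF chart_diff_has_derivative[OF f]]
    by (simp only: isCont_def tendsto_at_iff_tendsto_nhds)
  have "\<forall>\<^sub>F z in nhds (?F (snd c p)). z \<in> snd d ` (fst d \<inter> g -` fst e)"
    using g unfolding Fp chart_diff_def by blast
  from eventually_compose_filterlim[OF this lim]
  have ev2: "\<forall>\<^sub>F y in nhds (snd c p). ?F y \<in> snd d ` (fst d \<inter> g -` fst e)" .
  have ev1: "\<forall>\<^sub>F y in nhds (snd c p). y \<in> snd c ` (fst c \<inter> f -` fst d)"
    using f by (simp add: chart_diff_def)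
  have evs: "\<forall>\<^sub>F y in nhds (snd c p). y \<in> snd c ` (fst c \<inter> (\<lambda>x. g (f x)) -` fst e) \<and> ?G (?F y) = ?H y"
    using ev1 ev2
  proof eventually_elim
    case (elim y)
    then obtain x where x: "x \<in> fst c" "f x \<in> fst d" "y = snd c x" by auto
    then have Fy: "?F y = snd d (f x)" using p by (simp add: chart_inv_left)
    then obtain z where "z \<in> fst d" "g z \<in> fst e" "snd d (f x) = snd d z" using elim by auto
    then have "g (f x) \<in> fst e" using x p by (metis inj_onD)
    then show ?case using x p Fy by (auto simp: chart_inv_left)
  qed
  have "(?G \<circ> ?F has_derivative chart_deriv d e g (f p) \<circ> chart_deriv c d f p) (at (snd c p))"
    using chart_diff_has_derivative[OF f] chart_diff_has_derivative[OF g]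
    by (intro diff_chain_at) (simp_all only: Fp)
  then have der: "(?H has_derivative chart_deriv d e g (f p) \<circ> chart_deriv c d f p) (at (snd c p))"
  proof (rule has_derivative_transform_eventually)
    have "\<forall>\<^sub>F y in nhds (snd c p). (?G \<circ> ?F) y = ?H y"
      using evs by eventually_elim simp
    then show "\<forall>\<^sub>F y in at (snd c p). (?G \<circ> ?F) y = ?H y" "(?G \<circ> ?F) (snd c p) = ?H (snd c p)"
      by (auto simp: eventually_nhds_conv_at)
  qed simp
  show "chart_diff c e (\<lambda>x. g (f x)) p"
    unfolding chart_diff_def using p evs der by (auto elim: eventually_mono intro: differentiableI)
  show "chart_deriv c e (\<lambda>x. g (f x)) p v = chart_deriv d e g (f p) (chart_deriv c d f p v)"
    unfolding chart_deriv_def[of c e] using fun_cong[OF frechet_derivative_at[OF der], of v] by simp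
qed

lemma chart_deriv_cong:
  assumes f: "chart_diff c d f p" and fg: "\<And>x. x \<in> fst c \<Longrightarrow> f x = g x"
  shows "chart_deriv c d f p = chart_deriv c d g p"
proof -
  have p: "p \<in> fst c" "inj_on (snd c) (fst c)" "f p \<in> fst d" "inj_on (snd d) (fst d)"
    using f by (auto simp: chart_diff_def)
  have "\<forall>\<^sub>F y in nhds (snd c p). y \<in> snd c ` (fst c \<inter> f -` fst d)"
    using f by (simp add: chart_diff_def)
  then have ev: "\<forall>\<^sub>F y in nhds (snd c p). y \<in> snd c ` (fst c \<inter> g -` fst d) \<and>
      (snd d \<circ> f \<circ> chart_inv c) y = (snd d \<circ> g \<circ> chart_inv c) y"
    by eventually_elim (use fg p in \<open>auto simp: chart_inv_left\<close>)
  have der: "(snd d \<circ> g \<circ> chart_inv c has_derivative chart_deriv c d f p) (at (snd c p))"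
    by (rule has_derivative_transform_eventually[OF chart_diff_has_derivative[OF f]])
       (use ev in \<open>auto simp: eventually_nhds_conv_at elim: eventually_mono\<close>)
  show "chart_deriv c d f p = chart_deriv c d g p"
    unfolding chart_deriv_def[of c d g] using frechet_derivative_at[OF der] by simp
qed

lemma smooth_atlasD:
  assumes "smooth_atlas A"
  shows "c \<in> A \<Longrightarrow> inj_on (snd c) (fst c)" "c \<in> A \<Longrightarrow> open (snd c ` fst c)"
    "c \<in> A \<Longrightarrow> d \<in> A \<Longrightarrow> open (snd c ` (fst c \<inter> fst d))"
    "c \<in> A \<Longrightarrow> d \<in> A \<Longrightarrow> smooth_on (snd c ` (fst c \<inter> fst d)) (transition c d)"
  using assms by (auto simp: smooth_atlas_def)

lemma chart_diffI:
  assumes "inj_on (snd c) (fst c)" "inj_on (snd d) (fst d)" "p \<in> fst c" "f p \<in> fst d"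
    "open (snd c ` (fst c \<inter> f -` fst d))"
    "smooth_on (snd c ` (fst c \<inter> f -` fst d)) (snd d \<circ> f \<circ> chart_inv c)"
  shows "chart_diff c d f p"
proof -
  have "snd c p \<in> snd c ` (fst c \<inter> f -` fst d)" using assms(3,4) by blast
  then show ?thesis
    unfolding chart_diff_def
    using assms(1-5) smooth_on_differentiable[OF assms(6)] by (simp add: eventually_nhds_in_open)
qed

lemma transition_chart_diff:
  assumes "smooth_atlas A" "c \<in> A" "d \<in> A" "p \<in> fst c" "p \<in> fst d"
  shows "chart_diff c d (\<lambda>x. x) p"
  using smooth_atlasD[OF assms(1)] assms(2-)
  by (intro chart_diffI) (auto simp: transition_def comp_def)

lemma transition_chart_deriv:
  "frechet_derivative (transition c d) (at (snd c p)) = chart_deriv c d (\<lambda>x. x) p"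
  by (simp add: chart_deriv_def transition_def comp_def)

lemma chart_deriv_same:
  assumes "smooth_atlas A" "c \<in> A" "p \<in> fst c"
  shows "chart_deriv c c (\<lambda>x. x) p v = v"
proof -
  have "(transition c c has_derivative (\<lambda>v. v)) (at (snd c p))"
  proof (rule has_derivative_transform_within_open[OF has_derivative_ident smooth_atlasD(2)[OF assms(1,2)]])
    show "y = transition c c y" if "y \<in> snd c ` fst c" for y
      using chart_inv_right[OF that] by (simp add: transition_def)
  qed (use assms in auto)
  then show ?thesis
    using frechet_derivative_at transition_chart_deriv by metis
qed

lemma chart_at: "p \<in> points A \<Longrightarrow> chart_at A p \<in> A" "p \<in> points A \<Longrightarrow> p \<in> fst (chart_at A p)"
  unfolding chart_at_def points_def
  by (metis (mono_tags, lifting) UN_E someI_ex)+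

lemma points_memI: "c \<in> A \<Longrightarrow> p \<in> fst c \<Longrightarrow> p \<in> points A"
  by (auto simp: points_def)

lemma tangent_space_coords:
  "v \<in> tangent_space A p \<Longrightarrow> c \<in> A \<Longrightarrow> d \<in> A \<Longrightarrow> p \<in> fst c \<Longrightarrow> p \<in> fst d \<Longrightarrow>
    v d = chart_deriv c d (\<lambda>x. x) p (v c)"
  unfolding tangent_space_def transition_chart_deriv by blast

lemma tangent_space_zero: "v \<in> tangent_space A p \<Longrightarrow> \<not> (c \<in> A \<and> p \<in> fst c) \<Longrightarrow> v c = 0"
  unfolding tangent_space_def by blast

lemma tangent_spaceI:
  assumes "\<And>c. \<not> (c \<in> A \<and> p \<in> fst c) \<Longrightarrow> v c = 0"
    "\<And>c d. c \<in> A \<Longrightarrow> d \<in> A \<Longrightarrow> p \<in> fst c \<Longrightarrow> p \<in> fst d \<Longrightarrow> v d = chart_deriv c d (\<lambda>x. x) p (v c)"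
  shows "v \<in> tangent_space A p"
  unfolding tangent_space_def transition_chart_deriv using assms by blast

lemma subspace_tangent_space:
  assumes "smooth_atlas A" shows "subspace (tangent_space A p)"
proof -
  have lin: "linear (chart_deriv c d (\<lambda>x. x) p)"
    if "c \<in> A" "d \<in> A" "p \<in> fst c" "p \<in> fst d" for c d
    by (intro chart_diff_linear transition_chart_diff[OF assms] that)
  show ?thesis
  proof (rule subspaceI)
    show "0 \<in> tangent_space A p"
      by (rule tangent_spaceI) (simp_all add: lin linear_0)
    fix v w r
    assume v: "v \<in> tangent_space A p"
    show "r *\<^sub>R v \<in> tangent_space A p"
    proof (rule tangent_spaceI)
      fix c d assume c: "c \<in> A" "d \<in> A" "p \<in> fst c" "p \<in> fst d"
      show "(r *\<^sub>R v) d = chart_deriv c d (\<lambda>x. x) p ((r *\<^sub>R v) c)"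
        unfolding scaleR_fun_def linear_scale[OF lin[OF c]]
        using tangent_space_coords[OF v c] by (rule arg_cong)
    qed (simp add: scaleR_fun_def tangent_space_zero[OF v])
    assume w: "w \<in> tangent_space A p"
    show "v + w \<in> tangent_space A p"
    proof (rule tangent_spaceI)
      fix c d assume c: "c \<in> A" "d \<in> A" "p \<in> fst c" "p \<in> fst d"
      show "(v + w) d = chart_deriv c d (\<lambda>x. x) p ((v + w) c)"
        unfolding plus_fun_def linear_add[OF lin[OF c]]
        using tangent_space_coords[OF v c] tangent_space_coords[OF w c] by (rule arg_cong2)
    qed (simp add: tangent_space_zero[OF v] tangent_space_zero[OF w])
  qed
qed

lemma coord_vec_tangent:
  assumes "smooth_atlas A" "c \<in> A" "p \<in> fst c"
  shows "coord_vec A c p e \<in> tangent_space A p" "coord_vec A c p e c = e"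
proof -
  have eq: "coord_vec A c p e d = chart_deriv c d (\<lambda>x. x) p e" if "d \<in> A" "p \<in> fst d" for d
    using that by (simp add: coord_vec_def transition_chart_deriv)
  show "coord_vec A c p e c = e"
    using eq assms(2,3) chart_deriv_same[OF assms] by simp
  show "coord_vec A c p e \<in> tangent_space A p"
  proof (rule tangent_spaceI)
    fix c' d assume c: "c' \<in> A" "d \<in> A" "p \<in> fst c'" "p \<in> fst d"
    show "coord_vec A c p e d = chart_deriv c' d (\<lambda>x. x) p (coord_vec A c p e c')"
      unfolding eq[OF c(2,4)] eq[OF c(1,3)]
      by (rule chart_deriv_comp[OF transition_chart_diff[OF assms(1,2) c(1) assms(3) c(3)]
            transition_chart_diff[OF assms(1) c]])
  qed (auto simp: coord_vec_def)
qed

section \<open>Tangent maps\<close>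

text \<open>A tangent map reads its argument in the one chart \<open>chart_at A p\<close>, while its value has a component
  in every chart of \<open>B\<close>; the definition treats the two sides accordingly. On the source side this asks
  for one injective chart only, which suits the frame bundle.\<close>

definition mdiff ::
  "('p, 'e::euclidean_space) chart set \<Rightarrow> ('q, 'f::euclidean_space) chart set \<Rightarrow> ('p \<Rightarrow> 'q) \<Rightarrow> 'p \<Rightarrow> bool" where
  "mdiff A B f p \<longleftrightarrow> p \<in> points A \<and> f p \<in> points B \<and>
     (\<forall>d\<in>B. f p \<in> fst d \<longrightarrow> chart_diff (chart_at A p) d f p)"

lemma mdiffI:
  assumes "p \<in> points A" "smooth_atlas B" "d \<in> B" "chart_diff (chart_at A p) d f p"
  shows "mdiff A B f p"
  unfolding mdiff_def
proof (intro conjI ballI impI)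
  have fp: "f p \<in> fst d" using assms(4) by (simp add: chart_diff_def)
  then show "f p \<in> points B" using assms points_memI by metis
  fix d' assume "d' \<in> B" "f p \<in> fst d'"
  then show "chart_diff (chart_at A p) d' f p"
    using chart_diff_comp[OF assms(4) transition_chart_diff[OF assms(2,3)]] fp by blast
qed (fact assms(1))

lemma tangent_map_chart_deriv:
  "d \<in> B \<Longrightarrow> f p \<in> fst d \<Longrightarrow>
    tangent_map A B f p v d = chart_deriv (chart_at A p) d f p (v (chart_at A p))"
  by (simp add: tangent_map_def chart_deriv_def)

lemma mdiff_comp_chart_deriv:
  assumes "mdiff A B f p" "chart_diff (chart_at B (f p)) d g (f p)"
  shows "chart_diff (chart_at A p) d (\<lambda>x. g (f x)) p"
    "chart_deriv (chart_at B (f p)) d g (f p) (tangent_map A B f p v (chart_at B (f p))) =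
       chart_deriv (chart_at A p) d (\<lambda>x. g (f x)) p (v (chart_at A p))"
proof -
  have *: "f p \<in> points B" "chart_diff (chart_at A p) (chart_at B (f p)) f p"
    using assms(1) chart_at[of "f p" B] by (auto simp: mdiff_def)
  show "chart_diff (chart_at A p) d (\<lambda>x. g (f x)) p"
    using chart_diff_comp[OF *(2) assms(2)] .
  show "chart_deriv (chart_at B (f p)) d g (f p) (tangent_map A B f p v (chart_at B (f p))) =
       chart_deriv (chart_at A p) d (\<lambda>x. g (f x)) p (v (chart_at A p))"
    using chart_deriv_comp[OF *(2) assms(2)] chart_at[OF *(1)] by (simp add: tangent_map_chart_deriv)
qed

lemma tangent_map_comp:
  assumes "mdiff A B f p" "mdiff B C g (f p)"
  shows "tangent_map B C g (f p) (tangent_map A B f p v) = tangent_map A C (\<lambda>x. g (f x)) p v"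
proof
  fix d
  show "tangent_map B C g (f p) (tangent_map A B f p v) d = tangent_map A C (\<lambda>x. g (f x)) p v d"
  proof (cases "d \<in> C \<and> g (f p) \<in> fst d")
    case True
    then have "chart_diff (chart_at B (f p)) d g (f p)" using assms(2) by (simp add: mdiff_def)
    from mdiff_comp_chart_deriv(2)[OF assms(1) this] show ?thesis
      using True by (simp add: tangent_map_chart_deriv)
  qed (auto simp: tangent_map_def)
qed

lemma tangent_map_cong:
  assumes "mdiff A B f p" "\<And>x. x \<in> points A \<Longrightarrow> f x = g x"
  shows "tangent_map A B f p = tangent_map A B g p"
proof (intro ext)
  fix v d
  have p: "p \<in> points A" using assms(1) by (simp add: mdiff_def)
  show "tangent_map A B f p v d = tangent_map A B g p v d"
  proof (cases "d \<in> B \<and> f p \<in> fst d")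
    case True
    then have "chart_diff (chart_at A p) d f p" using assms(1) by (simp add: mdiff_def)
    from chart_deriv_cong[OF this, of g] True assms(2) p show ?thesis
      by (simp add: tangent_map_chart_deriv points_memI[OF chart_at(1)])
  qed (use p assms(2) in \<open>auto simp: tangent_map_def\<close>)
qed

lemma tangent_map_ident:
  assumes "v \<in> tangent_space A p" "p \<in> points A"
  shows "tangent_map A A (\<lambda>x. x) p v = v"
proof
  fix d
  show "tangent_map A A (\<lambda>x. x) p v d = v d"
  proof (cases "d \<in> A \<and> p \<in> fst d")
    case True
    then show ?thesis
      using tangent_space_coords[OF assms(1) chart_at(1)[OF assms(2)] _ chart_at(2)[OF assms(2)]]
      by (simp add: tangent_map_chart_deriv)
  next
    case False
    show ?thesis
      unfolding tangent_map_def tangent_space_zero[OF assms(1) False] using False by (rule if_not_P)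
  qed
qed

text \<open>The components of the image in two charts are related by the transition map, by the chain rule.\<close>

lemma tangent_map_tangent_space:
  assumes "mdiff A B f p" "smooth_atlas B"
  shows "tangent_map A B f p v \<in> tangent_space B (f p)"
proof -
  have "tangent_map A B f p v d = chart_deriv c d (\<lambda>x. x) (f p) (tangent_map A B f p v c)"
    if "c \<in> B" "d \<in> B" "f p \<in> fst c" "f p \<in> fst d" for c d
  proof -
    have c: "chart_diff (chart_at A p) c f p" using assms(1) that by (simp add: mdiff_def)
    from chart_deriv_comp[OF this transition_chart_diff[OF assms(2) that]] show ?thesis
      using that by (simp add: tangent_map_chart_deriv)
  qed
  moreover have "tangent_map A B f p v c = 0" if "\<not> (c \<in> B \<and> f p \<in> fst c)" for c
    unfolding tangent_map_def using that by (rule if_not_P)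
  ultimately show ?thesis by (intro tangent_spaceI)
qed

lemma tangent_map_linear:
  assumes "mdiff A B f p"
  shows "tangent_map A B f p (u + v) = tangent_map A B f p u + tangent_map A B f p v"
    "tangent_map A B f p (r *\<^sub>R v) = r *\<^sub>R tangent_map A B f p v"
proof -
  have "linear (chart_deriv (chart_at A p) d f p)" if "d \<in> B" "f p \<in> fst d" for d
    using assms that by (intro chart_diff_linear) (simp add: mdiff_def)
  then have "tangent_map A B f p (u + v) d = (tangent_map A B f p u + tangent_map A B f p v) d"
    "tangent_map A B f p (r *\<^sub>R v) d = (r *\<^sub>R tangent_map A B f p v) d" for d
    by (cases "d \<in> B \<and> f p \<in> fst d";
        simp add: tangent_map_chart_deriv linear_add linear_scale scaleR_fun_def;
        auto simp: tangent_map_def)+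
  then show "tangent_map A B f p (u + v) = tangent_map A B f p u + tangent_map A B f p v"
    "tangent_map A B f p (r *\<^sub>R v) = r *\<^sub>R tangent_map A B f p v" by auto
qed

lemma smooth_map_mdiff:
  assumes "smooth_map A B f" "smooth_atlas A" "smooth_atlas B" "p \<in> points A"
  shows "mdiff A B f p"
proof -
  have fp: "f p \<in> points B" using assms(1,4) by (auto simp: smooth_map_def)
  show ?thesis
    using assms(1) chart_at[OF assms(4)] chart_at[OF fp] smooth_atlasD(1)[OF assms(2)]
      smooth_atlasD(1)[OF assms(3)]
    by (intro mdiffI[OF assms(4,3) chart_at(1)[OF fp]] chart_diffI) (simp_all add: smooth_map_def)
qed

section \<open>Charts of the maximal atlas\<close>

lemma vec_coords_chart_deriv:
  "vec_coords A c p v = chart_deriv (chart_at A p) c (\<lambda>x. x) p (v (chart_at A p))"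
  by (simp add: vec_coords_def transition_chart_deriv)

text \<open>A chart of the maximal atlas reads off tangent vectors in the same way as the charts of the atlas,
  and the vector is recovered from these coordinates.\<close>

lemma vec_coords_eq:
  assumes "smooth_atlas (insert n A)" "c \<in> A" "p \<in> fst c" "p \<in> fst n" "v \<in> tangent_space A p"
  shows "vec_coords A n p v = chart_deriv c n (\<lambda>x. x) p (v c)"
    "v c = chart_deriv n c (\<lambda>x. x) p (vec_coords A n p v)"
proof -
  let ?a = "chart_at A p"
  have p: "p \<in> points A" using assms points_memI by metis
  note a = chart_at[OF p]
  have va: "v ?a = chart_deriv c ?a (\<lambda>x. x) p (v c)"
    using tangent_space_coords[OF assms(5,2) a(1) assms(3) a(2)] .
  have vc: "v c = chart_deriv ?a c (\<lambda>x. x) p (v ?a)"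
    using tangent_space_coords[OF assms(5) a(1) assms(2) a(2) assms(3)] .
  have d: "chart_diff c ?a (\<lambda>x. x) p" "chart_diff ?a n (\<lambda>x. x) p" "chart_diff n c (\<lambda>x. x) p"
    by (intro transition_chart_diff[OF assms(1)]; use a assms(2-4) in simp)+
  show "vec_coords A n p v = chart_deriv c n (\<lambda>x. x) p (v c)"
    unfolding vec_coords_chart_deriv va by (rule chart_deriv_comp[OF d(1,2), symmetric])
  show "v c = chart_deriv n c (\<lambda>x. x) p (vec_coords A n p v)"
    unfolding vec_coords_chart_deriv
    using vc chart_deriv_comp[OF d(2,3)] by (rule trans)
qed

lemma vec_coords_tangent_map:
  assumes "mdiff A B f p" "smooth_atlas (insert n B)" "f p \<in> fst n"
  shows "chart_diff (chart_at A p) n f p"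
    "vec_coords B n (f p) (tangent_map A B f p v) = chart_deriv (chart_at A p) n f p (v (chart_at A p))"
proof -
  have fp: "f p \<in> points B" using assms(1) by (simp add: mdiff_def)
  have "chart_diff (chart_at B (f p)) n (\<lambda>x. x) (f p)"
    by (rule transition_chart_diff[OF assms(2)]) (use chart_at[OF fp] assms(3) in simp_all)
  from mdiff_comp_chart_deriv[OF assms(1) this]
  show "chart_diff (chart_at A p) n f p"
    "vec_coords B n (f p) (tangent_map A B f p v) = chart_deriv (chart_at A p) n f p (v (chart_at A p))"
    by (simp_all add: vec_coords_chart_deriv)
qed

text \<open>Charts of the maximal atlas arise from a given chart by a local diffeomorphism of the model
  space.\<close>

lemma compatible_chart_diffeo:
  fixes A :: "('p, 'e::euclidean_space) chart set"
  assumes A: "smooth_atlas A" "a \<in> A" and U: "open U" "U \<subseteq> snd a ` fst a" and V: "open V"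
    and hom: "homeomorphism U V f g" and sm: "smooth_on U f" "smooth_on V g"
  shows "compatible_chart A (chart_inv a ` U, f \<circ> snd a)"
proof -
  define c where "c = (chart_inv a ` U, f \<circ> snd a)"
  have aU: "snd a (chart_inv a u) = u" "chart_inv a u \<in> fst a" if "u \<in> U" for u
    using U(2) that chart_inv_right[of u a] by auto
  have fU: "f ` U = V" and gV: "g ` V = U" and gf: "\<And>u. u \<in> U \<Longrightarrow> g (f u) = u"
    and fg: "\<And>w. w \<in> V \<Longrightarrow> f (g w) = w"
    using hom by (auto simp: homeomorphism_def)
  have fst_c: "x \<in> fst c \<longleftrightarrow> x \<in> fst a \<and> snd a x \<in> U" for x
    unfolding c_def using aU chart_inv_left[OF smooth_atlasD(1)[OF A]] by (auto simp: image_iff) metis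
  have snd_c: "snd c x = f (snd a x)" for x by (simp add: c_def)
  have inj_a: "inj_on (snd a) (fst a)" using smooth_atlasD(1)[OF A] .
  have inj_c: "inj_on (snd c) (fst c)"
    using inj_a by (auto simp: inj_on_def fst_c snd_c dest: arg_cong[of _ _ g]) (metis gf)
  have inv_c: "chart_inv c w = chart_inv a (g w)" if "w \<in> V" for w
    by (rule chart_inv_eq[OF inj_c]) (use that gV aU fg in \<open>auto simp: fst_c snd_c\<close>)
  have im_c: "snd c ` fst c = V"
    using fU aU by (force simp: fst_c snd_c image_iff)
  have dom_c: "snd c ` (fst c \<inter> fst d) = V \<inter> g -` (snd a ` (fst a \<inter> fst d))" for d
  proof (intro equalityI subsetI)
    fix w assume "w \<in> snd c ` (fst c \<inter> fst d)"
    then show "w \<in> V \<inter> g -` (snd a ` (fst a \<inter> fst d))"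
      using fU gf by (auto simp: fst_c snd_c)
  next
    fix w assume "w \<in> V \<inter> g -` (snd a ` (fst a \<inter> fst d))"
    then obtain x where x: "w \<in> V" "x \<in> fst a" "x \<in> fst d" "g w = snd a x" by auto
    have "g w \<in> U" using x(1) gV by blast
    then have "w = snd c x" "x \<in> fst c" using x fg[OF x(1)] by (simp_all add: fst_c snd_c)
    then show "w \<in> snd c ` (fst c \<inter> fst d)" using x by blast
  qed
  have dom_d: "snd d ` (fst d \<inter> fst c) = snd d ` (fst d \<inter> fst a) \<inter> transition d a -` U"
    if "d \<in> A" for d
    using chart_inv_left[OF smooth_atlasD(1)[OF A(1) that]]
    by (auto simp: fst_c transition_def image_iff)
  have cd: "open (snd c ` (fst c \<inter> fst d)) \<and> smooth_on (snd c ` (fst c \<inter> fst d)) (transition c d)"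
    if d: "d \<in> A" for d
  proof
    let ?S = "snd c ` (fst c \<inter> fst d)"
    have o: "open (snd a ` (fst a \<inter> fst d))" using smooth_atlasD(3)[OF A d] .
    show S: "open ?S" unfolding dom_c
      using continuous_open_preimage[OF smooth_on_continuous[OF sm(2)] V o] .
    have "g ` ?S \<subseteq> snd a ` (fst a \<inter> fst d)" "?S \<subseteq> V" unfolding dom_c by blast+
    then have "smooth_on ?S (\<lambda>w. transition a d (g w))"
      using smooth_on_compose[OF S o _ _ smooth_atlasD(4)[OF A d]] smooth_on_subset[OF sm(2)] by simp
    then show "smooth_on ?S (transition c d)"
      by (rule smooth_on_cong[OF S]) (auto simp: dom_c transition_def inv_c)
  qed
  have dc: "open (snd d ` (fst d \<inter> fst c)) \<and> smooth_on (snd d ` (fst d \<inter> fst c)) (transition d c)"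
    if d: "d \<in> A" for d
  proof
    let ?S = "snd d ` (fst d \<inter> fst c)"
    have o: "open (snd d ` (fst d \<inter> fst a))" using smooth_atlasD(3)[OF A(1) d A(2)] .
    have s: "smooth_on (snd d ` (fst d \<inter> fst a)) (transition d a)"
      using smooth_atlasD(4)[OF A(1) d A(2)] .
    show S: "open ?S" unfolding dom_d[OF d]
      using continuous_open_preimage[OF smooth_on_continuous[OF s] o U(1)] .
    have "transition d a ` ?S \<subseteq> U" "?S \<subseteq> snd d ` (fst d \<inter> fst a)"
      unfolding dom_d[OF d] by blast+
    then have "smooth_on ?S (\<lambda>z. f (transition d a z))"
      using smooth_on_compose[OF S U(1) _ _ sm(1)] smooth_on_subset[OF s] by simp
    then show "smooth_on ?S (transition d c)"
      by (rule smooth_on_cong[OF S]) (simp add: transition_def snd_c)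
  qed
  have "smooth_on V (transition c c)"
    by (rule smooth_on_cong[OF V smooth_on_id[OF V]])
       (use chart_inv_right[of _ c] im_c in \<open>auto simp: transition_def\<close>)
  then have "smooth_atlas (insert c A)"
    unfolding smooth_atlas_def using inj_c im_c V cd dc A(1) smooth_atlasD[OF A(1)] by auto
  moreover have "fst c \<subseteq> points A" using fst_c points_memI[OF A(2)] by auto
  ultimately show ?thesis by (simp add: compatible_chart_def c_def)
qed

text \<open>In the coordinates of a holomorphic chart \<open>J\<close> is constant, hence in any chart it is a constant map
  conjugated by the derivatives of transition maps. So only the algebraic identities have to be
  known for \<open>J\<close>; its smoothness comes from integrability.\<close>

lemma integrable_imp_almost_complex_structure:
  assumes A: "smooth_atlas A"
    and J: "\<And>p. p \<in> points A \<Longrightarrow> linear_on (tangent_space A p) (J p)"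
      "\<And>p v. p \<in> points A \<Longrightarrow> v \<in> tangent_space A p \<Longrightarrow> J p v \<in> tangent_space A p \<and> J p (J p v) = - v"
    and int: "integrable_acs A J"
  shows "almost_complex_structure A J"
  unfolding almost_complex_structure_def
proof (intro conjI ballI allI)
  fix c and e assume c: "c \<in> A"
  show "smooth_on (snd c ` fst c) (\<lambda>y. J (chart_inv c y) (coord_vec A c (chart_inv c y) e) c)"
  proof (rule smooth_on_local)
    fix y0 assume y0: "y0 \<in> snd c ` fst c"
    define p where "p = chart_inv c y0"
    have p: "p \<in> fst c" "snd c p = y0" "p \<in> points A"
      using chart_inv_right[OF y0] points_memI[OF c] by (auto simp: p_def)
    obtain n j where n: "compatible_chart A n" "p \<in> fst n" "linear j"
      "\<And>x v. x \<in> fst n \<Longrightarrow> v \<in> tangent_space A x \<Longrightarrow>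
          vec_coords A n x (J x v) = j (vec_coords A n x v)"
      using int p(3) unfolding integrable_acs_def by blast
    have nA: "smooth_atlas (insert n A)" using n(1) by (simp add: compatible_chart_def)
    let ?T = "snd c ` (fst c \<inter> fst n)" and ?T' = "snd n ` (fst n \<inter> fst c)"
    have T: "open ?T" "open ?T'" "smooth_on ?T (transition c n)" "smooth_on ?T' (transition n c)"
      using smooth_atlasD(3,4)[OF nA] c by auto
    have "(\<lambda>x. x) ` ?T \<subseteq> ?T" by blast
    from smooth_on_frechet_derivative[OF T(1) T(1) this smooth_on_id[OF T(1)] smooth_on_const[OF T(1)] T(3)]
    have "smooth_on ?T (\<lambda>y. frechet_derivative (transition c n) (at y) e)" .
    from smooth_on_linear[OF T(1) n(3) this]
    have inner: "smooth_on ?T (\<lambda>y. j (frechet_derivative (transition c n) (at y) e))" .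
    have "transition c n ` ?T \<subseteq> ?T'"
      using chart_inv_left[OF smooth_atlasD(1)[OF A c]] by (auto simp: transition_def)
    from smooth_on_frechet_derivative[OF T(1,2) this T(3) inner T(4)]
    have "smooth_on ?T (\<lambda>y. frechet_derivative (transition n c) (at (transition c n y))
        (j (frechet_derivative (transition c n) (at y) e)))" .
    then have "smooth_on ?T (\<lambda>y. J (chart_inv c y) (coord_vec A c (chart_inv c y) e) c)"
    proof (rule smooth_on_cong[OF T(1)])
      fix y assume "y \<in> ?T"
      then obtain x where x: "x \<in> fst c" "x \<in> fst n" "y = snd c x" by auto
      have inv: "chart_inv c y = x" using x chart_inv_left[OF smooth_atlasD(1)[OF A c]] by simp
      let ?v = "coord_vec A c x e"
      note v = coord_vec_tangent[OF A c x(1), of e]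
      have Jv: "J x ?v \<in> tangent_space A x" using J(2)[OF points_memI[OF c x(1)] v(1)] by simp
      have "J x ?v c = chart_deriv n c (\<lambda>x. x) x (j (chart_deriv c n (\<lambda>x. x) x e))"
        using vec_coords_eq(2)[OF nA c x(1,2) Jv] vec_coords_eq(1)[OF nA c x(1,2) v(1)] n(4)[OF x(2) v(1)] v(2)
        by simp
      then show "frechet_derivative (transition n c) (at (transition c n y))
        (j (frechet_derivative (transition c n) (at y) e)) =
         J (chart_inv c y) (coord_vec A c (chart_inv c y) e) c"
        unfolding inv x(3) transition_chart_deriv
        using chart_inv_left[OF smooth_atlasD(1)[OF A c] x(1)]
        by (simp add: transition_chart_deriv[symmetric]) (simp add: transition_def)
    qed
    then show "\<exists>T. open T \<and> y0 \<in> T \<and>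
        smooth_on T (\<lambda>y. J (chart_inv c y) (coord_vec A c (chart_inv c y) e) c)"
      using T(1) p n(2) by blast
  qed
qed (use J in auto)

section \<open>Linear algebra with finite families\<close>

lemma family_basis:
  fixes f :: "'i \<Rightarrow> 'v::real_vector"
  assumes fin: "finite I" and zero: "\<And>c. (\<Sum>i\<in>I. c i *\<^sub>R f i) = 0 \<Longrightarrow> \<forall>i\<in>I. c i = 0"
  shows "inj_on f I" "independent (f ` I)"
proof -
  show inj: "inj_on f I"
  proof (rule inj_onI, rule ccontr)
    fix i j assume ij: "i \<in> I" "j \<in> I" "f i = f j" "i \<noteq> j"
    let ?c = "\<lambda>l. if l = i then 1 else if l = j then -1 else (0::real)"
    have "(\<Sum>l\<in>I. ?c l *\<^sub>R f l) = (\<Sum>l\<in>{i,j}. ?c l *\<^sub>R f l)"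
      by (rule sum.mono_neutral_right) (use fin ij in auto)
    also have "\<dots> = 0" using ij by simp
    finally show False using zero[of ?c] ij by auto
  qed
  show "independent (f ` I)"
    unfolding dependent_finite[OF finite_imageI[OF fin]] sum.reindex[OF inj]
    using zero[of "\<lambda>i. _ (f i)"] by (auto simp: comp_def)
qed

lemma family_representation:
  fixes f :: "'i \<Rightarrow> 'v::real_vector"
  assumes "finite I" "inj_on f I" "independent (f ` I)"
  shows "v \<in> span (f ` I) \<Longrightarrow> (\<Sum>i\<in>I. representation (f ` I) v (f i) *\<^sub>R f i) = v"
    and "j \<in> I \<Longrightarrow> representation (f ` I) (\<Sum>i\<in>I. c i *\<^sub>R f i) (f j) = c j"
proof -
  show "(\<Sum>i\<in>I. representation (f ` I) v (f i) *\<^sub>R f i) = v" if "v \<in> span (f ` I)"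
    using sum_representation_eq[OF assms(3) that finite_imageI[OF assms(1)] order_refl]
    by (simp add: sum.reindex[OF assms(2)] comp_def)
  show "representation (f ` I) (\<Sum>i\<in>I. c i *\<^sub>R f i) (f j) = c j" if j: "j \<in> I"
  proof -
    have "representation (f ` I) (\<Sum>i\<in>I. c i *\<^sub>R f i) (f j) =
        (\<Sum>i\<in>I. c i * representation (f ` I) (f i) (f j))"
      by (simp add: representation_sum[OF assms(3)] representation_scale[OF assms(3)] span_base span_scale)
    also have "\<dots> = (\<Sum>i\<in>I. if i = j then c i else 0)"
      using assms(2) j by (intro sum.cong) (auto simp: representation_basis[OF assms(3)] inj_on_eq_iff)
    also have "\<dots> = c j" using j assms(1) by simp
    finally show ?thesis .
  qed
qed

lemma independent_pair_iff:
  "x \<noteq> y \<and> independent {x, y} \<longleftrightarrow> (\<forall>a b. a *\<^sub>R x + b *\<^sub>R y = 0 \<longrightarrow> a = 0 \<and> b = 0)"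
  for x y :: "'v::real_vector"
proof
  assume *: "x \<noteq> y \<and> independent {x, y}"
  show "\<forall>a b. a *\<^sub>R x + b *\<^sub>R y = 0 \<longrightarrow> a = 0 \<and> b = 0"
  proof (intro allI impI)
    fix a b assume ab: "a *\<^sub>R x + b *\<^sub>R y = 0"
    have "finite {x, y}" by simp
    from dependent_finite[OF this] * have
      "\<And>u. (\<Sum>v\<in>{x, y}. u v *\<^sub>R v) = 0 \<Longrightarrow> \<forall>v\<in>{x, y}. u v = 0" by blast
    from this[of "\<lambda>v. if v = x then a else b"] * ab show "a = 0 \<and> b = 0" by auto
  qed
next
  assume *: "\<forall>a b. a *\<^sub>R x + b *\<^sub>R y = 0 \<longrightarrow> a = 0 \<and> b = 0"
  have ne: "x \<noteq> y" using *[rule_format, of 1 "-1"] by auto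
  have "finite {x, y}" by simp
  from dependent_finite[OF this] have "independent {x, y}" using * ne by auto
  with ne show "x \<noteq> y \<and> independent {x, y}" ..
qed

lemma span_pair: "v \<in> span {x, y} \<longleftrightarrow> (\<exists>a b. v = a *\<^sub>R x + b *\<^sub>R y)"
  for v x y :: "'v::real_vector"
  by (auto simp: span_breakdown_eq algebra_simps)

section \<open>Binary forms\<close>

lemma sum_fun_apply: "(\<Sum>i\<in>I. f i) x = (\<Sum>i\<in>I. f i x)"
  by (induction I rule: infinite_finite_induct) simp_all


lemma hmonom_basis: "inj_on (hmonom k) {..k}" "independent (hmonom k ` {..k})"
proof -
  have "\<forall>i\<in>{..k}. c i = 0" if "(\<Sum>i\<in>{..k}. c i *\<^sub>R hmonom k i) = 0" for c
  proof -
    have "(\<Sum>i\<le>k. c i * t ^ i) = 0" for t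
    proof -
      have "(\<Sum>i\<le>k. c i *\<^sub>R hmonom k i) (vector [1, t]) = 0" using that by simp
      then show ?thesis by (simp add: sum_fun_apply scaleR_fun_def hmonom_def)
    qed
    then show ?thesis using polyfun_eq_0[where c = c and n = k] by simp
  qed
  then show "inj_on (hmonom k) {..k}" "independent (hmonom k ` {..k})"
    using family_basis[where f = "hmonom k" and I = "{..k}"] by blast+
qed

lemma hcoeff_expand: "V \<in> hpoly k \<Longrightarrow> (\<Sum>i\<le>k. hcoeff k V i *\<^sub>R hmonom k i) = V"
  unfolding hpoly_def hcoeff_def by (rule family_representation(1)[OF finite_atMost hmonom_basis])

lemma hcoeff_sum: "j \<le> k \<Longrightarrow> hcoeff k (\<Sum>i\<le>k. c i *\<^sub>R hmonom k i) j = c j"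
  unfolding hcoeff_def using family_representation(2)[OF finite_atMost hmonom_basis, of j k] by simp

lemma hpoly_sum: "(\<Sum>i\<le>k. c i *\<^sub>R hmonom k i) \<in> hpoly k"
  unfolding hpoly_def by (intro span_sum span_scale span_base) simp

lemma hmonom_hpoly: "i \<le> k \<Longrightarrow> hmonom k i \<in> hpoly k"
  unfolding hpoly_def by (intro span_base) simp

lemma subspace_hpoly: "subspace (hpoly k)"
  by (simp add: hpoly_def)

lemma hpoly_mult_linear:
  assumes "V \<in> hpoly k"
  shows "(\<lambda>w. (a * w $ 1 + b * w $ 2) * V w) \<in> hpoly (Suc k)"
proof -
  have eq: "(\<lambda>w. (a * w $ 1 + b * w $ 2) * V w) =
      (\<Sum>i\<le>k. hcoeff k V i *\<^sub>R (a *\<^sub>R hmonom (Suc k) i + b *\<^sub>R hmonom (Suc k) (Suc i)))" (is "?l = ?r")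
  proof
    fix w
    have "?l w = (a * w $ 1 + b * w $ 2) * (\<Sum>i\<le>k. hcoeff k V i * hmonom k i w)"
      by (subst hcoeff_expand[OF assms, symmetric]) (simp add: sum_fun_apply scaleR_fun_def)
    also have "\<dots> = (\<Sum>i\<le>k. hcoeff k V i * (a * hmonom (Suc k) i w + b * hmonom (Suc k) (Suc i) w))"
      unfolding sum_distrib_left
      by (intro sum.cong) (auto simp: hmonom_def Suc_diff_le algebra_simps)
    finally show "?l w = ?r w" by (simp add: sum_fun_apply scaleR_fun_def)
  qed
  show ?thesis unfolding eq
    by (intro subspace_sum subspace_hpoly subspace_scale[OF subspace_hpoly] subspace_add[OF subspace_hpoly]
        hmonom_hpoly) auto
qed

text \<open>Products of linear forms account both for the action of matrices on monomials and for the
  generators of symmetric powers.\<close>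

lemma hpoly_prod_list:
  "(\<lambda>w. prod_list (map (\<lambda>(a, b). a * w $ 1 + b * w $ 2) ps)) \<in> hpoly (length ps)"
proof (induction ps)
  case Nil
  have "(\<lambda>w. 1) = hmonom 0 0" by (auto simp: hmonom_def)
  then show ?case using hmonom_hpoly[of 0 0] by simp
next
  case (Cons p ps)
  obtain a b where p: "p = (a, b)" by force
  show ?case using hpoly_mult_linear[OF Cons.IH, of a b] p by simp
qed

lemma vector_mult_2:
  "(w v* g) $ j = w $ 1 * g $ 1 $ j + w $ 2 * g $ 2 $ j" for g :: "real^2^2"
  by (simp add: vector_matrix_mult_def sum_2 mult.commute)

lemma hact_hmonom_hpoly:
  assumes "j \<le> k" shows "hact (hmonom k j) g \<in> hpoly k"
proof -
  let ?ps = "replicate (k - j) (g $ 1 $ 1, g $ 2 $ 1) @ replicate j (g $ 1 $ 2, g $ 2 $ 2)"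
  have "hact (hmonom k j) g = (\<lambda>w. prod_list (map (\<lambda>(a, b). a * w $ 1 + b * w $ 2) ?ps))"
    by (auto simp: hact_def hmonom_def vector_mult_2 fun_eq_iff mult.commute)
  then show ?thesis using hpoly_prod_list[of ?ps] assms by simp
qed

section \<open>Binary forms as symmetric tensors\<close>

text \<open>A binary form evaluated at the pair \<open>(x, y)\<close> of vectors is a symmetric tensor.\<close>

definition subst_form :: "'v::real_vector \<Rightarrow> 'v \<Rightarrow> (real^2 \<Rightarrow> real) \<Rightarrow> ('v \<Rightarrow> real) \<Rightarrow> real" where
  "subst_form x y V = (\<lambda>\<alpha>. if linear \<alpha> then V (vector [\<alpha> x, \<alpha> y]) else 0)"

lemma subst_form_add: "subst_form x y (V + W) = subst_form x y V + subst_form x y W"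
  by (auto simp: subst_form_def)

lemma subst_form_scale: "subst_form x y (r *\<^sub>R V) = r *\<^sub>R subst_form x y V"
  by (auto simp: subst_form_def scaleR_fun_def)

lemma linear_subst_form: "linear (subst_form x y)"
  by (intro linearI subst_form_add subst_form_scale)

lemma subst_form_hmonom: "subst_form x y (hmonom k i) = sym_monom k i x y"
  by (auto simp: subst_form_def sym_monom_def sym_prod_def hmonom_def fun_eq_iff)

text \<open>Acting by \<open>g\<close> on a form amounts to evaluating it at the pair \<open>(x, y) g\<close>. This turns the matrix
  \<open>rho k g\<close> into the change of frame induced by \<open>g\<close>.\<close>

lemma subst_form_hact:
  "subst_form x y (hact V g) =
   subst_form (g $ 1 $ 1 *\<^sub>R x + g $ 2 $ 1 *\<^sub>R y) (g $ 1 $ 2 *\<^sub>R x + g $ 2 $ 2 *\<^sub>R y) V"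
proof
  fix \<alpha> :: "'a \<Rightarrow> real"
  have "vector [\<alpha> x, \<alpha> y] v* g =
     vector [\<alpha> (g $ 1 $ 1 *\<^sub>R x + g $ 2 $ 1 *\<^sub>R y), \<alpha> (g $ 1 $ 2 *\<^sub>R x + g $ 2 $ 2 *\<^sub>R y)]" if "linear \<alpha>"
    using that by (simp add: vec_eq_iff forall_2 vector_mult_2 linear_add linear_scale mult.commute)
  then show "subst_form x y (hact V g) \<alpha> = subst_form (g $ 1 $ 1 *\<^sub>R x + g $ 2 $ 1 *\<^sub>R y)
      (g $ 1 $ 2 *\<^sub>R x + g $ 2 $ 2 *\<^sub>R y) V \<alpha>"
    by (simp add: subst_form_def hact_def)
qed

text \<open>Linear functionals take arbitrary values on the independent vectors \<open>x\<close> and \<open>y\<close>, so the tensor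
  determines all values of the form.\<close>

lemma subst_form_eq_0:
  assumes "x \<noteq> y" "independent {x, y}" "subst_form x y V = 0"
  shows "V = 0"
proof
  fix w :: "real^2"
  obtain \<alpha> where \<alpha>: "linear \<alpha>" "\<forall>v\<in>{x, y}. \<alpha> v = (if v = x then w $ 1 else w $ 2)"
    using linear_independent_extend[OF assms(2), of "\<lambda>v. if v = x then w $ 1 else w $ 2"] by auto
  have "\<alpha> x = w $ 1" "\<alpha> y = w $ 2" using \<alpha>(2) assms(1) by simp_all
  then have "vector [\<alpha> x, \<alpha> y] = w" by (simp add: vec_eq_iff forall_2)
  then show "V w = 0 w" using fun_cong[OF assms(3), of \<alpha>] \<alpha>(1) by (simp add: subst_form_def)
qed

lemma sym_prod_subst_form:
  assumes "set vs \<subseteq> span {x, y}"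
  shows "\<exists>V\<in>hpoly (length vs). subst_form x y V = sym_prod vs"
proof -
  have "\<forall>v\<in>set vs. \<exists>ab. v = fst ab *\<^sub>R x + snd ab *\<^sub>R y"
    using assms span_pair by fastforce
  then obtain f where f: "\<And>v. v \<in> set vs \<Longrightarrow> v = fst (f v) *\<^sub>R x + snd (f v) *\<^sub>R y"
    by metis
  have "map \<alpha> vs = map ((\<lambda>(a, b). a * \<alpha> x + b * \<alpha> y) \<circ> f) vs" if "linear \<alpha>" for \<alpha> :: "'a \<Rightarrow> real"
  proof (rule map_cong[OF refl])
    fix v assume "v \<in> set vs"
    from arg_cong[OF f[OF this], of \<alpha>] show "\<alpha> v = ((\<lambda>(a, b). a * \<alpha> x + b * \<alpha> y) \<circ> f) v"
      using that by (simp add: linear_add linear_scale split_beta)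
  qed
  then have "prod_list (map (\<lambda>(a, b). a * \<alpha> x + b * \<alpha> y) (map f vs)) = prod_list (map \<alpha> vs)"
    if "linear \<alpha>" for \<alpha> :: "'a \<Rightarrow> real" using that by (metis map_map)
  then have "subst_form x y (\<lambda>w. prod_list (map (\<lambda>(a, b). a * w $ 1 + b * w $ 2) (map f vs))) = sym_prod vs"
    unfolding subst_form_def sym_prod_def fun_eq_iff by simp
  then show ?thesis using hpoly_prod_list[of "map f vs"] by auto
qed

lemma sym_power_subst_form: "sym_power k (span {x, y}) = subst_form x y ` hpoly k"
proof
  have "{sym_prod vs |vs. length vs = k \<and> set vs \<subseteq> span {x, y}} \<subseteq> subst_form x y ` hpoly k"
    using sym_prod_subst_form[of _ x y] by (force simp: image_iff)
  then show "sym_power k (span {x, y}) \<subseteq> subst_form x y ` hpoly k"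
    unfolding sym_power_def
    by (rule span_minimal) (rule linear_subspace_image[OF linear_subst_form subspace_hpoly])
  have "sym_monom k i x y \<in> sym_power k (span {x, y})" if "i \<le> k" for i
    unfolding sym_power_def sym_monom_def
    by (rule span_base) (use that in \<open>auto intro!: exI simp: span_base\<close>)
  then have "(subst_form x y ` (hmonom k ` {..k})) \<subseteq> sym_power k (span {x, y})"
    by (auto simp: subst_form_hmonom)
  then have "span (subst_form x y ` (hmonom k ` {..k})) \<subseteq> sym_power k (span {x, y})"
    by (rule span_minimal) (simp add: sym_power_def)
  then show "subst_form x y ` hpoly k \<subseteq> sym_power k (span {x, y})"
    unfolding hpoly_def by (simp add: linear_span_image[OF linear_subst_form])
qed

lemma linear_functional_separates:
  fixes v :: "'v::real_vector"
  assumes "\<And>\<alpha> :: 'v \<Rightarrow> real. linear \<alpha> \<Longrightarrow> \<alpha> v = \<alpha> w"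
  shows "v = w"
proof (rule ccontr)
  assume "v \<noteq> w"
  then have "independent {v - w}" by simp
  from linear_independent_extend[OF this, of "\<lambda>_. 1 :: real"]
  obtain \<alpha> :: "'v \<Rightarrow> real" where "linear \<alpha>" "\<alpha> (v - w) = 1" by auto
  then show False using assms[of \<alpha>] by (simp add: linear_diff)
qed

text \<open>Since odd powers of real numbers are injective, a vector is determined by its \<open>k\<close>-th power.\<close>

lemma sym_monom_determines_pair:
  assumes "odd k" "sym_monom k 0 x y = sym_monom k 0 x' y'" "sym_monom k k x y = sym_monom k k x' y'"
  shows "x = x'" "y = y'"
proof -
  have "\<alpha> x ^ k = \<alpha> x' ^ k" "\<alpha> y ^ k = \<alpha> y' ^ k" if "linear \<alpha>" for \<alpha> :: "'a \<Rightarrow> real"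
    using fun_cong[OF assms(2), of \<alpha>] fun_cong[OF assms(3), of \<alpha>] that
    by (simp_all add: sym_monom_def sym_prod_def)
  then have "\<alpha> x = \<alpha> x'" "\<alpha> y = \<alpha> y'" if "linear \<alpha>" for \<alpha> :: "'a \<Rightarrow> real"
    using that assms(1) odd_real_root_power_cancel by metis+
  then show "x = x'" "y = y'" using linear_functional_separates by blast+
qed

section \<open>Frames as linear isomorphisms\<close>

lemma
  assumes "inj_on \<eta> {..k}" "independent (\<eta> ` {..k})"
  shows frame_map_inv: "v \<in> span (\<eta> ` {..k}) \<Longrightarrow> frame_map k \<eta> (frame_inv k \<eta> v) = v"
    and frame_inv_add: "v \<in> span (\<eta> ` {..k}) \<Longrightarrow> w \<in> span (\<eta> ` {..k}) \<Longrightarrow>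
      frame_inv k \<eta> (v + w) = frame_inv k \<eta> v + frame_inv k \<eta> w"
    and frame_inv_scale: "v \<in> span (\<eta> ` {..k}) \<Longrightarrow> frame_inv k \<eta> (r *\<^sub>R v) = r *\<^sub>R frame_inv k \<eta> v"
proof -
  note rep = family_representation[OF finite_atMost assms]
  show "frame_map k \<eta> (frame_inv k \<eta> v) = v" if "v \<in> span (\<eta> ` {..k})"
    unfolding frame_map_def frame_inv_def using rep(1)[OF that] by (simp add: hcoeff_sum)
  show "frame_inv k \<eta> (v + w) = frame_inv k \<eta> v + frame_inv k \<eta> w"
    if "v \<in> span (\<eta> ` {..k})" "w \<in> span (\<eta> ` {..k})"
    by (simp add: frame_inv_def representation_add[OF assms(2) that(2,1)] representation_add[OF assms(2) that]
        scaleR_add_left sum.distrib)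
  show "frame_inv k \<eta> (r *\<^sub>R v) = r *\<^sub>R frame_inv k \<eta> v" if "v \<in> span (\<eta> ` {..k})"
    by (simp add: frame_inv_def representation_scale[OF assms(2) that] scaleR_sum_right)
qed

lemma frame_inv_hpoly: "frame_inv k \<eta> v \<in> hpoly k"
  by (simp add: frame_inv_def hpoly_sum)

section \<open>The basis of binary forms adapted to rotations\<close>

lemma infinite_unit_circle: "infinite {z::complex. cmod z = 1}"
proof
  assume fin: "finite {z::complex. cmod z = 1}"
  let ?f = "\<lambda>t. Complex t (sqrt (1 - t\<^sup>2))"
  have "?f ` {0..1} \<subseteq> {z. cmod z = 1}"
    by (auto simp: cmod_def power_le_one)
  then have "finite (?f ` {0..1})" using fin finite_subset by blast
  moreover have "inj_on ?f {0..1}" by (auto simp: inj_on_def)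
  ultimately have "finite {0..1::real}" using finite_imageD by blast
  then show False using infinite_Icc[of 0 "1::real"] by simp
qed

definition Vfamily :: "nat \<Rightarrow> nat + nat \<Rightarrow> real^2 \<Rightarrow> real" where
  "Vfamily k = case_sum (Veven k) (Vodd k)"

lemma Vbasis_Vfamily: "Vbasis k = Vfamily k ` ({..k div 2} <+> {..k div 2})"
  by (auto simp: Vbasis_def Vfamily_def Plus_def image_Un image_image)

text \<open>On the unit circle \<open>z\<^sup>k\<close> times the real part of \<open>\<Sum>\<^sub>j c\<^sub>j z\<^sup>k\<^sup>-\<^sup>2\<^sup>j\<close> is a polynomial in \<open>z\<close> with
  coefficients \<open>c\<^sub>j / 2\<close> at \<open>z\<^sup>2\<^sup>k\<^sup>-\<^sup>2\<^sup>j\<close> and \<open>cnj c\<^sub>j / 2\<close> at \<open>z\<^sup>2\<^sup>j\<close>. For odd \<open>k\<close> these exponents are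
  all different.\<close>

lemma Vfamily_basis:
  assumes "odd k"
  shows "inj_on (Vfamily k) ({..k div 2} <+> {..k div 2})" "independent (Vbasis k)"
proof -
  let ?m = "k div 2"
  have k: "k = 2 * ?m + 1" using assms by simp
  have "\<forall>i\<in>{..?m} <+> {..?m}. c i = 0"
    if c: "(\<Sum>i\<in>{..?m} <+> {..?m}. c i *\<^sub>R Vfamily k i) = 0" for c
  proof -
    define C where "C = (\<lambda>j. Complex (c (Inl j)) (- c (Inr j)))"
    define P where "P = (\<Sum>j\<le>?m. monom (C j) (2 * k - 2 * j) + monom (cnj (C j)) (2 * j))"
    have "poly P z = 0" if z: "cmod z = 1" for z
    proof -
      let ?w = "vector [Re z, Im z] :: real^2"
      have zz: "z * cnj z = 1" using z by (simp add: complex_norm_square[symmetric])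
      have "(Re z)\<^sup>2 + (Im z)\<^sup>2 = 1" using z by (metis cmod_power2 one_power2)
      then have Vc: "Vcpx k j ?w = z ^ (k - 2 * j)" for j by (simp add: Vcpx_def)
      have "(\<Sum>i\<in>{..?m} <+> {..?m}. c i *\<^sub>R Vfamily k i) ?w = 0" using c by simp
      then have "(\<Sum>j\<le>?m. c (Inl j) * Re (z ^ (k - 2*j))) + (\<Sum>j\<le>?m. c (Inr j) * Im (z ^ (k - 2*j))) = 0"
        by (simp add: sum_fun_apply scaleR_fun_def sum.Plus Vfamily_def Veven_def Vodd_def Vc)
      then have re: "(\<Sum>j\<le>?m. Re (C j * z ^ (k - 2*j))) = 0"
        by (simp add: C_def sum.distrib[symmetric])
      have "poly P z = (\<Sum>j\<le>?m. C j * z ^ (2 * k - 2 * j) + cnj (C j) * z ^ (2 * j))"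
        by (simp add: P_def poly_sum poly_monom)
      also have "\<dots> = (\<Sum>j\<le>?m. z ^ k * (2 * of_real (Re (C j * z ^ (k - 2*j)))))"
      proof (rule sum.cong[OF refl])
        fix j assume "j \<in> {..?m}"
        then have j: "2 * j \<le> k" by simp
        have e1: "z ^ (2 * k - 2 * j) = z ^ k * z ^ (k - 2 * j)"
          unfolding power_add[symmetric] using j by (intro arg_cong[where f = "\<lambda>n. z ^ n"]) simp
        have "z ^ k = z ^ (2 * j) * z ^ (k - 2 * j)"
          unfolding power_add[symmetric] using j by simp
        then have e2: "z ^ k * cnj z ^ (k - 2 * j) = z ^ (2 * j)"
          using zz by (simp add: mult.assoc power_mult_distrib[symmetric])
        have "C j * z ^ (2 * k - 2 * j) + cnj (C j) * z ^ (2 * j) =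
            z ^ k * (C j * z ^ (k - 2*j) + cnj (C j * z ^ (k - 2*j)))"
          unfolding e1 e2[symmetric] by (simp add: algebra_simps)
        then show "C j * z ^ (2 * k - 2 * j) + cnj (C j) * z ^ (2 * j) =
            z ^ k * (2 * of_real (Re (C j * z ^ (k - 2*j))))"
          unfolding complex_add_cnj by simp
      qed
      also have "\<dots> = z ^ k * 2 * of_real (\<Sum>j\<le>?m. Re (C j * z ^ (k - 2*j)))"
        by (simp only: sum_distrib_left of_real_sum mult.assoc)
      also have "\<dots> = 0" by (simp only: re) simp
      finally show ?thesis .
    qed
    then have "infinite {z. poly P z = 0}"
      using infinite_unit_circle infinite_super[of "{z. cmod z = 1}" "{z. poly P z = 0}"] by blast
    then have P0: "P = 0" using poly_roots_finite by blast
    have "C i = 0" if i: "i \<le> ?m" for i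
    proof -
      have "coeff P (2 * i) = (\<Sum>j\<le>?m. if i = j then cnj (C j) else 0)"
        unfolding P_def coeff_sum using i k by (intro sum.cong) auto
      then have "coeff P (2 * i) = cnj (C i)" using i by simp
      then show ?thesis using P0 by simp
    qed
    then show ?thesis by (auto simp: C_def complex_eq_iff)
  qed
  note zero = this
  have fin: "finite ({..?m} <+> {..?m})" by simp
  show "inj_on (Vfamily k) ({..k div 2} <+> {..k div 2})" "independent (Vbasis k)"
    unfolding Vbasis_Vfamily by (rule family_basis[OF fin], erule zero)+
qed

text \<open>Multiplying by \<open>x + \<i> y\<close> or \<open>x - \<i> y\<close> keeps real and imaginary parts homogeneous, and
  \<open>x\<^sup>2 + y\<^sup>2\<close> is the product of the two.\<close>

lemma Vcpx_hpoly:
  assumes "2 * j \<le> k"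
  shows "Veven k j \<in> hpoly k" "Vodd k j \<in> hpoly k"
proof -
  let ?z = "\<lambda>w::real^2. Complex (w $ 1) (w $ 2)"
  have step: "(\<lambda>w. Re (L w * f w)) \<in> hpoly (Suc n) \<and> (\<lambda>w. Im (L w * f w)) \<in> hpoly (Suc n)"
    if f: "(\<lambda>w. Re (f w)) \<in> hpoly n" "(\<lambda>w. Im (f w)) \<in> hpoly n"
      and L: "L = ?z \<or> L = (\<lambda>w. cnj (?z w))" for f n L
  proof -
    have 1: "(\<lambda>w. w $ 1 * Re (f w)) \<in> hpoly (Suc n)" "(\<lambda>w. w $ 2 * Re (f w)) \<in> hpoly (Suc n)"
      "(\<lambda>w. w $ 1 * Im (f w)) \<in> hpoly (Suc n)" "(\<lambda>w. w $ 2 * Im (f w)) \<in> hpoly (Suc n)"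
      using hpoly_mult_linear[OF f(1), of 1 0] hpoly_mult_linear[OF f(1), of 0 1]
        hpoly_mult_linear[OF f(2), of 1 0] hpoly_mult_linear[OF f(2), of 0 1] by simp_all
    note a = subspace_add[OF subspace_hpoly, unfolded plus_fun_def]
    note d = subspace_diff[OF subspace_hpoly, unfolded fun_diff_def]
    show ?thesis using L a[OF 1(1,4)] a[OF 1(3,2)] d[OF 1(1,4)] d[OF 1(3,2)] by auto
  qed
  have pow: "(\<lambda>w. Re (?z w ^ n)) \<in> hpoly n \<and> (\<lambda>w. Im (?z w ^ n)) \<in> hpoly n" for n
  proof (induction n)
    case 0
    have "(\<lambda>w. 1) = hmonom 0 0" by (auto simp: hmonom_def)
    then show ?case using hmonom_hpoly[of 0 0] subspace_0[OF subspace_hpoly, of 0]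
      by (simp add: zero_fun_def)
  next
    case (Suc n)
    then show ?case using step[of "\<lambda>w. ?z w ^ n" n ?z] by simp
  qed
  have "(\<lambda>w. Re (of_real ((w $ 1)\<^sup>2 + (w $ 2)\<^sup>2) ^ j * ?z w ^ n)) \<in> hpoly (2 * j + n) \<and>
      (\<lambda>w. Im (of_real ((w $ 1)\<^sup>2 + (w $ 2)\<^sup>2) ^ j * ?z w ^ n)) \<in> hpoly (2 * j + n)" for j n
  proof (induction j)
    case 0
    show ?case using pow[of n] by simp
  next
    case (Suc j)
    let ?f = "\<lambda>w. of_real ((w $ 1)\<^sup>2 + (w $ 2)\<^sup>2) ^ j * ?z w ^ n"
    have eq: "?z w * (cnj (?z w) * ?f w) = of_real ((w $ 1)\<^sup>2 + (w $ 2)\<^sup>2) ^ Suc j * ?z w ^ n" for w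
    proof -
      have "?z w * cnj (?z w) = of_real ((w $ 1)\<^sup>2 + (w $ 2)\<^sup>2)"
        by (simp add: complex_mult_cnj)
      then have "?z w * cnj (?z w) * ?f w = of_real ((w $ 1)\<^sup>2 + (w $ 2)\<^sup>2) * ?f w" by (simp only:)
      then show ?thesis by (simp only: mult.assoc power_Suc)
    qed
    have "(\<lambda>w. Re (cnj (?z w) * ?f w)) \<in> hpoly (Suc (2 * j + n)) \<and>
        (\<lambda>w. Im (cnj (?z w) * ?f w)) \<in> hpoly (Suc (2 * j + n))"
      using Suc by (intro step) auto
    then have "(\<lambda>w. Re (?z w * (cnj (?z w) * ?f w))) \<in> hpoly (Suc (Suc (2 * j + n))) \<and>
        (\<lambda>w. Im (?z w * (cnj (?z w) * ?f w))) \<in> hpoly (Suc (Suc (2 * j + n)))"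
      by (intro step) auto
    then show ?case unfolding eq by simp
  qed
  from this[of j "k - 2 * j"] assms show "Veven k j \<in> hpoly k" "Vodd k j \<in> hpoly k"
    by (simp_all add: Veven_def Vodd_def Vcpx_def)
qed

text \<open>\<open>Vbasis k\<close> consists of \<open>k + 1\<close> independent elements of a space of dimension \<open>k + 1\<close>.\<close>

lemma span_Vbasis:
  assumes "odd k" shows "span (Vbasis k) = hpoly k"
proof
  have sub: "Vbasis k \<subseteq> hpoly k" using Vcpx_hpoly[of _ k] by (auto simp: Vbasis_def)
  then show "span (Vbasis k) \<subseteq> hpoly k" by (simp add: span_minimal subspace_hpoly)
  have card: "card (Vbasis k) = k + 1"
    unfolding Vbasis_Vfamily card_image[OF Vfamily_basis(1)[OF assms]]
    using assms by (simp add: card_Plus) presburger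
  have "hmonom k i \<in> span (Vbasis k)" if i: "i \<le> k" for i
  proof (rule ccontr)
    assume "hmonom k i \<notin> span (Vbasis k)"
    then have ind: "independent (insert (hmonom k i) (Vbasis k))" and nin: "hmonom k i \<notin> Vbasis k"
      using Vfamily_basis(2)[OF assms] by (auto simp: independent_insert span_base)
    have "insert (hmonom k i) (Vbasis k) \<subseteq> span (hmonom k ` {..k})"
      using sub hmonom_hpoly[OF i] by (auto simp: hpoly_def)
    from independent_span_bound[OF finite_imageI[OF finite_atMost] ind this]
    have "card (insert (hmonom k i) (Vbasis k)) \<le> k + 1"
      by (simp add: card_image[OF hmonom_basis(1)])
    moreover have "finite (Vbasis k)" by (simp add: Vbasis_def)
    ultimately show False using nin card by simp
  qed
  then show "hpoly k \<subseteq> span (Vbasis k)"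
    unfolding hpoly_def by (intro span_minimal) auto
qed

lemma
  assumes "odd k" "V \<in> hpoly k"
  shows xi_add: "W \<in> hpoly k \<Longrightarrow> xi k j (V + W) = xi k j V + xi k j W"
    and xi_scale: "xi k j (r *\<^sub>R V) = r *\<^sub>R xi k j V"
  using assms Vfamily_basis(2)[OF assms(1)]
  by (simp_all add: xi_def xi_even_def xi_odd_def span_Vbasis complex_eq_iff
      representation_add representation_scale)

text \<open>Multiplication by \<open>\<i>\<close> in all coordinates \<open>\<xi>\<^sup>k\<^sup>,\<^sup>j\<close> is \<open>Jpoly\<close>.\<close>

lemma Jpoly_xi:
  assumes "odd k" "V' \<in> hpoly k" "\<And>j. j \<le> k div 2 \<Longrightarrow> xi k j V' = \<i> * xi k j V"
  shows "V' = Jpoly k V"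
proof -
  have V': "V' \<in> span (Vfamily k ` ({..k div 2} <+> {..k div 2}))"
    using assms(1,2) span_Vbasis Vbasis_Vfamily by metis
  have fin: "finite ({..k div 2} <+> {..k div 2})" by simp
  have "V' = (\<Sum>i\<in>{..k div 2} <+> {..k div 2}. representation (Vbasis k) V' (Vfamily k i) *\<^sub>R Vfamily k i)"
    unfolding Vbasis_Vfamily
    by (rule family_representation(1)[OF fin Vfamily_basis(1)[OF assms(1)] _ V', symmetric])
       (use Vfamily_basis(2)[OF assms(1)] Vbasis_Vfamily in simp)
  also have "\<dots> = (\<Sum>j\<le>k div 2. xi_even k j V' *\<^sub>R Veven k j + xi_odd k j V' *\<^sub>R Vodd k j)"
    by (simp add: sum.Plus Vfamily_def xi_even_def xi_odd_def sum.distrib)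
  also have "\<dots> = Jpoly k V"
    unfolding Jpoly_def
  proof (rule sum.cong[OF refl])
    fix j assume "j \<in> {..k div 2}"
    then have "xi k j V' = \<i> * xi k j V" using assms(3) by simp
    then show "xi_even k j V' *\<^sub>R Veven k j + xi_odd k j V' *\<^sub>R Vodd k j =
        xi_even k j V *\<^sub>R Vodd k j - xi_odd k j V *\<^sub>R Veven k j"
      by (simp add: xi_def complex_eq_iff)
  qed
  finally show ?thesis .
qed

section \<open>Complex submanifolds\<close>

text \<open>Coordinates in a chart of the maximal atlas determine a tangent vector, so injectivity of the
  tangent map is visible in them.\<close>

lemma tangent_map_injective_coords:
  fixes A :: "('p, 'e::euclidean_space) chart set" and Q :: "('q, 'f::euclidean_space) chart set"
  assumes A: "smooth_atlas A" "a = chart_at A p"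
    and f: "mdiff A Q f p" and n: "smooth_atlas (insert n Q)" "f p \<in> fst n" "smooth_atlas Q"
    and inj: "inj_on (tangent_map A Q f p) (tangent_space A p)"
  shows "inj (chart_deriv a n f p)"
proof -
  have p: "p \<in> points A" "f p \<in> points Q" using f by (simp_all add: mdiff_def)
  note a = chart_at[OF p(1), folded A(2)]
  note vt = vec_coords_tangent_map[OF f n(1,2), folded A(2)]
  have lin: "linear (chart_deriv a n f p)" using chart_diff_linear[OF vt(1)] .
  show ?thesis
  proof (subst linear_injective_0[OF lin], intro allI impI)
    fix e assume e: "chart_deriv a n f p e = 0"
    let ?v = "coord_vec A a p e"
    let ?w = "tangent_map A Q f p ?v"
    note v = coord_vec_tangent[OF A(1) a, of e]
    have w: "?w \<in> tangent_space Q (f p)" using tangent_map_tangent_space[OF f n(3)] .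
    have 0: "vec_coords Q n (f p) ?w = 0" using vt(2)[of ?v] v(2) e by simp
    have "?w = 0"
    proof
      fix d
      show "?w d = 0 d"
      proof (cases "d \<in> Q \<and> f p \<in> fst d")
        case True
        then have "linear (chart_deriv n d (\<lambda>x. x) (f p))"
          using n by (intro chart_diff_linear transition_chart_diff[OF n(1)]) simp_all
        then show ?thesis
          using vec_coords_eq(2)[OF n(1) _ _ n(2) w, of d] True 0 by (simp add: linear_0)
      next
        case False
        then show ?thesis using tangent_space_zero[OF w] by simp
      qed
    qed
    moreover have "tangent_map A Q f p 0 = 0" using tangent_map_linear(2)[OF f, of 0 0] by simp
    ultimately have "?v = 0"
      using inj_onD[OF inj, of ?v 0] v(1) subspace_0[OF subspace_tangent_space[OF A(1)]] by metis
    then show "e = 0" using v(2) by simp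
  qed
qed

text \<open>Here \<open>n\<close> is a chart of the maximal atlas; smoothness is carried over from a chart of \<open>Q\<close> by a
  transition map.\<close>

lemma smooth_map_in_chart:
  assumes A: "smooth_atlas A" "a \<in> A" "p \<in> fst a" and f: "smooth_map A Q f"
    and n: "smooth_atlas (insert n Q)" "f p \<in> fst n"
  obtains U where "open U" "snd a p \<in> U" "U \<subseteq> snd a ` (fst a \<inter> f -` fst n)"
    "smooth_on U (snd n \<circ> f \<circ> chart_inv a)"
proof -
  have "f p \<in> points Q" using f points_memI[OF A(2,3)] by (auto simp: smooth_map_def)
  note d = chart_at[OF this]
  let ?d = "chart_at Q (f p)"
  let ?O = "snd a ` (fst a \<inter> f -` fst ?d)" and ?O2 = "snd ?d ` (fst ?d \<inter> fst n)"
  let ?H = "snd ?d \<circ> f \<circ> chart_inv a"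
  let ?U = "?O \<inter> ?H -` ?O2"
  note inv_a = chart_inv_left[OF smooth_atlasD(1)[OF A(1,2)]]
  have d': "?d \<in> insert n Q" "n \<in> insert n Q" using d by simp_all
  have inj_d: "inj_on (snd ?d) (fst ?d)" using smooth_atlasD(1)[OF n(1) d'(1)] .
  have O: "open ?O" "smooth_on ?O ?H" using f A(2) d(1) by (auto simp: smooth_map_def)
  have O2: "open ?O2" "smooth_on ?O2 (transition ?d n)" using smooth_atlasD(3,4)[OF n(1) d'] .
  have U: "open ?U" using continuous_open_preimage[OF smooth_on_continuous[OF O(2)] O(1) O2(1)] .
  have mem: "f (chart_inv a y) \<in> fst ?d \<inter> fst n \<and> chart_inv a y \<in> fst a" if y: "y \<in> ?U" for y
  proof -
    obtain x where x: "x \<in> fst a" "f x \<in> fst ?d" "y = snd a x" using y by blast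
    then have xy: "chart_inv a y = x" using inv_a by simp
    then obtain z where z: "z \<in> fst ?d" "z \<in> fst n" "snd ?d (f x) = snd ?d z" using y by auto
    then have "f x = z" using x(2) inj_onD[OF inj_d] by blast
    then show ?thesis using xy x z by simp
  qed
  have sub: "?H ` ?U \<subseteq> ?O2" "?U \<subseteq> ?O" by blast+
  from smooth_on_compose[OF U O2(1) sub(1) smooth_on_subset[OF O(2) sub(2)] O2(2)]
  have "smooth_on ?U (\<lambda>y. transition ?d n (?H y))" .
  then have "smooth_on ?U (snd n \<circ> f \<circ> chart_inv a)"
  proof (rule smooth_on_cong[OF U])
    fix y assume "y \<in> ?U"
    then have "f (chart_inv a y) \<in> fst ?d" using mem by blast
    then show "transition ?d n (?H y) = (snd n \<circ> f \<circ> chart_inv a) y"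
      by (simp add: transition_def chart_inv_left[OF inj_d])
  qed
  moreover have "snd a p \<in> ?U" using A d(2) n(2) inv_a[OF A(3)] by auto
  moreover have "?U \<subseteq> snd a ` (fst a \<inter> f -` fst n)"
  proof
    fix y assume y: "y \<in> ?U"
    then have "y = snd a (chart_inv a y)" using chart_inv_right(1)[of y a] by auto
    then show "y \<in> snd a ` (fst a \<inter> f -` fst n)" using mem[OF y] by blast
  qed
  ultimately show ?thesis using that U by blast
qed

text \<open>A real linear projection onto a complex subspace becomes complex linear after averaging with
  its conjugate by \<open>j\<close>; it still restricts to the identity on the subspace, which is the range of
  \<open>L\<close> here.\<close>

lemma complex_linear_left_inverse:
  fixes L :: "'e::euclidean_space \<Rightarrow> 'f::euclidean_space"
  assumes L: "linear L" "inj L" and j: "linear j" "\<And>z. j (j z) = - z"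
    and inv: "\<And>e. j (L e) \<in> range L"
  obtains R i where "linear R" "linear i" "\<And>e. R (L e) = e" "\<And>z. R (j z) = i (R z)" "\<And>e. i (i e) = - e"
proof -
  obtain L' where L': "linear L'" "\<And>e. L' (L e) = e"
    using linear_injective_left_inverse[OF L] by (metis comp_apply id_apply)
  have LL': "L (L' t) = t" if "t \<in> range L" for t using that L'(2) by auto
  define P where "P = (\<lambda>z. (1/2) *\<^sub>R (L (L' z) - j (L (L' (j z)))))"
  define R where "R = (\<lambda>z. L' (P z))"
  define i where "i = (\<lambda>e. L' (j (L e)))"
  note lin = linear_add linear_scale linear_diff linear_neg
  have linP: "linear P"
    unfolding P_def by (rule linearI) (simp_all add: lin[OF L(1)] lin[OF L'(1)] lin[OF j(1)] algebra_simps)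
  have rng: "P z \<in> range L" for z
    unfolding P_def
    using inv linear_subspace_image[OF L(1) subspace_UNIV] by (intro subspace_scale subspace_diff) auto
  have jP: "j (P z) = P (j z)" for z
    by (simp add: P_def lin[OF j(1)] lin[OF L(1)] lin[OF L'(1)] j(2))
  show ?thesis
  proof (rule that)
    show "linear R" unfolding R_def using linear_compose[OF linP L'(1)] by (simp add: comp_def)
    show "linear i" unfolding i_def
      using linear_compose[OF linear_compose[OF L(1) j(1)] L'(1)] by (simp add: comp_def)
    show "R (L e) = e" for e
      using LL'[OF inv] by (simp add: R_def P_def L'(2) j(2) lin[OF L'(1)] scaleR_2[symmetric])
    show "R (j z) = i (R z)" for z
      by (simp add: R_def i_def LL'[OF rng] jP)
    show "i (i e) = - e" for e
      by (simp add: i_def LL'[OF inv] j(2) lin[OF L'(1)] L'(2))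
  qed
qed

text \<open>Compose a holomorphic chart around \<open>f p\<close> with a complex linear map that restricts to an
  isomorphism on the tangent space of the image of \<open>f\<close>. The result, pulled back by \<open>f\<close>, is a chart
  around \<open>p\<close> by the inverse function theorem, and it is holomorphic because its derivative is a
  composition of complex linear maps.\<close>

theorem integrable_acs_immersion:
  fixes A :: "('p, 'e::euclidean_space) chart set" and Q :: "('q, 'f::euclidean_space) chart set"
  assumes A: "smooth_atlas A" and Q: "smooth_atlas Q" and f: "smooth_map A Q f"
    and inj: "\<And>p. p \<in> points A \<Longrightarrow> inj_on (tangent_map A Q f p) (tangent_space A p)"
    and J: "integrable_acs Q J"
    and I: "\<And>p v. p \<in> points A \<Longrightarrow> v \<in> tangent_space A p \<Longrightarrow> I p v \<in> tangent_space A p"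
      "\<And>p v. p \<in> points A \<Longrightarrow> v \<in> tangent_space A p \<Longrightarrow>
        tangent_map A Q f p (I p v) = J (f p) (tangent_map A Q f p v)"
  shows "integrable_acs A I"
  unfolding integrable_acs_def
proof
  fix p assume p: "p \<in> points A"
  let ?a = "chart_at A p"
  note a = chart_at[OF p]
  have mf: "mdiff A Q f x" if "x \<in> points A" for x using smooth_map_mdiff[OF f A Q that] .
  have fp: "f p \<in> points Q" using mf[OF p] by (simp add: mdiff_def)
  obtain n j where n: "compatible_chart Q n" "f p \<in> fst n" and j: "linear j" "\<And>e. j (j e) = - e"
    and hol: "\<And>x v. x \<in> fst n \<Longrightarrow> v \<in> tangent_space Q x \<Longrightarrow>
          vec_coords Q n x (J x v) = j (vec_coords Q n x v)"
    using J fp unfolding integrable_acs_def by blast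
  have nQ: "smooth_atlas (insert n Q)" using n(1) by (simp add: compatible_chart_def)
  have holf: "j (vec_coords Q n (f x) (tangent_map A Q f x v)) =
      vec_coords Q n (f x) (tangent_map A Q f x (I x v))"
    if "x \<in> points A" "f x \<in> fst n" "v \<in> tangent_space A x" for x v
    using hol[OF that(2) tangent_map_tangent_space[OF mf[OF that(1)] Q]] I(2)[OF that(1,3)] by simp
  define L where "L = chart_deriv ?a n f p"
  note vt = vec_coords_tangent_map[OF mf[OF p] nQ n(2), folded L_def]
  have L: "linear L" "inj L"
    unfolding L_def
    using chart_diff_linear[OF vt(1)] tangent_map_injective_coords[OF A refl mf[OF p] nQ n(2) Q inj[OF p]] .
  have "j (L e) \<in> range L" for e
  proof -
    note v = coord_vec_tangent[OF A a, of e]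
    show ?thesis using holf[OF p n(2) v(1)] unfolding vt(2) v(2) by simp
  qed
  from complex_linear_left_inverse[OF L j this] obtain R i where
    R: "linear R" "\<And>e. R (L e) = e" "\<And>z. R (j z) = i (R z)" and i: "linear i" "\<And>e. i (i e) = - e"
    by metis
  obtain U where U: "open U" "snd ?a p \<in> U" "U \<subseteq> snd ?a ` (fst ?a \<inter> f -` fst n)"
    "smooth_on U (snd n \<circ> f \<circ> chart_inv ?a)"
    by (rule smooth_map_in_chart[OF A a f nQ n(2)])
  define h where "h = (\<lambda>y. R ((snd n \<circ> f \<circ> chart_inv ?a) y))"
  have smh: "smooth_on U h" unfolding h_def by (rule smooth_on_linear[OF U(1) R(1) U(4)])
  have blR: "bounded_linear R" using R(1) by (simp add: linear_conv_bounded_linear)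
  have "(h has_derivative (\<lambda>e. R (L e))) (at (snd ?a p))"
    unfolding h_def
    by (rule bounded_linear.has_derivative[OF blR chart_diff_has_derivative[OF vt(1), folded L_def]])
  then have "frechet_derivative h (at (snd ?a p)) = (\<lambda>e. e)"
    using frechet_derivative_at R(2) by force
  then have "inj (frechet_derivative h (at (snd ?a p)))" by simp
  from smooth_inverse_function_theorem[OF U(1) smh U(2) this]
  obtain U' V g where U': "open U'" "U' \<subseteq> U" "snd ?a p \<in> U'" "open V" "homeomorphism U' V h g"
    "smooth_on V g" .
  define N where "N = (chart_inv ?a ` U', h \<circ> snd ?a)"
  have N: "compatible_chart A N"
    unfolding N_def
    by (rule compatible_chart_diffeo[OF A a(1) U'(1) _ U'(4,5) smooth_on_subset[OF smh U'(2)] U'(6)])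
       (use U(3) U'(2) in blast)
  then have NA: "smooth_atlas (insert N A)" by (simp add: compatible_chart_def)
  have Nmem: "x \<in> fst ?a \<and> f x \<in> fst n \<and> snd N x = R (snd n (f x))" if x: "x \<in> fst N" for x
  proof -
    obtain y where y: "y \<in> U'" "x = chart_inv ?a y" using x by (auto simp: N_def)
    then obtain x' where x': "x' \<in> fst ?a" "f x' \<in> fst n" "y = snd ?a x'" using U(3) U'(2) by blast
    then have "x = x'" using y chart_inv_left[OF smooth_atlasD(1)[OF A a(1)]] by simp
    then show ?thesis using x' y by (simp add: N_def h_def)
  qed
  have pN: "p \<in> fst N"
    using U'(3) chart_inv_left[OF smooth_atlasD(1)[OF A a(1)] a(2)] by (force simp: N_def)
  \<comment> \<open>\<open>N\<close> is \<open>R \<circ> n \<circ> f\<close>, and the chain rule gives its effect on tangent vectors at every point.\<close>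
  have "vec_coords A N x v = R (vec_coords Q n (f x) (tangent_map A Q f x v))"
    if x: "x \<in> fst N" for x v
  proof -
    let ?b = "chart_at A x"
    have xA: "x \<in> points A" using points_memI[OF a(1)] Nmem[OF x] by blast
    note b = chart_at[OF xA]
    note vtx = vec_coords_tangent_map[OF mf[OF xA] nQ Nmem[OF x, THEN conjunct2, THEN conjunct1]]
    have tN: "chart_diff ?b N (\<lambda>x. x) x"
      by (rule transition_chart_diff[OF NA]) (use b x in simp_all)
    have inj_b: "inj_on (snd ?b) (fst ?b)" using smooth_atlasD(1)[OF A b(1)] .
    have "\<forall>\<^sub>F y in nhds (snd ?b x). y \<in> snd ?b ` (fst ?b \<inter> (\<lambda>x. x) -` fst N)"
      using tN unfolding chart_diff_def by blast
    then have ev: "\<forall>\<^sub>F y in nhds (snd ?b x).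
        R ((snd n \<circ> f \<circ> chart_inv ?b) y) = (snd N \<circ> (\<lambda>x. x) \<circ> chart_inv ?b) y"
    proof eventually_elim
      case (elim y)
      then obtain z where "z \<in> fst ?b" "z \<in> fst N" "y = snd ?b z" by blast
      then show ?case using Nmem[of z] by (simp add: chart_inv_left[OF inj_b])
    qed
    have "((\<lambda>y. R ((snd n \<circ> f \<circ> chart_inv ?b) y)) has_derivative (\<lambda>e. R (chart_deriv ?b n f x e)))
        (at (snd ?b x))"
      by (rule bounded_linear.has_derivative[OF blR chart_diff_has_derivative[OF vtx(1)]])
    then have "(snd N \<circ> (\<lambda>x. x) \<circ> chart_inv ?b has_derivative (\<lambda>e. R (chart_deriv ?b n f x e)))
        (at (snd ?b x))"
      by (rule has_derivative_transform_eventually)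
         (use ev in \<open>simp_all add: eventually_nhds_conv_at\<close>)
    then have "chart_deriv ?b N (\<lambda>x. x) x = (\<lambda>e. R (chart_deriv ?b n f x e))"
      unfolding chart_deriv_def[of ?b N] using frechet_derivative_at by metis
    then show ?thesis unfolding vec_coords_chart_deriv[of A N] vtx(2) by simp
  qed
  note coordN = this
  have "vec_coords A N x (I x v) = i (vec_coords A N x v)"
    if x: "x \<in> fst N" and v: "v \<in> tangent_space A x" for x v
  proof -
    have xA: "x \<in> points A" and fx: "f x \<in> fst n"
      using points_memI[OF a(1)] Nmem[OF x] by blast+
    show ?thesis
      unfolding coordN[OF x] holf[OF xA fx v, symmetric] R(3) ..
  qed
  then show "\<exists>c j. compatible_chart A c \<and> p \<in> fst c \<and> linear j \<and> (\<forall>e. j (j e) = - e) \<and>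
     (\<forall>x\<in>fst c. \<forall>v\<in>tangent_space A x.
        vec_coords A c x (I x v) = j (vec_coords A c x v))"
    using N pN i by blast
qed

text \<open>The algebraic identities for \<open>I\<close> hold because they hold for \<open>J\<close> and the differential of \<open>f\<close> is
  injective.\<close>

corollary almost_complex_structure_immersion:
  fixes A :: "('p, 'e::euclidean_space) chart set" and Q :: "('q, 'f::euclidean_space) chart set"
  assumes A: "smooth_atlas A" and Q: "smooth_atlas Q" and f: "smooth_map A Q f"
    and inj: "\<And>p. p \<in> points A \<Longrightarrow> inj_on (tangent_map A Q f p) (tangent_space A p)"
    and J: "almost_complex_structure Q J" "integrable_acs Q J"
    and I: "\<And>p v. p \<in> points A \<Longrightarrow> v \<in> tangent_space A p \<Longrightarrow> I p v \<in> tangent_space A p"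
      "\<And>p v. p \<in> points A \<Longrightarrow> v \<in> tangent_space A p \<Longrightarrow>
        tangent_map A Q f p (I p v) = J (f p) (tangent_map A Q f p v)"
  shows "almost_complex_structure A I \<and> integrable_acs A I"
proof
  show int: "integrable_acs A I" using integrable_acs_immersion[OF A Q f inj J(2) I] .
  show "almost_complex_structure A I"
  proof (rule integrable_imp_almost_complex_structure[OF A _ _ int])
    fix p assume p: "p \<in> points A"
    let ?T = "tangent_map A Q f p"
    note mf = smooth_map_mdiff[OF f A Q p]
    note sub = subspace_tangent_space[OF A, of p]
    have fp: "f p \<in> points Q" using mf by (simp add: mdiff_def)
    have T: "?T v \<in> tangent_space Q (f p)" for v using tangent_map_tangent_space[OF mf Q] .
    have Jlin: "linear_on (tangent_space Q (f p)) (J (f p))"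
      and JJ: "J (f p) (J (f p) w) = - w" if "w \<in> tangent_space Q (f p)" for w
      using J(1) fp that unfolding almost_complex_structure_def by blast+
    note eq = inj_onD[OF inj[OF p]]
    show "linear_on (tangent_space A p) (I p)"
      unfolding linear_on_def
    proof (intro conjI ballI allI)
      fix v w assume v: "v \<in> tangent_space A p" and w: "w \<in> tangent_space A p"
      show "I p (v + w) = I p v + I p w"
      proof (rule eq)
        show "?T (I p (v + w)) = ?T (I p v + I p w)"
          using Jlin[OF T] T unfolding tangent_map_linear(1)[OF mf] I(2)[OF p v] I(2)[OF p w]
            I(2)[OF p subspace_add[OF sub v w]] linear_on_def by blast
      qed (intro I(1) p v w subspace_add[OF sub])+
    next
      fix r v assume v: "v \<in> tangent_space A p"
      show "I p (r *\<^sub>R v) = r *\<^sub>R I p v"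
      proof (rule eq)
        show "?T (I p (r *\<^sub>R v)) = ?T (r *\<^sub>R I p v)"
          using Jlin[OF T] T unfolding tangent_map_linear(2)[OF mf] I(2)[OF p v]
            I(2)[OF p subspace_scale[OF sub v]] linear_on_def by blast
      qed (intro I(1) p v subspace_scale[OF sub])+
    qed
    fix v assume v: "v \<in> tangent_space A p"
    note Iv = I(1)[OF p v]
    have "I p (I p v) = - v"
    proof (rule eq)
      have "?T (- v) = - ?T v" using tangent_map_linear(2)[OF mf, of "-1" v] by simp
      then show "?T (I p (I p v)) = ?T (- v)"
        unfolding I(2)[OF p Iv] I(2)[OF p v] JJ[OF T] by simp
    qed (intro I(1) p v Iv subspace_neg[OF sub])+
    then show "I p v \<in> tangent_space A p \<and> I p (I p v) = - v" using Iv by simp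
  qed
qed

section \<open>The frame bundle\<close>

lemma linear_on_sum:
  assumes "subspace S" "linear_on S f" "finite I" "\<And>i. i \<in> I \<Longrightarrow> v i \<in> S"
  shows "f (\<Sum>i\<in>I. c i *\<^sub>R v i) = (\<Sum>i\<in>I. c i *\<^sub>R f (v i))"
  using assms(3,4)
proof (induction I rule: finite_induct)
  case empty
  have "f 0 = f (0 *\<^sub>R 0)" by simp
  also have "\<dots> = 0"
    using assms(1,2) subspace_0 unfolding linear_on_def by (metis scaleR_zero_left)
  finally show ?case by simp
next
  case (insert i I)
  have 1: "(\<Sum>i\<in>I. c i *\<^sub>R v i) \<in> S" "c i *\<^sub>R v i \<in> S" "v i \<in> S"
    using insert by (auto intro!: subspace_sum[OF assms(1)] subspace_scale[OF assms(1)])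
  then have "f (c i *\<^sub>R v i + (\<Sum>i\<in>I. c i *\<^sub>R v i)) = c i *\<^sub>R f (v i) + f (\<Sum>i\<in>I. c i *\<^sub>R v i)"
    using assms(2) by (simp add: linear_on_def)
  then show ?case using insert by simp
qed

text \<open>On \<open>CO(2)\<close>-orbits of frames this is the projection from the quotient bundle to \<open>M\<close>.\<close>

definition orbit_base :: "('m \<times> 'x) set \<Rightarrow> 'm" where
  "orbit_base X = (THE p. fst ` X = {p})"

lemma orbit_base_eq: "fst ` X = {p} \<Longrightarrow> orbit_base X = p"
  unfolding orbit_base_def by (rule the_equality) auto

text \<open>\<open>CO(2)\<close> is the multiplicative group of nonzero complex numbers.\<close>

definition CO2_mat :: "complex \<Rightarrow> real^2^2" where
  "CO2_mat z = vector [vector [Re z, - Im z], vector [Im z, Re z]]"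

lemma CO2_eq: "CO2 = CO2_mat ` (- {0})"
proof -
  have "CO2_mat (Complex u v) = vector [vector [u, - v], vector [v, u]]" for u v
    by (simp add: CO2_mat_def)
  moreover have "Complex u v \<noteq> 0 \<longleftrightarrow> u\<^sup>2 + v\<^sup>2 \<noteq> 0" for u v
    by (simp add: complex_eq_iff sum_power2_eq_zero_iff)
  ultimately have "CO2 = {CO2_mat (Complex u v) | u v. Complex u v \<noteq> 0}"
    unfolding CO2_def by simp
  also have "\<dots> = CO2_mat ` (- {0})"
    by (auto simp: image_iff) (metis complex.collapse)
  finally show ?thesis .
qed

lemma fst_CO2_orbit: "fst ` CO2_orbit k b = {fst b}"
proof -
  have "CO2_mat 1 \<in> CO2" unfolding CO2_eq by (rule imageI) simp
  then show ?thesis by (auto simp: CO2_orbit_def right_act_def image_image)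
qed

lemma orbit_base_CO2_orbit: "orbit_base (CO2_orbit k b) = fst b"
  by (rule orbit_base_eq[OF fst_CO2_orbit])

locale gl2_bundle =
  fixes k :: nat and A :: "('m, 'e::euclidean_space) chart set"
    and E :: "'m \<Rightarrow> 'v::real_vector set"
    and F :: "('m, 2, 'v) local_frame set"
    and \<Theta> :: "'m \<Rightarrow> (('v \<Rightarrow> real) \<Rightarrow> real) \<Rightarrow> ('m, 'e) tvec"
  assumes odd_k: "odd k" and gl2: "gl2_structure k A E F \<Theta>"
begin

lemma smooth_A: "smooth_atlas A"
  using gl2 by (simp add: gl2_structure_def smooth_manifold_def)

lemma local_frame:
  assumes "(U, s) \<in> F" "p \<in> U"
  shows "s 1 p \<noteq> s 2 p \<and> independent {s 1 p, s 2 p}" "E p = span {s 1 p, s 2 p}"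
proof -
  have *: "inj_on (\<lambda>i. s i p) UNIV" "independent ((\<lambda>i. s i p) ` UNIV)" "span ((\<lambda>i. s i p) ` UNIV) = E p"
    using gl2 assms unfolding gl2_structure_def vector_bundle_def by auto
  have im: "(\<lambda>i. s i p) ` UNIV = {s 1 p, s 2 p}" unfolding UNIV_2 by simp
  have "s 1 p \<noteq> s 2 p" using inj_onD[OF *(1), of 1 2] by auto
  then show "s 1 p \<noteq> s 2 p \<and> independent {s 1 p, s 2 p}" using *(2) im by simp
  show "E p = span {s 1 p, s 2 p}" using *(3) im by simp
qed

lemma Theta:
  assumes "p \<in> points A"
  shows "linear_on (sym_power k (E p)) (\<Theta> p)"
    "bij_betw (\<Theta> p) (sym_power k (E p)) (tangent_space A p)"
  using gl2 assms unfolding gl2_structure_def vector_bundle_iso_def by auto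

definition frame_of_E :: "'m \<Rightarrow> 'v \<Rightarrow> 'v \<Rightarrow> bool" where
  "frame_of_E p x y \<longleftrightarrow> p \<in> points A \<and> x \<noteq> y \<and> independent {x, y} \<and> span {x, y} = E p"

lemma frame_bundle_eq: "b \<in> frame_bundle k A E \<Theta> \<longleftrightarrow>
    (\<exists>p x y. b = (p, induced_frame k \<Theta> p x y) \<and> frame_of_E p x y)"
  by (auto simp: frame_bundle_def frame_of_E_def)

lemma frame_of_E_mem:
  assumes "frame_of_E p x y" shows "x \<in> E p" "y \<in> E p"
proof -
  have "E p = span {x, y}" using assms unfolding frame_of_E_def by blast
  then show "x \<in> E p" "y \<in> E p" by (simp_all only: span_base insertI1 insertI2)
qed

lemma sym_power_frame: "frame_of_E p x y \<Longrightarrow> sym_power k (E p) = subst_form x y ` hpoly k"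
  using sym_power_subst_form[of k x y] by (simp add: frame_of_E_def)

lemma sym_monom_sym_power:
  assumes "x \<in> E p" "y \<in> E p" "i \<le> k" shows "sym_monom k i x y \<in> sym_power k (E p)"
  unfolding sym_power_def sym_monom_def
  using assms
  by (intro span_base CollectI exI[of _ "replicate (k - i) x @ replicate i y"]) auto

lemma frame_map_induced:
  assumes "frame_of_E p x y" "V \<in> hpoly k"
  shows "frame_map k (induced_frame k \<Theta> p x y) V = \<Theta> p (subst_form x y V)"
proof -
  note xy = frame_of_E_mem[OF assms(1)]
  have p: "p \<in> points A" using assms(1) by (simp add: frame_of_E_def)
  have sub: "subspace (sym_power k (E p))" unfolding sym_power_def by (rule subspace_span)
  have mem: "sym_monom k i x y \<in> sym_power k (E p)" if "i \<in> {..k}" for i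
    using that by (intro sym_monom_sym_power xy) simp
  have "subst_form x y V = subst_form x y (\<Sum>i\<le>k. hcoeff k V i *\<^sub>R hmonom k i)"
    unfolding hcoeff_expand[OF assms(2)] ..
  also have "\<dots> = (\<Sum>i\<le>k. hcoeff k V i *\<^sub>R sym_monom k i x y)"
    unfolding linear_sum[OF linear_subst_form] subst_form_scale subst_form_hmonom ..
  finally have "\<Theta> p (subst_form x y V) = \<Theta> p (\<Sum>i\<le>k. hcoeff k V i *\<^sub>R sym_monom k i x y)"
    by (rule arg_cong)
  also have "\<dots> = (\<Sum>i\<le>k. hcoeff k V i *\<^sub>R \<Theta> p (sym_monom k i x y))"
    by (rule linear_on_sum[OF sub Theta(1)[OF p] finite_atMost mem])
  also have "\<dots> = frame_map k (induced_frame k \<Theta> p x y) V"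
    unfolding frame_map_def by (intro sum.cong) (simp_all add: induced_frame_def)
  finally show ?thesis by (rule sym)
qed

text \<open>A pair \<open>(x, y)\<close> makes \<open>hpoly k\<close> isomorphic to the symmetric power by \<open>subst_form\<close>, and \<open>\<Theta>\<close> is an
  isomorphism onto the tangent space; the frame is the image of the monomial basis.\<close>

lemma induced_frame_basis:
  assumes "frame_of_E p x y"
  defines "\<eta> \<equiv> induced_frame k \<Theta> p x y"
  shows "inj_on \<eta> {..k}" "independent (\<eta> ` {..k})" "span (\<eta> ` {..k}) = tangent_space A p"
proof -
  have p: "p \<in> points A" using assms(1) by (simp add: frame_of_E_def)
  note bij = Theta(2)[OF p, unfolded sym_power_frame[OF assms(1)]]
  have sumV: "(\<Sum>i\<le>k. c i *\<^sub>R \<eta> i) = \<Theta> p (subst_form x y (\<Sum>i\<le>k. c i *\<^sub>R hmonom k i))" for c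
    using frame_map_induced[OF assms(1) hpoly_sum, of c] by (simp add: frame_map_def hcoeff_sum \<eta>_def)
  have "\<forall>i\<in>{..k}. c i = 0" if c: "(\<Sum>i\<le>k. c i *\<^sub>R \<eta> i) = 0" for c
  proof -
    let ?V = "\<Sum>i\<le>k. c i *\<^sub>R hmonom k i"
    have "\<Theta> p (subst_form x y ?V) = \<Theta> p (subst_form x y 0)"
      using c sumV[of c] sumV[of "\<lambda>_. 0"] by simp
    moreover have "0 \<in> hpoly k" using subspace_0[OF subspace_hpoly] .
    ultimately have "subst_form x y ?V = subst_form x y 0"
      using bij hpoly_sum unfolding bij_betw_def by (meson imageI inj_onD)
    then have "subst_form x y ?V = 0" by (simp only: linear_0[OF linear_subst_form])
    moreover have "x \<noteq> y" "independent {x, y}" using assms(1) unfolding frame_of_E_def by blast+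
    ultimately have "?V = 0" using subst_form_eq_0 by blast
    then show ?thesis using hcoeff_sum[of _ k c] hcoeff_sum[of _ k "\<lambda>_. 0"] by simp
  qed
  then show "inj_on \<eta> {..k}" "independent (\<eta> ` {..k})"
    using family_basis[of "{..k}" \<eta>] by simp_all
  show "span (\<eta> ` {..k}) = tangent_space A p"
  proof
    have "\<eta> i \<in> tangent_space A p" if "i \<le> k" for i
      using that bij assms(1) hmonom_hpoly[of i k] unfolding bij_betw_def \<eta>_def induced_frame_def
      by (auto simp: subst_form_hmonom[symmetric])
    then show "span (\<eta> ` {..k}) \<subseteq> tangent_space A p"
      by (intro span_minimal subspace_tangent_space smooth_A) auto
    show "tangent_space A p \<subseteq> span (\<eta> ` {..k})"
    proof
      fix v assume "v \<in> tangent_space A p"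
      then obtain V where V: "V \<in> hpoly k" "v = \<Theta> p (subst_form x y V)"
        using bij unfolding bij_betw_def by auto
      then have "v = (\<Sum>i\<le>k. hcoeff k V i *\<^sub>R \<eta> i)" using sumV hcoeff_expand[OF V(1)] by simp
      moreover have "(\<Sum>i\<le>k. hcoeff k V i *\<^sub>R \<eta> i) \<in> span (\<eta> ` {..k})"
        by (intro span_sum span_scale span_base imageI)
      ultimately show "v \<in> span (\<eta> ` {..k})" by simp
    qed
  qed
qed

lemma frame_bundle_basis:
  assumes "b \<in> frame_bundle k A E \<Theta>"
  shows "inj_on (snd b) {..k}" "independent (snd b ` {..k})"
    "span (snd b ` {..k}) = tangent_space A (fst b)" "fst b \<in> points A"
  using assms induced_frame_basis by (auto simp: frame_bundle_eq frame_of_E_def)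

lemma right_act_induced:
  assumes "frame_of_E p x y"
  shows "right_act k (p, induced_frame k \<Theta> p x y) g =
    (p, induced_frame k \<Theta> p (g $ 1 $ 1 *\<^sub>R x + g $ 2 $ 1 *\<^sub>R y) (g $ 1 $ 2 *\<^sub>R x + g $ 2 $ 2 *\<^sub>R y))"
proof -
  let ?\<eta> = "induced_frame k \<Theta> p x y"
  have "(\<Sum>i\<le>k. rho k g i j *\<^sub>R ?\<eta> i) = \<Theta> p (sym_monom k j (g $ 1 $ 1 *\<^sub>R x + g $ 2 $ 1 *\<^sub>R y)
      (g $ 1 $ 2 *\<^sub>R x + g $ 2 $ 2 *\<^sub>R y))" if "j \<le> k" for j
    using frame_map_induced[OF assms hact_hmonom_hpoly[OF that, of g]]
    by (simp add: frame_map_def rho_def subst_form_hact subst_form_hmonom)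
  then show ?thesis by (auto simp: right_act_def induced_frame_def fun_eq_iff)
qed

lemma right_act_CO2_mat:
  assumes "frame_of_E p x y"
  shows "right_act k (p, induced_frame k \<Theta> p x y) (CO2_mat z) =
    (p, induced_frame k \<Theta> p (Re z *\<^sub>R x + Im z *\<^sub>R y) (Re z *\<^sub>R y - Im z *\<^sub>R x))"
  using right_act_induced[OF assms, of "CO2_mat z"] by (simp add: CO2_mat_def)

lemma rotate_rotate:
  fixes x y :: 'v
  defines "X \<equiv> \<lambda>z. Re z *\<^sub>R x + Im z *\<^sub>R y" and "Y \<equiv> \<lambda>z. Re z *\<^sub>R y - Im z *\<^sub>R x"
  shows "Re w *\<^sub>R X z + Im w *\<^sub>R Y z = X (z * w)" "Re w *\<^sub>R Y z - Im w *\<^sub>R X z = Y (z * w)"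
  unfolding X_def Y_def by (simp_all add: algebra_simps)

lemma frame_of_E_rotate:
  assumes "frame_of_E p x y" "z \<noteq> 0"
  shows "frame_of_E p (Re z *\<^sub>R x + Im z *\<^sub>R y) (Re z *\<^sub>R y - Im z *\<^sub>R x)" (is "frame_of_E p ?X ?Y")
proof -
  have ind: "a *\<^sub>R x + b *\<^sub>R y = 0 \<Longrightarrow> a = 0 \<and> b = 0" for a b
    using assms(1) independent_pair_iff[of x y] unfolding frame_of_E_def by blast
  have "a = 0 \<and> b = 0" if "a *\<^sub>R ?X + b *\<^sub>R ?Y = 0" for a b
  proof -
    have "(a * Re z - b * Im z) *\<^sub>R x + (a * Im z + b * Re z) *\<^sub>R y = 0"
      using that by (simp add: algebra_simps)
    from ind[OF this] have "Complex a b * z = 0" by (simp add: complex_eq_iff)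
    then have "Complex a b = 0" using assms(2) by simp
    then show ?thesis by (simp add: complex_eq_iff)
  qed
  then have "?X \<noteq> ?Y \<and> independent {?X, ?Y}" using independent_pair_iff by blast
  moreover have "span {?X, ?Y} = span {x, y}"
  proof
    show "span {?X, ?Y} \<subseteq> span {x, y}"
      by (rule span_minimal) (auto intro: span_add span_diff span_scale span_base)
    have "x = Re (inverse z) *\<^sub>R ?X + Im (inverse z) *\<^sub>R ?Y" "y = Re (inverse z) *\<^sub>R ?Y - Im (inverse z) *\<^sub>R ?X"
      using rotate_rotate[where z = z and w = "inverse z" and x = x and y = y] assms(2) by simp_all
    moreover have "Re (inverse z) *\<^sub>R ?X + Im (inverse z) *\<^sub>R ?Y \<in> span {?X, ?Y}"
      "Re (inverse z) *\<^sub>R ?Y - Im (inverse z) *\<^sub>R ?X \<in> span {?X, ?Y}"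
      by (auto intro: span_add span_diff span_scale span_base)
    ultimately have "x \<in> span {?X, ?Y}" "y \<in> span {?X, ?Y}" by simp_all
    then show "span {x, y} \<subseteq> span {?X, ?Y}" by (intro span_minimal) auto
  qed
  ultimately show ?thesis using assms(1) by (simp add: frame_of_E_def)
qed

lemma CO2_orbit_frame:
  assumes "frame_of_E p x y"
  shows "CO2_orbit k (p, induced_frame k \<Theta> p x y) =
    (\<lambda>z. (p, induced_frame k \<Theta> p (Re z *\<^sub>R x + Im z *\<^sub>R y) (Re z *\<^sub>R y - Im z *\<^sub>R x))) ` (- {0})"
  unfolding CO2_orbit_def CO2_eq image_image right_act_CO2_mat[OF assms] ..

text \<open>Every element of an orbit is a frame that generates the same orbit; so the frame used to transport
  \<open>Jpoly\<close> to the tangent space may be any representative of the value of the section.\<close>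

lemma CO2_orbit_eq:
  assumes "b \<in> frame_bundle k A E \<Theta>" "b' \<in> CO2_orbit k b"
  shows "b' \<in> frame_bundle k A E \<Theta>" "CO2_orbit k b' = CO2_orbit k b"
proof -
  obtain p x y where b: "b = (p, induced_frame k \<Theta> p x y)" "frame_of_E p x y"
    using assms(1) frame_bundle_eq by blast
  let ?X = "\<lambda>z. Re z *\<^sub>R x + Im z *\<^sub>R y" and ?Y = "\<lambda>z. Re z *\<^sub>R y - Im z *\<^sub>R x"
  let ?f = "\<lambda>z. (p, induced_frame k \<Theta> p (?X z) (?Y z))"
  obtain z where z: "z \<noteq> 0" "b' = ?f z"
    using assms(2) unfolding b(1) CO2_orbit_frame[OF b(2)] by blast
  note fz = frame_of_E_rotate[OF b(2) z(1)]
  show "b' \<in> frame_bundle k A E \<Theta>" using z fz frame_bundle_eq by blast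
  have "CO2_orbit k b' = (\<lambda>w. ?f (z * w)) ` (- {0})"
    unfolding z(2) CO2_orbit_frame[OF fz] rotate_rotate ..
  also have "\<dots> = ?f ` ((*) z ` (- {0}))" by (simp only: image_image)
  also have "(*) z ` (- {0}) = - {0}"
  proof
    show "- {0} \<subseteq> (*) z ` (- {0})"
    proof
      fix w :: complex assume "w \<in> - {0}"
      then have "w = z * (w / z)" "w / z \<in> - {0}" using z(1) by auto
      then show "w \<in> (*) z ` (- {0})" by blast
    qed
  qed (use z(1) in auto)
  finally show "CO2_orbit k b' = CO2_orbit k b" unfolding b(1) CO2_orbit_frame[OF b(2)] .
qed

section \<open>Charts of the frame bundle\<close>

text \<open>The defining property singles out one matrix because the frame determines the pair of vectors of
  \<open>E\<close> (as \<open>k\<close> is odd) and the local frame determines their coordinates.\<close>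

lemma frame_matrix:
  assumes "(U, s) \<in> F" "b \<in> frame_bundle k A E \<Theta>" "fst b \<in> U"
  defines "a \<equiv> frame_matrix k \<Theta> s b"
  shows "snd b = induced_frame k \<Theta> (fst b)
       (\<Sum>i\<in>UNIV. a $ i $ 1 *\<^sub>R s i (fst b)) (\<Sum>i\<in>UNIV. a $ i $ 2 *\<^sub>R s i (fst b))"
proof -
  obtain p x y where b: "b = (p, induced_frame k \<Theta> p x y)" "frame_of_E p x y"
    using assms(2) frame_bundle_eq by blast
  have pU: "p \<in> U" "p \<in> points A" using assms(3) b by (auto simp: frame_of_E_def)
  let ?s1 = "s 1 p" and ?s2 = "s 2 p"
  note s = local_frame[OF assms(1) pU(1)]
  have ind: "a = 0 \<and> b = 0" if "a *\<^sub>R ?s1 + b *\<^sub>R ?s2 = 0" for a b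
    using s(1) that independent_pair_iff[of ?s1 ?s2] by blast
  note xy = frame_of_E_mem[OF b(2)]
  then obtain a1 b1 a2 b2 where x: "x = a1 *\<^sub>R ?s1 + b1 *\<^sub>R ?s2" and y: "y = a2 *\<^sub>R ?s1 + b2 *\<^sub>R ?s2"
    unfolding s(2) span_pair by blast
  let ?P = "\<lambda>a. invertible a \<and> snd b = induced_frame k \<Theta> (fst b)
       (\<Sum>i\<in>UNIV. a $ i $ 1 *\<^sub>R s i (fst b)) (\<Sum>i\<in>UNIV. a $ i $ 2 *\<^sub>R s i (fst b))"
  let ?a = "vector [vector [a1, a2], vector [b1, b2]] :: real^2^2"
  have sums: "(\<Sum>i\<in>UNIV. (c::real^2^2) $ i $ j *\<^sub>R s i p) = c $ 1 $ j *\<^sub>R ?s1 + c $ 2 $ j *\<^sub>R ?s2" for c j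
    by (simp add: sum_2)
  have indxy: "a = 0 \<and> b = 0" if "a *\<^sub>R x + b *\<^sub>R y = 0" for a b
    using b(2) that independent_pair_iff[of x y] unfolding frame_of_E_def by blast
  have "det ?a \<noteq> 0"
  proof
    assume "det ?a = 0"
    then have d: "a1 * b2 = a2 * b1" by (simp add: det_2)
    have "b2 *\<^sub>R x + (- b1) *\<^sub>R y = (a1 * b2 - a2 * b1) *\<^sub>R ?s1" unfolding x y by (simp add: algebra_simps)
    then have "b1 = 0" "b2 = 0" using indxy[of b2 "- b1"] d by auto
    moreover have "a2 *\<^sub>R x + (- a1) *\<^sub>R y = (a2 * b1 - a1 * b2) *\<^sub>R ?s2" unfolding x y by (simp add: algebra_simps)
    then have "a1 = 0" "a2 = 0" using indxy[of a2 "- a1"] d by auto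
    ultimately have "x = 0" using x by simp
    then show False using indxy[of 1 0] by simp
  qed
  then have ex: "?P ?a" using b(1) x y by (simp add: invertible_det_nz sums)
  have uniq: "c = ?a" if c: "?P c" for c
  proof -
    let ?x = "c $ 1 $ 1 *\<^sub>R ?s1 + c $ 2 $ 1 *\<^sub>R ?s2" and ?y = "c $ 1 $ 2 *\<^sub>R ?s1 + c $ 2 $ 2 *\<^sub>R ?s2"
    have xy': "?x \<in> E p" "?y \<in> E p" unfolding s(2) span_pair by blast+
    have fr: "induced_frame k \<Theta> p x y = induced_frame k \<Theta> p ?x ?y" using c b(1) sums by simp
    have "sym_monom k i x y = sym_monom k i ?x ?y" if "i \<le> k" for i
    proof (rule inj_onD[OF bij_betw_imp_inj_on[OF Theta(2)[OF pU(2)]]])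
      show "\<Theta> p (sym_monom k i x y) = \<Theta> p (sym_monom k i ?x ?y)"
        using fun_cong[OF fr, of i] that by (simp add: induced_frame_def)
    qed (intro sym_monom_sym_power xy xy' that)+
    then have "x = ?x" "y = ?y" using sym_monom_determines_pair[OF odd_k] by blast+
    then have "(a1 - c $ 1 $ 1) *\<^sub>R ?s1 + (b1 - c $ 2 $ 1) *\<^sub>R ?s2 = 0"
      "(a2 - c $ 1 $ 2) *\<^sub>R ?s1 + (b2 - c $ 2 $ 2) *\<^sub>R ?s2 = 0"
      unfolding x y by (simp_all add: algebra_simps)
    from ind[OF this(1)] ind[OF this(2)] show ?thesis by (simp add: vec_eq_iff forall_2)
  qed
  have "a = ?a" unfolding a_def frame_matrix_def using ex uniq by (rule the_equality)
  then show ?thesis using ex by simp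
qed

lemma points_frame_atlas: "points (frame_atlas k A E F \<Theta>) = frame_bundle k A E \<Theta>"
proof
  show "frame_bundle k A E \<Theta> \<subseteq> points (frame_atlas k A E F \<Theta>)"
  proof
    fix b assume b: "b \<in> frame_bundle k A E \<Theta>"
    note p = frame_bundle_basis(4)[OF b]
    have "\<Union> (fst ` F) = points A" using gl2 by (simp add: gl2_structure_def vector_bundle_def)
    then obtain U s where U: "(U, s) \<in> F" "fst b \<in> U" using p by (metis UN_iff prod.collapse)
    let ?c = "chart_at A (fst b)"
    have "({b \<in> frame_bundle k A E \<Theta>. fst b \<in> fst ?c \<inter> U},
       \<lambda>b. (snd ?c (fst b), frame_matrix k \<Theta> s b)) \<in> frame_atlas k A E F \<Theta>"
      unfolding frame_atlas_def using chart_at(1)[OF p] U(1) by blast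
    from points_memI[OF this] show "b \<in> points (frame_atlas k A E F \<Theta>)"
      using b U(2) chart_at(2)[OF p] by simp
  qed
qed (auto simp: points_def frame_atlas_def)

lemma frame_atlas_chart:
  assumes "d \<in> frame_atlas k A E F \<Theta>"
  obtains c where "c \<in> A"
    "\<forall>b\<in>fst d. fst b \<in> fst c \<and> fst (snd d b) = snd c (fst b)" "inj_on (snd d) (fst d)"
proof -
  obtain c U s where d: "d = ({b \<in> frame_bundle k A E \<Theta>. fst b \<in> fst c \<inter> U},
       \<lambda>b. (snd c (fst b), frame_matrix k \<Theta> s b))" and c: "c \<in> A" "(U, s) \<in> F"
    using assms unfolding frame_atlas_def by blast
  have "inj_on (snd d) (fst d)"
  proof (rule inj_onI)
    fix b b' assume b: "b \<in> fst d" "b' \<in> fst d" "snd d b = snd d b'"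
    then have *: "fst b = fst b'" "frame_matrix k \<Theta> s b = frame_matrix k \<Theta> s b'"
      using inj_onD[OF smooth_atlasD(1)[OF smooth_A c(1)], of "fst b" "fst b'"] by (simp_all add: d)
    have "snd b = snd b'"
      using frame_matrix[OF c(2), of b] frame_matrix[OF c(2), of b'] b(1,2) * by (simp add: d)
    then show "b = b'" using * by (simp add: prod_eq_iff)
  qed
  note inj = this
  show ?thesis
  proof (rule that[OF c(1) _ inj])
    show "\<forall>b\<in>fst d. fst b \<in> fst c \<and> fst (snd d b) = snd c (fst b)"
      unfolding d by simp
  qed
qed

section \<open>The projection from the quotient bundle\<close>

abbreviation "B \<equiv> frame_atlas k A E F \<Theta>"
abbreviation "Q \<equiv> CO2_quotient_atlas k A E F \<Theta>"

lemma quotient_chart_diff: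
  assumes "\<gamma> \<in> Q" "d \<in> B" "b \<in> fst d" "CO2_orbit k b \<in> fst \<gamma>"
  shows "chart_diff d \<gamma> (CO2_orbit k) b"
proof (rule chart_diffI)
  show "inj_on (snd d) (fst d)" using frame_atlas_chart[OF assms(2)] by blast
qed (use assms in \<open>auto simp: CO2_quotient_atlas_def quotient_atlas_def\<close>)

text \<open>The quotient map is a submersion and so has smooth local sections. Composed with one of
  them, the projection of the frame bundle becomes the projection of the quotient.\<close>

lemma orbit_base_chart_diff:
  assumes "\<gamma> \<in> Q" "b \<in> frame_bundle k A E \<Theta>" "CO2_orbit k b \<in> fst \<gamma>"
  shows "\<exists>c\<in>A. chart_diff \<gamma> c orbit_base (CO2_orbit k b)"
proof -
  define d where "d = chart_at B b"
  have d: "d \<in> B" "b \<in> fst d"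
    using chart_at[of b B] assms(2) points_frame_atlas by (simp_all add: d_def)
  obtain c where c: "c \<in> A" "\<forall>b\<in>fst d. fst b \<in> fst c \<and> fst (snd d b) = snd c (fst b)"
    and inj_d: "inj_on (snd d) (fst d)"
    by (rule frame_atlas_chart[OF d(1)])
  let ?O = "snd d ` (fst d \<inter> CO2_orbit k -` fst \<gamma>)" and ?G = "snd \<gamma> \<circ> CO2_orbit k \<circ> chart_inv d"
  have \<gamma>: "inj_on (snd \<gamma>) (fst \<gamma>)" "open ?O" "smooth_on ?O ?G"
    "\<And>y. y \<in> ?O \<Longrightarrow> surj (frechet_derivative ?G (at y))"
    using assms(1) d(1) unfolding CO2_quotient_atlas_def quotient_atlas_def by auto
  have G: "?G (snd d b') = snd \<gamma> (CO2_orbit k b')" if "b' \<in> fst d" for b'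
    using chart_inv_left[OF inj_d that] by simp
  have y0: "snd d b \<in> ?O" using d assms(3) by blast
  obtain W s where W: "open W" "?G (snd d b) \<in> W" "smooth_on W s" "s ` W \<subseteq> ?O"
      "\<And>w. w \<in> W \<Longrightarrow> ?G (s w) = w"
    using submersion_local_section[OF \<gamma>(2,3) y0 \<gamma>(4)[OF y0]] by metis
  have W0: "snd \<gamma> (CO2_orbit k b) \<in> W" using W(2) unfolding G[OF d(2)] .
  have *: "w \<in> snd \<gamma> ` (fst \<gamma> \<inter> orbit_base -` fst c) \<and>
      (snd c \<circ> orbit_base \<circ> chart_inv \<gamma>) w = fst (s w)" if w: "w \<in> W" for w
  proof -
    obtain b' where b': "b' \<in> fst d" "CO2_orbit k b' \<in> fst \<gamma>" "s w = snd d b'" using W(4) w by blast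
    then have "w = snd \<gamma> (CO2_orbit k b')" using W(5)[OF w] G[OF b'(1)] by simp
    then show ?thesis
      using b' c(2)[rule_format, OF b'(1)] chart_inv_left[OF \<gamma>(1) b'(2)] by (auto simp: orbit_base_CO2_orbit)
  qed
  have "((\<lambda>w. fst (s w)) has_derivative
      (\<lambda>v. fst (frechet_derivative s (at (snd \<gamma> (CO2_orbit k b))) v))) (at (snd \<gamma> (CO2_orbit k b)))"
    by (rule bounded_linear.has_derivative[OF bounded_linear_fst smooth_on_has_derivative[OF W(3) W0]])
  then have "(snd c \<circ> orbit_base \<circ> chart_inv \<gamma> has_derivative
      (\<lambda>v. fst (frechet_derivative s (at (snd \<gamma> (CO2_orbit k b))) v))) (at (snd \<gamma> (CO2_orbit k b)))"
    by (rule has_derivative_transform_within_open[OF _ W(1) W0]) (simp only: *)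
  then have "(snd c \<circ> orbit_base \<circ> chart_inv \<gamma>) differentiable (at (snd \<gamma> (CO2_orbit k b)))"
    by (rule differentiableI)
  moreover have "\<forall>\<^sub>F w in nhds (snd \<gamma> (CO2_orbit k b)). w \<in> snd \<gamma> ` (fst \<gamma> \<inter> orbit_base -` fst c)"
    using eventually_nhds_in_open[OF W(1) W0] by eventually_elim (use * in blast)
  ultimately have "chart_diff \<gamma> c orbit_base (CO2_orbit k b)"
    unfolding chart_diff_def using assms(3) c(2)[rule_format, OF d(2)] \<gamma>(1) smooth_atlasD(1)[OF smooth_A c(1)]
    by (simp add: orbit_base_CO2_orbit)
  then show ?thesis using c(1) by blast
qed

lemma mdiff_orbit_base:
  assumes "b \<in> frame_bundle k A E \<Theta>" "CO2_orbit k b \<in> points Q"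
  shows "mdiff Q A orbit_base (CO2_orbit k b)"
proof -
  note \<gamma> = chart_at[OF assms(2)]
  obtain c where "c \<in> A" "chart_diff (chart_at Q (CO2_orbit k b)) c orbit_base (CO2_orbit k b)"
    using orbit_base_chart_diff[OF \<gamma>(1) assms(1) \<gamma>(2)] by blast
  then show ?thesis by (rule mdiffI[OF assms(2) smooth_A])
qed

lemma tangent_map_orbit_base:
  assumes "b \<in> frame_bundle k A E \<Theta>" "CO2_orbit k b \<in> points Q" "smooth_atlas Q"
  shows "tangent_map Q A orbit_base (CO2_orbit k b) (tangent_map B Q (CO2_orbit k) b v) =
    tangent_map B A fst b v"
proof -
  have bB: "b \<in> points B" using assms(1) points_frame_atlas by simp
  note d = chart_at[OF bB] and \<gamma> = chart_at[OF assms(2)]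
  have q: "mdiff B Q (CO2_orbit k) b"
    by (rule mdiffI[OF bB assms(3) \<gamma>(1) quotient_chart_diff[OF \<gamma>(1) d \<gamma>(2)]])
  note \<pi> = mdiff_orbit_base[OF assms(1,2)]
  have "tangent_map Q A orbit_base (CO2_orbit k b) (tangent_map B Q (CO2_orbit k) b v) =
      tangent_map B A (\<lambda>b. orbit_base (CO2_orbit k b)) b v"
    by (rule tangent_map_comp[OF q \<pi>])
  also have "(\<lambda>b. orbit_base (CO2_orbit k b)) = fst" by (simp add: orbit_base_CO2_orbit fun_eq_iff)
  finally show ?thesis .
qed

section \<open>Holomorphic sections\<close>

text \<open>The forms \<open>\<xi>\<^sup>k\<^sup>,\<^sup>j\<close> on the frame bundle are horizontal, so they are the pullbacks of covectors
  \<open>\<alpha>\<close> of the quotient that factor through the tangent space of \<open>M\<close>. Their pullbacks being among the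
  forms that define \<open>J\<close>, these \<open>\<alpha>\<close> are of type (1,0).\<close>

lemma xi_form_J:
  assumes J: "is_J_phi k A E F \<Theta> \<phi> J" and b: "b \<in> frame_bundle k A E \<Theta>" "CO2_orbit k b \<in> points Q"
    and Q: "smooth_atlas Q" and w: "w \<in> tangent_space Q (CO2_orbit k b)" and j: "j \<le> k div 2"
  defines "\<theta> \<equiv> \<lambda>w. frame_inv k (snd b) (tangent_map Q A orbit_base (CO2_orbit k b) w)"
  shows "xi k j (\<theta> (J (CO2_orbit k b) w)) = \<i> * xi k j (\<theta> w)"
proof -
  let ?T = "tangent_map Q A orbit_base (CO2_orbit k b)"
  define \<alpha> where "\<alpha> = (\<lambda>w. xi k j (\<theta> w))"
  note \<pi> = mdiff_orbit_base[OF b]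
  note fb = frame_bundle_basis[OF b(1)]
  have T: "?T w \<in> span (snd b ` {..k})" for w
    using tangent_map_tangent_space[OF \<pi> smooth_A] unfolding fb(3) orbit_base_CO2_orbit .
  have lin: "linear_on (tangent_space Q (CO2_orbit k b)) \<alpha>"
    unfolding linear_on_def \<alpha>_def \<theta>_def tangent_map_linear[OF \<pi>]
      frame_inv_add[OF fb(1,2) T T] frame_inv_scale[OF fb(1,2) T]
    using xi_add[OF odd_k frame_inv_hpoly frame_inv_hpoly] xi_scale[OF odd_k frame_inv_hpoly] by blast
  have "\<alpha> (tangent_map B Q (CO2_orbit k) b v) =
      (\<Sum>i\<le>k div 2. (if i = j then 1 else 0) * xi k i (soldering_form k A E F \<Theta> b v)) + 0 * zeta \<phi> b v" for v
  proof -
    have "(\<Sum>i\<le>k div 2. (if i = j then 1 else 0) * xi k i (soldering_form k A E F \<Theta> b v)) =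
        (\<Sum>i\<le>k div 2. if i = j then xi k i (soldering_form k A E F \<Theta> b v) else 0)"
      by (intro sum.cong) auto
    also have "\<dots> = xi k j (soldering_form k A E F \<Theta> b v)" using j by simp
    finally show ?thesis
      by (simp add: \<alpha>_def \<theta>_def tangent_map_orbit_base[OF b Q] soldering_form_def)
  qed
  then have "\<exists>a z. \<forall>v\<in>tangent_space B b. \<alpha> (tangent_map B Q (CO2_orbit k) b v) =
      (\<Sum>j\<le>k div 2. a j * xi k j (soldering_form k A E F \<Theta> b v)) + z * zeta \<phi> b v"
    by (intro exI[of _ "\<lambda>i. if i = j then 1 else 0"] exI[of _ 0] ballI)
  then have "\<forall>w\<in>tangent_space Q (CO2_orbit k b). \<alpha> (J (CO2_orbit k b) w) = \<i> * \<alpha> w"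
    using J b(1) lin unfolding is_J_phi_def Let_def by blast
  then show ?thesis using w by (simp add: \<alpha>_def)
qed

text \<open>Since \<open>orbit_base \<circ> \<sigma>\<close> is the identity, the differential of a section has a left inverse.\<close>

lemma
  assumes \<sigma>: "smooth_section k A E F \<Theta> \<sigma>" and Q: "smooth_atlas Q" and p: "p \<in> points A"
  shows section_mdiff: "mdiff A Q \<sigma> p"
    and section_base: "v \<in> tangent_space A p \<Longrightarrow>
      tangent_map Q A orbit_base (\<sigma> p) (tangent_map A Q \<sigma> p v) = v"
proof -
  show m: "mdiff A Q \<sigma> p"
    using smooth_map_mdiff[OF _ smooth_A Q p] \<sigma> by (simp add: smooth_section_def)
  obtain b where b: "b \<in> frame_bundle k A E \<Theta>" "\<sigma> p = CO2_orbit k b"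
    using \<sigma> p unfolding smooth_section_def by blast
  have \<pi>: "mdiff Q A orbit_base (\<sigma> p)"
    using mdiff_orbit_base[OF b(1)] m b(2) by (simp add: mdiff_def)
  have base: "orbit_base (\<sigma> x) = x" if "x \<in> points A" for x
    using \<sigma> that by (intro orbit_base_eq) (simp add: smooth_section_def)
  assume v: "v \<in> tangent_space A p"
  have id: "mdiff A A (\<lambda>x. x) p"
    by (rule mdiffI[OF p smooth_A chart_at(1)[OF p]], rule transition_chart_diff[OF smooth_A])
       (simp_all add: chart_at[OF p])
  have "tangent_map Q A orbit_base (\<sigma> p) (tangent_map A Q \<sigma> p v) =
      tangent_map A A (\<lambda>x. orbit_base (\<sigma> x)) p v"
    by (rule tangent_map_comp[OF m \<pi>])
  also have "\<dots> = tangent_map A A (\<lambda>x. x) p v"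
    using tangent_map_cong[OF id, of "\<lambda>x. orbit_base (\<sigma> x)"] base by simp
  also have "\<dots> = v" by (rule tangent_map_ident[OF v p])
  finally show "tangent_map Q A orbit_base (\<sigma> p) (tangent_map A Q \<sigma> p v) = v" .
qed

text \<open>By invariance \<open>J (d\<sigma> v) = d\<sigma> v'\<close> for some \<open>v'\<close>. The values of the forms \<open>\<xi>\<^sup>k\<^sup>,\<^sup>j\<close> on \<open>v'\<close> are
  \<open>\<i>\<close> times those on \<open>v\<close>, which identifies \<open>v'\<close>.\<close>

lemma holomorphic_section_J:
  assumes J: "is_J_phi k A E F \<Theta> \<phi> J" and hol: "holomorphic_section k A E F \<Theta> J \<sigma>"
    and Q: "smooth_atlas Q" and p: "p \<in> points A" and v: "v \<in> tangent_space A p"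
  shows "J_section k \<sigma> p v \<in> tangent_space A p"
    "tangent_map A Q \<sigma> p (J_section k \<sigma> p v) = J (\<sigma> p) (tangent_map A Q \<sigma> p v)"
proof -
  have \<sigma>: "smooth_section k A E F \<Theta> \<sigma>" using hol by (simp add: holomorphic_section_def)
  obtain b0 where b0: "b0 \<in> frame_bundle k A E \<Theta>" "\<sigma> p = CO2_orbit k b0"
    using \<sigma> p unfolding smooth_section_def by blast
  define b where "b = (SOME b. b \<in> \<sigma> p)"
  have "\<sigma> p \<noteq> {}" using fst_CO2_orbit[of k b0] b0(2) by auto
  then have "b \<in> CO2_orbit k b0" unfolding b_def b0(2)[symmetric] by (rule some_in_eq[THEN iffD2])
  note b = CO2_orbit_eq[OF b0(1) this]
  have \<sigma>p: "\<sigma> p = CO2_orbit k b" using b(2) b0(2) by simp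
  note m = section_mdiff[OF \<sigma> Q p]
  have bQ: "CO2_orbit k b \<in> points Q" using m \<sigma>p by (simp add: mdiff_def)
  have "fst ` \<sigma> p = {p}" using \<sigma> p by (simp add: smooth_section_def)
  then have fst_b: "fst b = p" using fst_CO2_orbit[of k b] \<sigma>p by simp
  note fb = frame_bundle_basis[OF b(1), unfolded fst_b]
  let ?\<eta> = "snd b"
  obtain v' where v': "v' \<in> tangent_space A p"
    "J (\<sigma> p) (tangent_map A Q \<sigma> p v) = tangent_map A Q \<sigma> p v'"
    using hol p v unfolding holomorphic_section_def Let_def by blast
  have "frame_inv k ?\<eta> v' = Jpoly k (frame_inv k ?\<eta> v)"
  proof (rule Jpoly_xi[OF odd_k frame_inv_hpoly])
    fix j assume j: "j \<le> k div 2"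
    have "tangent_map A Q \<sigma> p v \<in> tangent_space Q (CO2_orbit k b)"
      using tangent_map_tangent_space[OF m Q] \<sigma>p by simp
    from xi_form_J[OF J b(1) bQ Q this j]
    show "xi k j (frame_inv k ?\<eta> v') = \<i> * xi k j (frame_inv k ?\<eta> v)"
      unfolding \<sigma>p[symmetric] v'(2) section_base[OF \<sigma> Q p v'(1)] section_base[OF \<sigma> Q p v] .
  qed
  then have "J_section k \<sigma> p v = v'"
    using frame_map_inv[OF fb(1,2), of v'] v'(1) fb(3) unfolding J_section_def Let_def b_def by simp
  then show "J_section k \<sigma> p v \<in> tangent_space A p"
    "tangent_map A Q \<sigma> p (J_section k \<sigma> p v) = J (\<sigma> p) (tangent_map A Q \<sigma> p v)"
    using v' by simp_all
qed

end

theorem theorem6p3: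
  fixes A :: "('m, 'e::euclidean_space) chart set"
    and E :: "'m \<Rightarrow> 'v::real_vector set"
    and F :: "('m, 2, 'v) local_frame set"
    and \<Theta> :: "'m \<Rightarrow> (('v \<Rightarrow> real) \<Rightarrow> real) \<Rightarrow> ('m, 'e) tvec"
    and \<phi> :: "('m, 'e) fpoint \<Rightarrow> (('m, 'e) fpoint, 'e \<times> (real^2^2)) tvec \<Rightarrow> real^2^2"
    and J :: "('m, 'e) fpoint set \<Rightarrow> (('m, 'e) fpoint set, 'e \<times> complex) tvec \<Rightarrow>
                (('m, 'e) fpoint set, 'e \<times> complex) tvec"
    and \<sigma> :: "'m \<Rightarrow> ('m, 'e) fpoint set"
    and k :: nat
  assumes "even (k + 1)"
    and "gl2_structure k A E F \<Theta>"
    and "gl2_connection k A E F \<Theta> \<phi>"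
    and "is_J_phi k A E F \<Theta> \<phi> J"
    and "integrable_acs (CO2_quotient_atlas k A E F \<Theta>) J"
    and "holomorphic_section k A E F \<Theta> J \<sigma>"
  shows "almost_complex_structure A (J_section k \<sigma>) \<and> integrable_acs A (J_section k \<sigma>)"
proof (cases "points A = {}")
  case True
  then have "snd c ` fst c = {}" if "c \<in> A" for c using that by (auto simp: points_def)
  moreover have "smooth_on {} f" for f :: "'e \<Rightarrow> 'e" by (rule smooth_on_local) simp
  ultimately show ?thesis
    using True unfolding almost_complex_structure_def integrable_acs_def by simp
next
  case False
  then obtain p where p: "p \<in> points A" by blast
  let ?Q = "CO2_quotient_atlas k A E F \<Theta>"
  interpret gl2_bundle k A E F \<Theta>
    by standard (use assms(1,2) in simp_all)
  have \<sigma>: "smooth_section k A E F \<Theta> \<sigma>" "smooth_map A ?Q \<sigma>"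
    using assms(6) by (simp_all add: holomorphic_section_def smooth_section_def)
  have "\<sigma> p \<in> points ?Q" using \<sigma>(2) p by (auto simp: smooth_map_def)
  then obtain c where "compatible_chart ?Q c"
    using assms(5) unfolding integrable_acs_def by blast
  \<comment> \<open>Compatibility of \<open>c\<close> with the charts of the quotient includes that these form a smooth atlas.\<close>
  then have Q: "smooth_atlas ?Q"
    unfolding compatible_chart_def smooth_atlas_def by blast
  have inj: "inj_on (tangent_map A ?Q \<sigma> p) (tangent_space A p)" if "p \<in> points A" for p
    by (rule inj_on_inverseI[where g = "tangent_map ?Q A orbit_base (\<sigma> p)"])
       (rule section_base[OF \<sigma>(1) Q that])
  have "almost_complex_structure ?Q J" using assms(4) by (simp add: is_J_phi_def Let_def)
  from almost_complex_structure_immersion[OF smooth_A Q \<sigma>(2) inj this assms(5)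
      holomorphic_section_J[OF assms(4,6) Q]]
  show ?thesis .
qed

end
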